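(* Let $L$ be a regular forest language over a finite alphabet $A$, with syntactic forest algebra $(H_L,V_L)$ and syntactic morphism $\alpha_L:A^\Delta\to(H_L,V_L)$. Then $L$ is cca-piecewise testable if and only if both of the following hold: (i) $u^\omega h=u^\omega v h=v u^\omega h$ whenever $h\in H_L$ is a tree-type or $h=0$, and $u,v\in V_L$ are tree-context-types with $v\unlhd u$; (ii) $\omega\cdot h=\omega\cdot h+g=g+\omega\cdot h$ whenever $g,h\in H_L$ satisfy $g\unlhd h$.
   Context: Forests over a finite alphabet $A$ are finite, ordered, unranked, $A$-labelled forests (finite sequences of trees, with the empty forest $0$ allowed). A context is a forest over $A\cup\{\Box\}$ in which exactly one node has label $\Box$ (the hole) and that node is a leaf; $\Box$ alone is the empty context. $ps$ and $pq$ denote substitution of a forest $s$ or context $q$ in the hole of a context $p$; $s+t$ is concatenation. A tree-context is a nonempty context having one node that is an ancestor of all other nodes, including the hole. Forest algebra: a pair $(H,V)$ of monoids, $H$ additive (not necessarily commutative) with identity $0$, $V$ multiplicative with identity $\Box$, with a faithful monoidal left action of $V$ on $H$, such that for each $g\in H$ there are $g+\Box,\Box+g\in V$ with $(g+\Box)h=g+h$, $(\Box+g)h=h+g$ for all $h\in H$. $A^\Delta$ is the free forest algebra of all forests and contexts over $A$. For a forest language $L$ put $s\sim_L s'$ if for every context $p$, $ps\in L\iff ps'\in L$; for contexts, $p\sim_L p'$ if $ps\sim_L p's$ for all forests $s$. The quotient of $A^\Delta$ by $\sim_L$ is the syntactic forest algebra $(H_L,V_L)$ and the projection is the syntactic morphism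 $\alpha_L$. $L$ is regular iff $(H_L,V_L)$ is finite. cca-pieces: the closest common ancestor $x\sqcap y$ of nodes $x,y$ (if it exists) is the common ancestor (each node counting as an ancestor of itself) that is a descendant of all other common ancestors. A forest $s$ is a cca-piece of $t$, $s\unlhd t$, if there is an injective label-preserving map from nodes of $s$ to nodes of $t$ preserving the depth-first left-first order and the closest common ancestor relation; equivalently, $\unlhd$ is the reflexive transitive closure of the pairs $(pt,p\,a(t))$ with $p$ a context, $a\in A$, and $t$ a tree or empty (i.e. one repeatedly deletes a leaf or a node with exactly one child). For contexts, $p\unlhd q$ is defined in the same way, with the hole treated as a node and preserved. $L$ is cca-piecewise testable if there is $n>0$ such that membership of $t$ in $L$ depends only on the set of cca-pieces of $t$ of size (number of nodes) at most $n$. Relative to $\alpha_L$: for $v,w\in V_L$, $v\unlhd w$ means there are contexts $p\unlhd q$ over $A$ with $\alpha_L(p)=v$, $\alpha_L(q)=w$; for $g,h\in H_L$, $g\unlhd h$ means there are forests $s\unlhd t$ over $A$ with $\alpha_L(s)=g$, $\alpha_L(t)=h$. A tree-type is an element of $H_L$ that is the image under $\alpha_L$ of some tree; a tree-context-type is an element of $V_L$ that is the image of some tree-context. $\omega>0$ is an integer such that $v^\omega$ is idempotent for all $v\in V_L$ and $\omega\cdot h$ (sum of $\omega$ copies of $h$) is idempotent for all $h\in H_L$. *)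

theory Defs
  imports "HOL-Algebra.Group" "HOL-Library.Sublist"
begin

datatype 'a tree = Node (root: 'a) (children: "'a tree list")

type_synonym 'a forest = "'a tree list"

text \<open>
  \<open>Hole l r\<close> stands for $l + \Box + r$ and \<open>Layer l a p r\<close> for $l + a(p) + r$.
  The map \<open>ctx_forest\<close> recovers the context as a forest with one extra label
  \<open>None\<close> for the hole; see \<open>inj_ctx_forest\<close> and \<open>range_ctx_forest\<close>.
\<close>

datatype 'a ctx =
    Hole "'a forest" "'a forest"
  | Layer "'a forest" 'a "'a ctx" "'a forest"

abbreviation empty_ctx :: "'a ctx" where
  "empty_ctx \<equiv> Hole [] []"

primrec fill :: "'a ctx \<Rightarrow> 'a forest \<Rightarrow> 'a forest" where
  "fill (Hole l r) s = l @ s @ r"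
| "fill (Layer l a p r) s = l @ [Node a (fill p s)] @ r"

primrec pad :: "'a forest \<Rightarrow> 'a ctx \<Rightarrow> 'a forest \<Rightarrow> 'a ctx" where
  "pad f (Hole l r) g = Hole (f @ l) (r @ g)"
| "pad f (Layer l a p r) g = Layer (f @ l) a p (r @ g)"

primrec ctx_comp :: "'a ctx \<Rightarrow> 'a ctx \<Rightarrow> 'a ctx" where
  "ctx_comp (Hole l r) q = pad l q r"
| "ctx_comp (Layer l a p r) q = Layer l a (ctx_comp p q) r"

primrec ctx_forest :: "'a ctx \<Rightarrow> 'a option forest" where
  "ctx_forest (Hole l r) = map (map_tree Some) l @ [Node None []] @ map (map_tree Some) r"
| "ctx_forest (Layer l a p r) =
     map (map_tree Some) l @ [Node (Some a) (ctx_forest p)] @ map (map_tree Some) r"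

lemma fill_pad [simp]: "fill (pad l p r) s = l @ fill p s @ r"
  by (cases p) auto

lemma fill_ctx_comp [simp]: "fill (ctx_comp p q) s = fill p (fill q s)"
  by (induction p) auto

lemma pad_empty [simp]: "pad [] p [] = p"
  by (cases p) auto

lemma pad_pad [simp]: "pad l (pad l' p r') r = pad (l @ l') p (r' @ r)"
  by (cases p) auto

lemma ctx_comp_pad [simp]: "ctx_comp (pad l p r) q = pad l (ctx_comp p q) r"
  by (cases p) auto

text \<open>
  A node is addressed by the nonempty list of child indices leading to it from the top
  level. Hence \<open>prefix\<close> is the (reflexive) ancestor relation and \<open>lexord less_than\<close>,
  in which proper prefixes come first, is the depth-first left-first order.
\<close>

fun is_node :: "'a forest \<Rightarrow> nat list \<Rightarrow> bool" where
  "is_node f [] \<longleftrightarrow> False"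
| "is_node f (i # x) \<longleftrightarrow> i < length f \<and> (x = [] \<or> is_node (children (f ! i)) x)"

definition nodes :: "'a forest \<Rightarrow> nat list set" where
  "nodes f = {x. is_node f x}"

fun label :: "'a forest \<Rightarrow> nat list \<Rightarrow> 'a" where
  "label f [] = undefined"
| "label f (i # x) = (if x = [] then root (f ! i) else label (children (f ! i)) x)"

definition is_cca :: "'a forest \<Rightarrow> nat list \<Rightarrow> nat list \<Rightarrow> nat list \<Rightarrow> bool" where
  "is_cca f x y z \<longleftrightarrow> z \<in> nodes f \<and> prefix z x \<and> prefix z y \<and>
     (\<forall>w \<in> nodes f. prefix w x \<and> prefix w y \<longrightarrow> prefix w z)"

definition cca :: "'a forest \<Rightarrow> nat list \<Rightarrow> nat list \<Rightarrow> nat list option" where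
  "cca f x y = (if \<exists>z. is_cca f x y z then Some (THE z. is_cca f x y z) else None)"

lemma nodes_eq: "nodes f = (\<Union>i<length f. (#) i ` insert [] (nodes (children (f ! i))))"
proof -
  have "is_node f x \<longleftrightarrow> x \<in> (\<Union>i<length f. (#) i ` insert [] (nodes (children (f ! i))))" for x
    by (cases x) (auto simp: nodes_def)
  then show ?thesis
    by (auto simp: nodes_def)
qed

lemma finite_nodes [simp]: "finite (nodes f)"
proof (induction "size_list size f" arbitrary: f rule: less_induct)
  case less
  have "finite (nodes (children (f ! i)))" if "i < length f" for i
  proof (rule less)
    have "size (f ! i) \<le> size_list size f"
      using that by (intro size_list_estimation'[of "f ! i"]) auto
    moreover have "size_list size (children (f ! i)) < size (f ! i)"
      by (cases "f ! i") auto
    ultimately show "size_list size (children (f ! i)) < size_list size f"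
      by linarith
  qed
  then show ?case
    by (subst nodes_eq) auto
qed

lemma cca_Some_iff: "cca f x y = Some z \<longleftrightarrow> is_cca f x y z"
proof -
  have "(THE w. is_cca f x y w) = z" if "is_cca f x y z" for z
    using that by (intro the_equality) (auto simp: is_cca_def intro: prefix_order.antisym)
  then show ?thesis
    by (auto simp: cca_def)
qed

definition hole_at :: "'a option forest \<Rightarrow> nat list \<Rightarrow> bool" where
  "hole_at f x \<longleftrightarrow> x \<in> nodes f \<and> label f x = None \<and>
     (\<forall>y \<in> nodes f. label f y = None \<longrightarrow> y = x) \<and> (\<forall>y \<in> nodes f. \<not> strict_prefix x y)"

definition is_context :: "'a option forest \<Rightarrow> bool" where
  "is_context f \<longleftrightarrow> (\<exists>x. hole_at f x)"

lemma labels_eq: "label f ` nodes f = (\<Union>t \<in> set f. set_tree t)"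
proof (induction "size_list size f" arbitrary: f rule: less_induct)
  case less
  have IH: "label (children t) ` nodes (children t) = (\<Union>u \<in> set (children t). set_tree u)"
    if "t \<in> set f" for t
  proof (rule less)
    have "size t \<le> size_list size f"
      using that by (intro size_list_estimation') auto
    moreover have "size_list size (children t) < size t"
      by (cases t) auto
    ultimately show "size_list size (children t) < size_list size f"
      by linarith
  qed
  have "label f ` nodes f = (\<Union>i<length f. label f ` (#) i ` insert [] (nodes (children (f ! i))))"
    by (subst nodes_eq) (simp add: image_UN)
  also have "\<dots> = (\<Union>i<length f. set_tree (f ! i))"
  proof (intro SUP_cong refl)
    fix i assume "i \<in> {..<length f}"
    then have i: "i < length f"
      by simp
    have "label f ` (#) i ` insert [] (nodes (children (f ! i)))
          = insert (root (f ! i)) (label (children (f ! i)) ` nodes (children (f ! i)))"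
      by (auto simp: image_image nodes_def image_iff split: if_splits)
    also have "\<dots> = set_tree (f ! i)"
      using IH[OF nth_mem[OF i]] by (cases "f ! i") simp
    finally show "label f ` (#) i ` insert [] (nodes (children (f ! i))) = set_tree (f ! i)" .
  qed
  also have "\<dots> = (\<Union>t \<in> set f. set_tree t)"
    by (auto simp: set_conv_nth)
  finally show ?case .
qed

lemma None_not_in_tree_iff:
  "None \<notin> set_tree t \<longleftrightarrow>
     root t \<noteq> None \<and> (\<forall>y. is_node (children t) y \<longrightarrow> label (children t) y \<noteq> None)"
proof -
  have "set_tree t = insert (root t) (label (children t) ` nodes (children t))"
    by (cases t) (simp add: labels_eq)
  then show ?thesis
    by (simp add: nodes_def image_iff eq_commute[of None] del: not_None_eq)
qed

lemma is_node_not_Nil: "is_node f x \<Longrightarrow> x \<noteq> []"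
  by auto

lemma no_is_node_iff: "(\<forall>z. \<not> is_node f z) \<longleftrightarrow> f = []"
proof
  assume "\<forall>z. \<not> is_node f z"
  then have "\<not> is_node f [0]" by blast
  then show "f = []" by simp
next
  assume "f = []"
  then show "\<forall>z. \<not> is_node f z"
    by (metis is_node.elims(2) list.size(3) not_less_zero)
qed

lemma hole_at_Cons:
  "hole_at f (i # x) \<longleftrightarrow> i < length f \<and> (\<forall>j < length f. j \<noteq> i \<longrightarrow> None \<notin> set_tree (f ! j)) \<and>
     (if x = [] then f ! i = Node None []
      else root (f ! i) \<noteq> None \<and> hole_at (children (f ! i)) x)"
proof -
  let ?N = "\<lambda>j z. is_node (children (f ! j)) z" and ?l = "\<lambda>j z. label (children (f ! j)) z"
  have all_nodes: "(\<forall>y \<in> nodes f. P y) \<longleftrightarrow>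
      (\<forall>j < length f. P [j] \<and> (\<forall>z. ?N j z \<longrightarrow> P (j # z)))" for P
  proof (intro iffI ballI)
    fix y assume "\<forall>j < length f. P [j] \<and> (\<forall>z. ?N j z \<longrightarrow> P (j # z))" "y \<in> nodes f"
    then show "P y" by (cases y) (auto simp: nodes_def)
  qed (auto simp: nodes_def)
  have lab: "label f (j # z) = ?l j z" if "?N j z" for j z
    using is_node_not_Nil[OF that] by simp
  have "hole_at f (i # x) \<longleftrightarrow> i < length f \<and> (x = [] \<or> ?N i x) \<and> label f (i # x) = None \<and>
      (\<forall>j < length f. (root (f ! j) = None \<longrightarrow> j = i \<and> x = []) \<and>
         (\<forall>z. ?N j z \<longrightarrow> ?l j z = None \<longrightarrow> j = i \<and> z = x)) \<and>
      (\<forall>z. ?N i z \<longrightarrow> \<not> strict_prefix x z)"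
    (is "_ \<longleftrightarrow> ?R")
    unfolding hole_at_def all_nodes using lab by (simp add: nodes_def) blast
  also have "?R \<longleftrightarrow> i < length f \<and> (\<forall>j < length f. j \<noteq> i \<longrightarrow> None \<notin> set_tree (f ! j)) \<and>
     (if x = [] then f ! i = Node None []
      else root (f ! i) \<noteq> None \<and> hole_at (children (f ! i)) x)"
  proof (cases "x = []")
    case True
    have "(\<forall>z. ?N i z \<longrightarrow> \<not> strict_prefix [] z) \<longleftrightarrow> (\<forall>z. \<not> ?N i z)"
      by (metis is_node_not_Nil strict_prefix_simps(2) list.exhaust)
    moreover have "f ! i = Node None [] \<longleftrightarrow> root (f ! i) = None \<and> children (f ! i) = []"
      by (cases "f ! i") auto
    ultimately show ?thesis
      using True unfolding None_not_in_tree_iff no_is_node_iff[symmetric] by (simp del: not_None_eq) blast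
  next
    case False
    then have "hole_at (children (f ! i)) x \<longleftrightarrow> ?N i x \<and> ?l i x = None \<and>
        (\<forall>z. ?N i z \<longrightarrow> ?l i z = None \<longrightarrow> z = x) \<and> (\<forall>z. ?N i z \<longrightarrow> \<not> strict_prefix x z)"
      by (simp add: hole_at_def nodes_def)
    moreover have "label f (i # x) = ?l i x"
      using False by simp
    ultimately show ?thesis
      using False unfolding None_not_in_tree_iff by (simp del: not_None_eq label.simps) blast
  qed
  finally show ?thesis .
qed

lemma not_hole_at_Nil: "\<not> hole_at f []"
  by (simp add: hole_at_def nodes_def)

lemma None_not_in_map_tree_Some [simp]: "None \<notin> set_tree (map_tree Some t)"
  by (auto simp: tree.set_map)

lemma is_context_ctx_forest: "is_context (ctx_forest p)"
proof (induction p)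
  case (Hole l r)
  have "hole_at (ctx_forest (Hole l r)) [length l]"
    by (auto simp: hole_at_Cons nth_append nth_Cons' simp del: One_nat_def)
  then show ?case
    by (auto simp: is_context_def)
next
  case (Layer l a p r)
  then obtain x where x: "hole_at (ctx_forest p) x"
    by (auto simp: is_context_def)
  then have "x \<noteq> []"
    by (auto simp: not_hole_at_Nil)
  with x have "hole_at (ctx_forest (Layer l a p r)) (length l # x)"
    by (auto simp: hole_at_Cons nth_append nth_Cons' simp del: One_nat_def)
  then show ?case
    by (auto simp: is_context_def)
qed

lemma ex_map_tree_Some: "None \<notin> set_tree t \<Longrightarrow> \<exists>u. t = map_tree Some u"
proof
  assume "None \<notin> set_tree t"
  then have "map_tree (Some \<circ> the) t = map_tree id t"
    by (intro tree.map_cong) (metis comp_apply id_apply option.collapse)+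
  then show "t = map_tree Some (map_tree the t)"
    by (simp add: tree.map_comp tree.map_id)
qed

lemma ex_map_map_tree_Some: "\<forall>t \<in> set f. None \<notin> set_tree t \<Longrightarrow> \<exists>g. f = map (map_tree Some) g"
  by (metis ex_map_conv ex_map_tree_Some)

lemma hole_at_ctx_forest: "hole_at f x \<Longrightarrow> \<exists>p. f = ctx_forest p"
proof (induction x arbitrary: f)
  case Nil
  then show ?case by (simp add: not_hole_at_Nil)
next
  case (Cons i x)
  then have i: "i < length f" and others: "\<forall>j < length f. j \<noteq> i \<longrightarrow> None \<notin> set_tree (f ! j)"
    by (auto simp: hole_at_Cons)
  have "\<forall>t \<in> set (take i f). None \<notin> set_tree t" "\<forall>t \<in> set (drop (Suc i) f). None \<notin> set_tree t"
    using others by (auto simp: in_set_conv_nth)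
  then obtain l r where "take i f = map (map_tree Some) l" "drop (Suc i) f = map (map_tree Some) r"
    by (metis ex_map_map_tree_Some)
  then have f: "f = map (map_tree Some) l @ [f ! i] @ map (map_tree Some) r"
    using id_take_nth_drop[OF i] by simp
  show ?case
  proof (cases "x = []")
    case True
    then have "f ! i = Node None []"
      using Cons.prems by (simp add: hole_at_Cons)
    then show ?thesis
      using f by (metis ctx_forest.simps(1))
  next
    case False
    then obtain a where a: "root (f ! i) = Some a" and "hole_at (children (f ! i)) x"
      using Cons.prems by (auto simp: hole_at_Cons)
    then obtain p where "children (f ! i) = ctx_forest p"
      using Cons.IH by blast
    with a have "f ! i = Node (Some a) (ctx_forest p)"
      by (cases "f ! i") auto
    then show ?thesis
      using f by (metis ctx_forest.simps(2))
  qed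
qed

lemma range_ctx_forest: "range ctx_forest = {f. is_context f}"
  using is_context_ctx_forest hole_at_ctx_forest unfolding is_context_def by blast

lemma append_Cons_eq_unique:
  assumes "l @ h # r = l' @ h' # r'" "P h" "P h'" "\<forall>t \<in> set l. \<not> P t" "\<forall>t \<in> set l'. \<not> P t"
  shows "l = l' \<and> h = h' \<and> r = r'"
  using assms
proof (induction l arbitrary: l')
  case Nil
  then show ?case by (cases l') auto
next
  case (Cons a l)
  then show ?case by (cases l') auto
qed

lemma None_in_ctx_forest: "\<exists>t \<in> set (ctx_forest p). None \<in> set_tree t"
  by (induction p) auto

lemma inj_ctx_forest: "inj ctx_forest"
proof (rule injI)
  have inj: "inj (map (map_tree (Some :: 'a \<Rightarrow> 'a option)))"
    by (intro list.inj_map tree.inj_map) auto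
  fix p q :: "'a ctx"
  assume "ctx_forest p = ctx_forest q"
  then show "p = q"
  proof (induction p arbitrary: q)
    case (Hole l r)
    have *: "None \<notin> (\<Union>t\<in>set (map (map_tree Some) l). set_tree t)" for l :: "'a forest"
      by auto
    show ?case
    proof (cases q)
      case (Hole l' r')
      with Hole.prems have "map (map_tree Some) l = map (map_tree Some) l' \<and>
          map (map_tree Some) r = map (map_tree Some) r'"
        using append_Cons_eq_unique[of "map (map_tree Some) l" "Node None []" "map (map_tree Some) r"
            "map (map_tree Some) l'" "Node None []" "map (map_tree Some) r'" "\<lambda>t. None \<in> set_tree t"]
        by auto
      with Hole show ?thesis
        using inj by (auto dest: injD)
    next
      case (Layer l' a p' r')
      with Hole.prems show ?thesis
        using append_Cons_eq_unique[of "map (map_tree Some) l" "Node None []" "map (map_tree Some) r"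
            "map (map_tree Some) l'" "Node (Some a) (ctx_forest p')" "map (map_tree Some) r'"
            "\<lambda>t. None \<in> set_tree t"] None_in_ctx_forest[of p']
        by auto
    qed
  next
    case (Layer l a p r)
    show ?case
    proof (cases q)
      case (Hole l' r')
      with Layer.prems show ?thesis
        using append_Cons_eq_unique[of "map (map_tree Some) l" "Node (Some a) (ctx_forest p)"
            "map (map_tree Some) r" "map (map_tree Some) l'" "Node None []" "map (map_tree Some) r'"
            "\<lambda>t. None \<in> set_tree t"] None_in_ctx_forest[of p]
        by auto
    next
      case q: (Layer l' a' p' r')
      with Layer.prems have "map (map_tree Some) l = map (map_tree Some) l' \<and>
          Node (Some a) (ctx_forest p) = Node (Some a') (ctx_forest p') \<and>
          map (map_tree Some) r = map (map_tree Some) r'"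
        using append_Cons_eq_unique[of "map (map_tree Some) l" "Node (Some a) (ctx_forest p)"
            "map (map_tree Some) r" "map (map_tree Some) l'" "Node (Some a') (ctx_forest p')"
            "map (map_tree Some) r'" "\<lambda>t. None \<in> set_tree t"]
            None_in_ctx_forest[of p] None_in_ctx_forest[of p']
        by auto
      with q Layer.IH[of p'] show ?thesis
        using inj by (auto dest: injD)
    qed
  qed
qed

text \<open>
  The closest common ancestor is preserved as a partial operation: nodes without a common
  ancestor are mapped to nodes without a common ancestor. Without this, $b + c$ would be
  a piece of $a(b + c)$, although no deletion of leaves and of nodes with exactly one child
  leads from the latter to the former.
\<close>

definition cca_piece :: "'a forest \<Rightarrow> 'a forest \<Rightarrow> bool" (infix \<open>\<unlhd>\<^sub>F\<close> 50) where
  "s \<unlhd>\<^sub>F t \<longleftrightarrow> (\<exists>\<phi>. inj_on \<phi> (nodes s) \<and> \<phi> ` nodes s \<subseteq> nodes t \<and>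
     (\<forall>x \<in> nodes s. label t (\<phi> x) = label s x) \<and>
     (\<forall>x \<in> nodes s. \<forall>y \<in> nodes s.
        (x, y) \<in> lexord less_than \<longrightarrow> (\<phi> x, \<phi> y) \<in> lexord less_than) \<and>
     (\<forall>x \<in> nodes s. \<forall>y \<in> nodes s. cca t (\<phi> x) (\<phi> y) = map_option \<phi> (cca s x y)))"

definition ctx_piece :: "'a ctx \<Rightarrow> 'a ctx \<Rightarrow> bool" (infix \<open>\<unlhd>\<^sub>C\<close> 50) where
  "p \<unlhd>\<^sub>C q \<longleftrightarrow> ctx_forest p \<unlhd>\<^sub>F ctx_forest q"

definition cca_pieces_upto :: "nat \<Rightarrow> 'a forest \<Rightarrow> 'a forest set" where
  "cca_pieces_upto n t = {s. s \<unlhd>\<^sub>F t \<and> card (nodes s) \<le> n}"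

definition cca_piecewise_testable :: "'a forest set \<Rightarrow> bool" where
  "cca_piecewise_testable L \<longleftrightarrow>
     (\<exists>n>0. \<forall>t t'. cca_pieces_upto n t = cca_pieces_upto n t' \<longrightarrow> (t \<in> L \<longleftrightarrow> t' \<in> L))"

definition is_tree :: "'a forest \<Rightarrow> bool" where
  "is_tree s \<longleftrightarrow> (\<exists>t. s = [t])"

definition is_tree_ctx :: "'a ctx \<Rightarrow> bool" where
  "is_tree_ctx p \<longleftrightarrow> p \<noteq> empty_ctx \<and>
     (\<exists>x \<in> nodes (ctx_forest p). \<forall>y \<in> nodes (ctx_forest p). prefix x y)"

text \<open>
  The additive monoid \<open>H\<close> is also an HOL-Algebra monoid, so its operation is
  \<open>\<otimes>\<^bsub>H\<^esub>\<close>, its identity $0$ is \<open>\<one>\<^bsub>H\<^esub>\<close>, and $n \cdot h$ is \<open>h [^]\<^bsub>H\<^esub> n\<close>.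
\<close>

locale forest_algebra = H: monoid H + V: monoid V
  for H :: "('h, 'm) monoid_scheme" and V :: "('v, 'n) monoid_scheme"
    and act :: "'v \<Rightarrow> 'h \<Rightarrow> 'h" +
  assumes act_closed: "\<lbrakk>v \<in> carrier V; h \<in> carrier H\<rbrakk> \<Longrightarrow> act v h \<in> carrier H"
    and act_one: "h \<in> carrier H \<Longrightarrow> act \<one>\<^bsub>V\<^esub> h = h"
    and act_mult: "\<lbrakk>v \<in> carrier V; w \<in> carrier V; h \<in> carrier H\<rbrakk> \<Longrightarrow>
           act (v \<otimes>\<^bsub>V\<^esub> w) h = act v (act w h)"
    and faithful: "\<lbrakk>v \<in> carrier V; w \<in> carrier V; \<And>h. h \<in> carrier H \<Longrightarrow> act v h = act w h\<rbrakk> \<Longrightarrow>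
           v = w"
    and insert_left: "g \<in> carrier H \<Longrightarrow>
           \<exists>v \<in> carrier V. \<forall>h \<in> carrier H. act v h = g \<otimes>\<^bsub>H\<^esub> h"
    and insert_right: "g \<in> carrier H \<Longrightarrow>
           \<exists>v \<in> carrier V. \<forall>h \<in> carrier H. act v h = h \<otimes>\<^bsub>H\<^esub> g"

definition syn_rel :: "'a forest set \<Rightarrow> ('a forest \<times> 'a forest) set" where
  "syn_rel L = {(s, s'). \<forall>p. fill p s \<in> L \<longleftrightarrow> fill p s' \<in> L}"

definition syn_ctx_rel :: "'a forest set \<Rightarrow> ('a ctx \<times> 'a ctx) set" where
  "syn_ctx_rel L = {(p, p'). \<forall>s. (fill p s, fill p' s) \<in> syn_rel L}"

definition syn :: "'a forest set \<Rightarrow> 'a forest \<Rightarrow> 'a forest set" where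
  "syn L s = syn_rel L `` {s}"

definition syn_ctx :: "'a forest set \<Rightarrow> 'a ctx \<Rightarrow> 'a ctx set" where
  "syn_ctx L p = syn_ctx_rel L `` {p}"

definition syn_H :: "'a forest set \<Rightarrow> 'a forest set monoid" where
  "syn_H L = \<lparr>carrier = UNIV // syn_rel L,
              mult = (\<lambda>g h. \<Union>s\<in>g. \<Union>t\<in>h. syn L (s @ t)),
              one = syn L []\<rparr>"

definition syn_V :: "'a forest set \<Rightarrow> 'a ctx set monoid" where
  "syn_V L = \<lparr>carrier = UNIV // syn_ctx_rel L,
              mult = (\<lambda>v w. \<Union>p\<in>v. \<Union>q\<in>w. syn_ctx L (ctx_comp p q)),
              one = syn_ctx L empty_ctx\<rparr>"

definition syn_act :: "'a forest set \<Rightarrow> 'a ctx set \<Rightarrow> 'a forest set \<Rightarrow> 'a forest set" where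
  "syn_act L v h = (\<Union>p\<in>v. \<Union>s\<in>h. syn L (fill p s))"

lemma equiv_syn_rel: "equiv UNIV (syn_rel L)"
  by (rule equivI) (auto simp: syn_rel_def refl_on_def sym_def trans_def)

lemma equiv_syn_ctx_rel: "equiv UNIV (syn_ctx_rel L)"
  by (rule equivI) (auto simp: syn_ctx_rel_def syn_rel_def refl_on_def sym_def trans_def)

lemma syn_eq_iff: "syn L s = syn L t \<longleftrightarrow> (s, t) \<in> syn_rel L"
  unfolding syn_def by (simp add: eq_equiv_class_iff[OF equiv_syn_rel])

lemma syn_ctx_eq_iff: "syn_ctx L p = syn_ctx L q \<longleftrightarrow> (p, q) \<in> syn_ctx_rel L"
  unfolding syn_ctx_def by (simp add: eq_equiv_class_iff[OF equiv_syn_ctx_rel])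

lemma carrier_syn_H: "carrier (syn_H L) = range (syn L)"
  by (auto simp: syn_H_def syn_def quotient_def)

lemma carrier_syn_V: "carrier (syn_V L) = range (syn_ctx L)"
  by (auto simp: syn_V_def syn_ctx_def quotient_def)

lemma one_syn_H: "\<one>\<^bsub>syn_H L\<^esub> = syn L []"
  by (simp add: syn_H_def)

lemma one_syn_V: "\<one>\<^bsub>syn_V L\<^esub> = syn_ctx L empty_ctx"
  by (simp add: syn_V_def)

lemma syn_rel_fill: "(s, t) \<in> syn_rel L \<Longrightarrow> (fill p s, fill p t) \<in> syn_rel L"
proof -
  assume "(s, t) \<in> syn_rel L"
  then have "fill (ctx_comp q p) s \<in> L \<longleftrightarrow> fill (ctx_comp q p) t \<in> L" for q
    unfolding syn_rel_def by blast
  then show ?thesis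
    by (simp add: syn_rel_def)
qed

lemma syn_rel_trans: "\<lbrakk>(s, t) \<in> syn_rel L; (t, u) \<in> syn_rel L\<rbrakk> \<Longrightarrow> (s, u) \<in> syn_rel L"
  by (auto simp: syn_rel_def)

lemma syn_rel_append:
  assumes "(s, s') \<in> syn_rel L" "(t, t') \<in> syn_rel L"
  shows "(s @ t, s' @ t') \<in> syn_rel L"
  using syn_rel_fill[OF assms(1), of "Hole [] t"] syn_rel_fill[OF assms(2), of "Hole s' []"]
  by (auto intro: syn_rel_trans)

lemma syn_rel_fill2:
  assumes "(p, p') \<in> syn_ctx_rel L" "(s, s') \<in> syn_rel L"
  shows "(fill p s, fill p' s') \<in> syn_rel L"
proof -
  have "(fill p s', fill p' s') \<in> syn_rel L"
    using assms(1) by (simp add: syn_ctx_rel_def)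
  with syn_rel_fill[OF assms(2), of p] show ?thesis
    by (rule syn_rel_trans)
qed

lemma syn_ctx_rel_comp:
  assumes "(p, p') \<in> syn_ctx_rel L" "(q, q') \<in> syn_ctx_rel L"
  shows "(ctx_comp p q, ctx_comp p' q') \<in> syn_ctx_rel L"
  using assms(2) syn_rel_fill2[OF assms(1)] by (simp add: syn_ctx_rel_def)

lemma mult_syn_H [simp]: "syn L s \<otimes>\<^bsub>syn_H L\<^esub> syn L t = syn L (s @ t)"
proof -
  have "syn L s \<otimes>\<^bsub>syn_H L\<^esub> syn L t = (\<Union>s'\<in>syn L s. \<Union>t'\<in>syn L t. syn L (s' @ t'))"
    by (simp add: syn_H_def)
  also have "\<dots> = syn L (s @ t)"
    unfolding syn_def
    by (rule UN_equiv_class2[OF equiv_syn_rel equiv_syn_rel _ UNIV_I UNIV_I])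
      (intro congruent2I', simp flip: syn_def add: syn_eq_iff syn_rel_append)
  finally show ?thesis .
qed

lemma mult_syn_V [simp]: "syn_ctx L p \<otimes>\<^bsub>syn_V L\<^esub> syn_ctx L q = syn_ctx L (ctx_comp p q)"
proof -
  have "syn_ctx L p \<otimes>\<^bsub>syn_V L\<^esub> syn_ctx L q
        = (\<Union>p'\<in>syn_ctx L p. \<Union>q'\<in>syn_ctx L q. syn_ctx L (ctx_comp p' q'))"
    by (simp add: syn_V_def)
  also have "\<dots> = syn_ctx L (ctx_comp p q)"
    unfolding syn_ctx_def
    by (rule UN_equiv_class2[OF equiv_syn_ctx_rel equiv_syn_ctx_rel _ UNIV_I UNIV_I])
      (intro congruent2I', simp flip: syn_ctx_def add: syn_ctx_eq_iff syn_ctx_rel_comp)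
  finally show ?thesis .
qed

lemma syn_act_syn [simp]: "syn_act L (syn_ctx L p) (syn L s) = syn L (fill p s)"
  unfolding syn_act_def syn_def syn_ctx_def
  by (rule UN_equiv_class2[OF equiv_syn_ctx_rel equiv_syn_rel _ UNIV_I UNIV_I])
    (intro congruent2I', simp flip: syn_def add: syn_eq_iff syn_rel_fill2)

lemma ctx_comp_empty_right [simp]: "ctx_comp p empty_ctx = p"
  by (induction p) auto

lemma ctx_comp_assoc: "ctx_comp (ctx_comp p q) r = ctx_comp p (ctx_comp q r)"
  by (induction p) auto

lemma forest_algebra_syn: "forest_algebra (syn_H L) (syn_V L) (syn_act L)"
proof unfold_locales
  fix g assume "g \<in> carrier (syn_H L)"
  then obtain s where g: "g = syn L s"
    by (auto simp: carrier_syn_H)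
  have "\<forall>h \<in> carrier (syn_H L). syn_act L (syn_ctx L (Hole s [])) h = g \<otimes>\<^bsub>syn_H L\<^esub> h"
    by (auto simp: g carrier_syn_H)
  then show "\<exists>v \<in> carrier (syn_V L). \<forall>h \<in> carrier (syn_H L). syn_act L v h = g \<otimes>\<^bsub>syn_H L\<^esub> h"
    by (auto simp: carrier_syn_V)
  have "\<forall>h \<in> carrier (syn_H L). syn_act L (syn_ctx L (Hole [] s)) h = h \<otimes>\<^bsub>syn_H L\<^esub> g"
    by (auto simp: g carrier_syn_H)
  then show "\<exists>v \<in> carrier (syn_V L). \<forall>h \<in> carrier (syn_H L). syn_act L v h = h \<otimes>\<^bsub>syn_H L\<^esub> g"
    by (auto simp: carrier_syn_V)
next
  fix v w assume "v \<in> carrier (syn_V L)" "w \<in> carrier (syn_V L)"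
    and eq: "\<And>h. h \<in> carrier (syn_H L) \<Longrightarrow> syn_act L v h = syn_act L w h"
  then obtain p q where pq: "v = syn_ctx L p" "w = syn_ctx L q"
    by (auto simp: carrier_syn_V)
  have "syn L (fill p s) = syn L (fill q s)" for s
    using eq[of "syn L s"] by (simp add: pq carrier_syn_H)
  then show "v = w"
    by (simp add: pq syn_eq_iff syn_ctx_eq_iff syn_ctx_rel_def)
qed (auto simp: carrier_syn_H carrier_syn_V one_syn_H one_syn_V ctx_comp_assoc)

definition regular :: "'a forest set \<Rightarrow> bool" where
  "regular L \<longleftrightarrow> finite (carrier (syn_H L)) \<and> finite (carrier (syn_V L))"

definition tree_type :: "'a forest set \<Rightarrow> 'a forest set \<Rightarrow> bool" where
  "tree_type L h \<longleftrightarrow> (\<exists>t. is_tree t \<and> syn L t = h)"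

definition tree_ctx_type :: "'a forest set \<Rightarrow> 'a ctx set \<Rightarrow> bool" where
  "tree_ctx_type L v \<longleftrightarrow> (\<exists>p. is_tree_ctx p \<and> syn_ctx L p = v)"

definition H_piece :: "'a forest set \<Rightarrow> 'a forest set \<Rightarrow> 'a forest set \<Rightarrow> bool" where
  "H_piece L g h \<longleftrightarrow> (\<exists>s t. s \<unlhd>\<^sub>F t \<and> syn L s = g \<and> syn L t = h)"

definition V_piece :: "'a forest set \<Rightarrow> 'a ctx set \<Rightarrow> 'a ctx set \<Rightarrow> bool" where
  "V_piece L v w \<longleftrightarrow> (\<exists>p q. p \<unlhd>\<^sub>C q \<and> syn_ctx L p = v \<and> syn_ctx L q = w)"

definition is_idempotent :: "('b, 'm) monoid_scheme \<Rightarrow> 'b \<Rightarrow> bool" where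
  "is_idempotent M x \<longleftrightarrow> x \<otimes>\<^bsub>M\<^esub> x = x"

end

theory Submission
  imports Defs "HOL-Library.Infinite_Set"
begin

text \<open>
  \<open>\<unlhd>\<close> is Kruskal's homeomorphic embedding, so it is a well-quasi-order. If \<open>L\<close> is not cca-piecewise
  testable, there are forests \<open>f n \<in> L\<close> and \<open>g n \<notin> L\<close> with the same pieces of size at most \<open>n\<close>;
  passing to increasing subsequences, both generate the same ideal (directed downward closed set)
  of forests. Hence it suffices that the two identities make the syntactic class constant on all
  sufficiently large elements of every ideal. This is shown by induction along strict inclusion of
  ideals, which is well-founded. Ideals closed under concatenation are settled by the identity for
  \<open>\<omega> \<cdot> h\<close>; other ideals of forests are split into two factors generating smaller ideals. For an
  ideal \<open>T\<close> of trees, either the roots are fixed and one passes to the children, or one can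
  iterate tree contexts that map \<open>T\<close> into itself, and the identity for \<open>u\<^sup>\<omega>\<close> absorbs these
  contexts and leaves a core in a smaller ideal. The converse is pumping: a piece of size at most
  \<open>n\<close> cannot use all copies in an iteration of length \<open>n + 1\<close>.
\<close>

section \<open>Kruskal's theorem\<close>

text \<open>The obstacle is that several trees cannot be moved under a common new parent: b + c is
  not a piece of a(b + c). A tree or the empty forest may be wrapped in a context, a longer forest
  may not. This matches the restriction of the identity for u^\<omega> to tree types and 0, and it
  is why \<open>length s \<le> 1\<close> accompanies the arguments about nesting. Words of trees and
  words of nested contexts thus obey separate identities, but a single lemma on absorbing words,
  \<open>eventually_absorbed\<close>, exploits both.

  Constancy on the large elements of one ideal is enough because the two sequences interleave: some
  \<open>g\<close> lies between two \<open>f\<close>'s, hence in the ideal and above the threshold.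
  No bound on the size of pieces results.

  In the induction, ideals are compared first by the trees that they contain and only then by
  inclusion, since the children of the trees in an ideal form forests that need not belong to
  it.\<close>

definition almost_full_on :: "('a \<Rightarrow> 'a \<Rightarrow> bool) \<Rightarrow> 'a set \<Rightarrow> bool" where
  "almost_full_on P A \<longleftrightarrow> (\<forall>f :: nat \<Rightarrow> 'a. range f \<subseteq> A \<longrightarrow> (\<exists>i j. i < j \<and> P (f i) (f j)))"

lemma almost_full_onD:
  assumes "almost_full_on P A" "\<And>i :: nat. f i \<in> A"
  shows "\<exists>i j. i < j \<and> P (f i) (f j)"
  using assms unfolding almost_full_on_def by (meson image_subsetI)

text \<open>Only finitely many indices have no later term above their own, since infinitely many
  would enumerate to a sequence without a good pair. Past the last of them one can climb forever,
  and transitivity turns comparisons of consecutive terms into all comparisons.\<close>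

lemma almost_full_on_monotone_subseq:
  fixes f :: "nat \<Rightarrow> 'a"
  assumes af: "almost_full_on P A" and "transp P" and f: "\<And>i. f i \<in> A"
  shows "\<exists>g :: nat \<Rightarrow> nat. strict_mono g \<and> (\<forall>i j. i < j \<longrightarrow> P (f (g i)) (f (g j)))"
proof -
  define B where "B = {i. \<forall>j>i. \<not> P (f i) (f j)}"
  have "finite B"
  proof (rule ccontr)
    assume "infinite B"
    then obtain e :: "nat \<Rightarrow> nat" where e: "strict_mono e" "\<And>i. e i \<in> B"
      using infinite_enumerate by blast
    obtain i j where "i < j" "P (f (e i)) (f (e j))"
      using almost_full_onD[OF af, of "\<lambda>i. f (e i)", OF f] by blast
    then show False
      using e strict_monoD unfolding B_def by blast
  qed
  then obtain M where M: "\<And>i. i \<in> B \<Longrightarrow> i < M"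
    by (metis finite_nat_set_iff_bounded)
  have next_ex: "\<exists>j>i. P (f i) (f j)" if "i \<ge> M" for i
    using M[of i] that unfolding B_def by force
  have "\<exists>g. \<forall>n. M \<le> g n \<and> (g n < g (Suc n) \<and> P (f (g n)) (f (g (Suc n))))"
  proof (rule dependent_nat_choice)
    fix i and n :: nat assume "M \<le> i"
    then show "\<exists>j. M \<le> j \<and> i < j \<and> P (f i) (f j)"
      using next_ex[of i] by (meson le_trans less_imp_le)
  qed auto
  then obtain g where g: "\<And>n. g n < g (Suc n)" "\<And>n. P (f (g n)) (f (g (Suc n)))"
    by blast
  show ?thesis
  proof (intro exI conjI allI impI)
    show "strict_mono g"
      using g(1) by (simp add: strict_mono_Suc_iff)
    show "P (f (g i)) (f (g j))" if "i < j" for i j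
      using that
    proof (induction rule: less_Suc_induct)
      case (2 i j k)
      then show ?case using \<open>transp P\<close> by (meson transpE)
    qed (rule g)
  qed
qed

section \<open>Minimal bad sequences (Nash-Williams)\<close>

definition bad_seq :: "('a \<Rightarrow> 'a \<Rightarrow> bool) \<Rightarrow> 'a set \<Rightarrow> (nat \<Rightarrow> 'a) \<Rightarrow> bool" where
  "bad_seq P A f \<longleftrightarrow> (\<forall>i. f i \<in> A) \<and> (\<forall>i j. i < j \<longrightarrow> \<not> P (f i) (f j))"

lemma not_almost_full_on_iff: "\<not> almost_full_on P A \<longleftrightarrow> (\<exists>f. bad_seq P A f)"
  unfolding almost_full_on_def bad_seq_def by blast

definition minimal_bad_seq ::
  "('a \<Rightarrow> nat) \<Rightarrow> ('a \<Rightarrow> 'a \<Rightarrow> bool) \<Rightarrow> 'a set \<Rightarrow> (nat \<Rightarrow> 'a) \<Rightarrow> bool" where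
  "minimal_bad_seq m P A f \<longleftrightarrow> bad_seq P A f \<and>
     (\<forall>n g. bad_seq P A g \<and> (\<forall>i<n. g i = f i) \<longrightarrow> m (f n) \<le> m (g n))"

text \<open>The positions are minimised one after the other: \<open>F n\<close> is minimal at
  position \<open>n\<close> and keeps the earlier values. Hence the diagonal is again bad, a pair i
  < j being inherited from \<open>F j\<close>, and every competitor of the diagonal at
  \<open>n\<close> also competes with \<open>F n\<close>.\<close>

lemma ex_minimal_bad_seq:
  fixes m :: "'a \<Rightarrow> nat"
  assumes "\<not> almost_full_on P A"
  shows "\<exists>f. minimal_bad_seq m P A f"
proof -
  obtain f0 where "bad_seq P A f0"
    using assms by (auto simp: not_almost_full_on_iff)
  define minimal where
    "minimal n g \<longleftrightarrow> bad_seq P A g \<and> (\<forall>h. bad_seq P A h \<and> (\<forall>i<n. h i = g i) \<longrightarrow> m (g n) \<le> m (h n))"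
    for n g
  have ex: "\<exists>h. minimal n h \<and> (\<forall>i<n. h i = g i)" if "bad_seq P A g" for g n
  proof -
    have "\<exists>h. (bad_seq P A h \<and> (\<forall>i<n. h i = g i)) \<and>
        (\<forall>h'. bad_seq P A h' \<and> (\<forall>i<n. h' i = g i) \<longrightarrow> m (h n) \<le> m (h' n))"
      by (rule ex_has_least_nat[of _ g]) (use that in auto)
    then show ?thesis
      unfolding minimal_def by metis
  qed
  have "\<exists>F. \<forall>n. minimal n (F n) \<and> (\<forall>i<Suc n. F (Suc n) i = F n i)"
  proof (rule dependent_nat_choice)
    show "\<exists>g. minimal 0 g"
      using ex[OF \<open>bad_seq P A f0\<close>] by blast
    show "\<exists>h. minimal (Suc n) h \<and> (\<forall>i<Suc n. h i = g i)" if "minimal n g" for g n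
      using ex that unfolding minimal_def by blast
  qed
  then obtain F where F: "\<And>n. minimal n (F n)" "\<And>n i. i \<le> n \<Longrightarrow> F (Suc n) i = F n i"
    by (auto simp: less_Suc_eq_le)
  have F_eq: "F n i = F i i" if "i \<le> n" for n i
    using that by (induction n rule: dec_induct) (use F(2) in auto)
  have bad: "bad_seq P A (F n)" for n
    using F(1) unfolding minimal_def by blast
  have "bad_seq P A (\<lambda>i. F i i)"
    unfolding bad_seq_def
  proof (intro conjI allI impI)
    show "F i i \<in> A" for i
      using bad unfolding bad_seq_def by blast
    show "\<not> P (F i i) (F j j)" if "i < j" for i j
      using bad[of j] F_eq[of i j] that unfolding bad_seq_def by (metis less_imp_le)
  qed
  moreover have "m (F n n) \<le> m (g n)" if "bad_seq P A g" "\<forall>i<n. g i = F i i" for n g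
  proof -
    have "\<forall>i<n. g i = F n i"
      using that(2) F_eq by (metis less_imp_le)
    then show ?thesis
      using F(1)[of n] that(1) unfolding minimal_def by blast
  qed
  ultimately show ?thesis
    unfolding minimal_bad_seq_def by blast
qed

text \<open>The replacement step common to Higman's lemma and Kruskal's theorem. Cut the given
  sequence at a term whose index \<open>k\<close> is least and put the terms of \<open>f\<close>
  below that index in front. By minimality the result has a good pair. It cannot begin in the
  \<open>f\<close> part, since being below an element of \<open>B n\<close> implies being below
  \<open>f n\<close>; so it lies in the given sequence.\<close>

lemma almost_full_on_below_minimal_bad:
  assumes f: "minimal_bad_seq m P A f"
    and B: "\<And>n x. x \<in> B n \<Longrightarrow> x \<in> A \<and> m x < m (f n) \<and> (\<forall>y \<in> A. P y x \<longrightarrow> P y (f n))"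
  shows "almost_full_on P (\<Union>n. B n)"
  unfolding almost_full_on_def
proof (intro allI impI)
  fix g :: "nat \<Rightarrow> 'a" assume "range g \<subseteq> (\<Union>n. B n)"
  then have "\<forall>i. \<exists>n. g i \<in> B n"
    by blast
  then obtain k where k: "\<And>i. g i \<in> B (k i)"
    by metis
  have f_bad: "f i \<in> A" "i < j \<Longrightarrow> \<not> P (f i) (f j)" for i j
    using f unfolding minimal_bad_seq_def bad_seq_def by auto
  obtain i0 where i0: "\<And>i. k i0 \<le> k i"
    using ex_has_least_nat[of "\<lambda>_. True" _ k] by auto
  define h where "h i = (if i < k i0 then f i else g (i0 + (i - k i0)))" for i
  have "\<not> bad_seq P A h"
  proof
    assume "bad_seq P A h"
    moreover have "\<forall>i<k i0. h i = f i"
      by (simp add: h_def)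
    ultimately have "m (f (k i0)) \<le> m (h (k i0))"
      using f unfolding minimal_bad_seq_def by blast
    then show False
      using B[OF k[of i0]] by (simp add: h_def)
  qed
  moreover have "h i \<in> A" for i
    using f_bad(1) B[OF k] by (simp add: h_def)
  ultimately obtain i j where ij: "i < j" "P (h i) (h j)"
    unfolding bad_seq_def by blast
  show "\<exists>i j. i < j \<and> P (g i) (g j)"
  proof (cases "i < k i0")
    case True
    have "\<not> k i0 \<le> j"
    proof
      assume j: "k i0 \<le> j"
      define j' where "j' = i0 + (j - k i0)"
      have "P (f i) (g j')"
        using ij True j by (simp add: h_def j'_def)
      then have "P (f i) (f (k j'))"
        using B[OF k] f_bad(1) by blast
      then show False
        using f_bad(2)[of i "k j'"] i0[of j'] True by simp
    qed
    then show ?thesis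
      using ij f_bad(2)[of i j] True by (simp add: h_def)
  next
    case False
    then show ?thesis
      using ij by (intro exI[of _ "i0 + (i - k i0)"] exI[of _ "i0 + (j - k i0)"]) (auto simp: h_def)
  qed
qed

text \<open>Higman's lemma: the tails of a minimal bad sequence are almost full, and along a
  subsequence with increasing heads a good pair of tails is a good pair of lists.\<close>

lemma almost_full_on_lists:
  assumes af: "almost_full_on P A" and tr: "transp P"
  shows "almost_full_on (list_emb P) (lists A)"
proof (rule ccontr)
  assume "\<not> ?thesis"
  then obtain f where min: "minimal_bad_seq length (list_emb P) (lists A) f"
    using ex_minimal_bad_seq by blast
  then have f: "\<And>i. f i \<in> lists A" "\<And>i j. i < j \<Longrightarrow> \<not> list_emb P (f i) (f j)"
    unfolding minimal_bad_seq_def bad_seq_def by auto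
  have ne: "f i \<noteq> []" for i
    using f(2)[of i "Suc i"] by auto
  have "hd (f i) \<in> A \<and> tl (f i) \<in> lists A" for i
    using f(1)[of i] ne[of i] by (cases "f i") simp_all
  then have hd: "hd (f i) \<in> A" and tl: "tl (f i) \<in> lists A" for i
    by blast+
  obtain g :: "nat \<Rightarrow> nat"
    where g: "strict_mono g" "\<forall>i j. i < j \<longrightarrow> P (hd (f (g i))) (hd (f (g j)))"
    using almost_full_on_monotone_subseq[OF af tr, of "\<lambda>i. hd (f i)", OF hd] by blast
  have "almost_full_on (list_emb P) (\<Union>n. {tl (f n)})"
  proof (rule almost_full_on_below_minimal_bad[OF min])
    fix n x assume "x \<in> {tl (f n)}"
    then show "x \<in> lists A \<and> length x < length (f n) \<and>
        (\<forall>y\<in>lists A. list_emb P y x \<longrightarrow> list_emb P y (f n))"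
      using tl[of n] ne[of n] by (cases "f n") (simp_all add: list_emb_Cons)
  qed
  from almost_full_onD[OF this, of "\<lambda>i. tl (f (g i))"]
  obtain i j where "i < j" "list_emb P (tl (f (g i))) (tl (f (g j)))"
    by auto
  then have "list_emb P (hd (f (g i)) # tl (f (g i))) (hd (f (g j)) # tl (f (g j)))"
    using g(2) by (intro list_emb_Cons2) auto
  then show False
    using f(2)[of "g i" "g j"] g(1) \<open>i < j\<close> ne by (auto simp: strict_mono_def)
qed

lemma list_emb_mono_le: "P \<le> Q \<Longrightarrow> list_emb P xs ys \<longrightarrow> list_emb Q xs ys"
  by (intro list_emb_mono) (auto simp: le_fun_def)

text \<open>\<open>temb_node\<close> sends distinct children into distinct child subtrees, from left
  to right, so that closest common ancestors are kept; \<open>temb_sub\<close> passes to a subtree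
  of the target.\<close>

inductive temb :: "'a tree \<Rightarrow> 'a tree \<Rightarrow> bool" where
  temb_node: "list_emb temb f g \<Longrightarrow> temb (Node a f) (Node a g)"
| temb_sub: "temb s t \<Longrightarrow> t \<in> set g \<Longrightarrow> temb s (Node a g)"
monos list_emb_mono_le

abbreviation emb :: "'a forest \<Rightarrow> 'a forest \<Rightarrow> bool" where
  "emb \<equiv> list_emb temb"

lemma temb_refl [simp]: "temb t t"
proof (induction t)
  case (Node a f)
  then show ?case
    by (intro temb_node list_emb_refl)
qed

lemma emb_refl [simp]: "emb f f"
  by (simp add: list_emb_refl)

lemma temb_trans: "temb s t \<Longrightarrow> temb t u \<Longrightarrow> temb s u"
proof (induction u arbitrary: s t)
  case (Node c h)
  have IH: "temb s u" if "u \<in> set h" "temb s t" "temb t u" for s t u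
    using Node.IH that by blast
  from \<open>temb t (Node c h)\<close> show ?case
  proof cases
    case (temb_node g)
    from \<open>temb s t\<close>[unfolded temb_node] show ?thesis
    proof cases
      case (temb_node f)
      have "emb f h"
        using list_emb_trans[of f g h temb] IH \<open>emb f g\<close> \<open>emb g h\<close> by blast
      then show ?thesis
        using temb_node by (auto intro: temb.temb_node)
    next
      case (temb_sub t')
      then obtain u where "u \<in> set h" "temb t' u"
        using \<open>emb g h\<close> by (meson list_emb_set)
      then show ?thesis
        using IH temb_sub by (auto intro: temb.temb_sub)
    qed
  next
    case (temb_sub u)
    then show ?thesis
      using IH Node.prems by (auto intro: temb.temb_sub)
  qed
qed

lemma transp_temb: "transp temb"
  using temb_trans by (auto intro: transpI)

lemma emb_trans: "emb f g \<Longrightarrow> emb g h \<Longrightarrow> emb f h"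
  using list_emb_trans[of f g h temb] temb_trans by blast

lemma transp_emb: "transp emb"
  using emb_trans by (auto intro: transpI)

lemma almost_full_on_finite: "finite A \<Longrightarrow> almost_full_on (=) A"
  unfolding almost_full_on_def
proof (intro allI impI)
  fix f :: "nat \<Rightarrow> 'a" assume "finite A" "range f \<subseteq> A"
  then have "\<not> inj f"
    using range_inj_infinite finite_subset by blast
  then obtain i j where "i \<noteq> j" "f i = f j"
    unfolding inj_def by blast
  then show "\<exists>i j. i < j \<and> f i = f j"
    by (metis linorder_neqE_nat)
qed

text \<open>In a minimal bad sequence the children of all terms form an almost full set, so by
  Higman's lemma the lists of such children do as well. Finiteness of the alphabet makes the roots
  constant along a subsequence.\<close>

lemma almost_full_on_temb: "almost_full_on temb (UNIV :: 'a::finite tree set)"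
proof (rule ccontr)
  assume "\<not> ?thesis"
  then obtain f :: "nat \<Rightarrow> 'a tree" where min: "minimal_bad_seq size temb UNIV f"
    using ex_minimal_bad_seq by blast
  then have f: "\<And>i j. i < j \<Longrightarrow> \<not> temb (f i) (f j)"
    unfolding minimal_bad_seq_def bad_seq_def by auto
  define B where "B = (\<Union>n. set (children (f n)))"
  have "almost_full_on temb B"
    unfolding B_def
  proof (rule almost_full_on_below_minimal_bad[OF min])
    fix n x assume x: "x \<in> set (children (f n))"
    then have "size x < size (f n)"
      by (cases "f n") (auto dest: size_list_estimation'[of x _ _ size])
    moreover have "temb y (f n)" if "temb y x" for y
      using x that by (cases "f n") (auto intro: temb_sub)
    ultimately show "x \<in> UNIV \<and> size x < size (f n) \<and> (\<forall>y\<in>UNIV. temb y x \<longrightarrow> temb y (f n))"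
      by blast
  qed
  then have af: "almost_full_on emb (lists B)"
    using almost_full_on_lists transp_temb by blast
  have "transp ((=) :: 'a \<Rightarrow> 'a \<Rightarrow> bool)"
    by (auto intro: transpI)
  from almost_full_on_monotone_subseq[OF almost_full_on_finite[OF finite_UNIV] this, of "\<lambda>i. root (f i)"]
  obtain g :: "nat \<Rightarrow> nat"
    where g: "strict_mono g" "\<forall>i j. i < j \<longrightarrow> root (f (g i)) = root (f (g j))"
    by auto
  have "children (f (g i)) \<in> lists B" for i
    unfolding B_def by auto
  from almost_full_onD[OF af, of "\<lambda>i. children (f (g i))", OF this]
  obtain i j where "i < j" "emb (children (f (g i))) (children (f (g j)))"
    by blast
  moreover have "root (f (g i)) = root (f (g j))"
    using g(2) \<open>i < j\<close> by blast
  ultimately have "temb (f (g i)) (f (g j))"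
    by (cases "f (g i)"; cases "f (g j)") (simp add: temb_node)
  then show False
    using f[of "g i" "g j"] g(1) \<open>i < j\<close> by (auto simp: strict_mono_def)
qed

lemma almost_full_on_emb: "almost_full_on emb (UNIV :: 'a::finite forest set)"
  using almost_full_on_lists[OF almost_full_on_temb transp_temb] by simp

section \<open>Downsets and finite bases\<close>

definition downset :: "('a \<Rightarrow> 'a \<Rightarrow> bool) \<Rightarrow> 'a set \<Rightarrow> bool" where
  "downset P A \<longleftrightarrow> (\<forall>x y. y \<in> A \<longrightarrow> P x y \<longrightarrow> x \<in> A)"

lemma downsetD: "downset P A \<Longrightarrow> y \<in> A \<Longrightarrow> P x y \<Longrightarrow> x \<in> A"
  unfolding downset_def by blast

text \<open>Elements lost at successive steps of an infinite descent would form a bad sequence: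
  lying below a later one would keep the earlier one in a downset that it has left.\<close>

lemma wf_psubset_downsets:
  assumes "almost_full_on P UNIV"
  shows "wf {(A, B). A \<subset> B \<and> downset P A \<and> downset P B}"
  unfolding wf_iff_no_infinite_down_chain
proof
  assume "\<exists>D. \<forall>i. (D (Suc i), D i) \<in> {(A, B). A \<subset> B \<and> downset P A \<and> downset P B}"
  then obtain D where "\<forall>i. (D (Suc i), D i) \<in> {(A, B). A \<subset> B \<and> downset P A \<and> downset P B}" ..
  then have D: "\<And>i. D (Suc i) \<subset> D i" "\<And>i. downset P (D i)"
    by simp_all
  have anti: "D j \<subseteq> D i" if "i \<le> j" for i j
    by (rule lift_Suc_antimono_le[OF _ that]) (use D(1) in blast)
  have "\<forall>i. \<exists>x. x \<in> D i - D (Suc i)"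
    using D(1) by blast
  then obtain x where x: "\<And>i. x i \<in> D i - D (Suc i)"
    by metis
  obtain i j where ij: "i < j" "P (x i) (x j)"
    using almost_full_onD[OF assms, of x] by blast
  then have "x j \<in> D (Suc i)"
    using anti[of "Suc i" j] x[of j] by auto
  then show False
    using ij D(2)[of "Suc i"] x[of i] by (auto dest: downsetD)
qed

lemma almost_full_on_finite_basis:
  assumes "almost_full_on P UNIV"
  shows "\<exists>B. finite B \<and> B \<subseteq> U \<and> (\<forall>x \<in> U. \<exists>b \<in> B. P b x)"
proof (rule ccontr)
  assume "\<not> ?thesis"
  then have no: "\<forall>B. finite B \<and> B \<subseteq> U \<longrightarrow> (\<exists>x. x \<in> U \<and> (\<forall>b \<in> B. \<not> P b x))"
    by metis
  define pick where "pick B = (SOME x. x \<in> U \<and> (\<forall>b \<in> B. \<not> P b x))" for B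
  have pick: "pick B \<in> U \<and> (\<forall>b \<in> B. \<not> P b (pick B))" if "finite B" "B \<subseteq> U" for B
    unfolding pick_def by (rule someI_ex) (use no that in simp)
  define F where "F = rec_nat {} (\<lambda>_ B. insert (pick B) B)"
  define x where "x n = pick (F n)" for n
  have F_Suc: "F (Suc n) = insert (x n) (F n)" for n
    by (simp add: F_def x_def)
  have "finite (F n) \<and> F n \<subseteq> U" for n
    by (induction n) (use pick in \<open>auto simp: F_def\<close>)
  then have x: "b \<in> F n \<Longrightarrow> \<not> P b (x n)" for n b
    using pick unfolding x_def by blast
  have mono: "F i \<subseteq> F j" if "i \<le> j" for i j
    by (rule lift_Suc_mono_le[OF _ that]) (use F_Suc in blast)
  obtain i j where ij: "i < j" "P (x i) (x j)"
    using almost_full_onD[OF assms, of x] by blast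
  then have "x i \<in> F j"
    using mono[of "Suc i" j] F_Suc[of i] by auto
  then show False
    using ij x by blast
qed

section \<open>Pieces as homeomorphic embeddings\<close>

lemma Nil_notin_nodes [simp]: "[] \<notin> nodes f"
  by (simp add: nodes_def)

lemma Cons_in_nodes: "i # x \<in> nodes f \<longleftrightarrow> i < length f \<and> (x = [] \<or> x \<in> nodes (children (f ! i)))"
  by (simp add: nodes_def)

fun subforest_at :: "'a forest \<Rightarrow> nat list \<Rightarrow> 'a forest" where
  "subforest_at f [] = f"
| "subforest_at f (i # x) = subforest_at (children (f ! i)) x"

lemma append_in_nodes:
  "w \<in> nodes f \<Longrightarrow> w @ z \<in> nodes f \<longleftrightarrow> z = [] \<or> z \<in> nodes (subforest_at f w)"
proof (induction w arbitrary: f)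
  case (Cons i w)
  then show ?case
    by (cases "w = []") (auto simp: Cons_in_nodes)
qed simp

lemma label_append: "z \<noteq> [] \<Longrightarrow> label f (w @ z) = label (subforest_at f w) z"
  by (induction w arbitrary: f) auto

lemma nodes_prefix_closed: "x @ y \<in> nodes f \<Longrightarrow> x \<noteq> [] \<Longrightarrow> x \<in> nodes f"
proof (induction x arbitrary: f)
  case (Cons i x)
  then show ?case
    by (cases "x = []") (auto simp: Cons_in_nodes)
qed simp

abbreviation lcp :: "'a list \<Rightarrow> 'a list \<Rightarrow> 'a list" where
  "lcp \<equiv> longest_common_prefix"

lemma lcp_Nil [simp]: "lcp x [] = []" "lcp [] x = []"
  by (cases x; simp)+

lemma lcp_append [simp]: "lcp (w @ x) (w @ y) = w @ lcp x y"
  by (induction w) auto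

lemma lcp_same [simp]: "lcp x x = x"
  by (induction x) auto

lemma cca_eq_lcp:
  assumes "x \<in> nodes f" "y \<in> nodes f"
  shows "cca f x y = (if lcp x y = [] then None else Some (lcp x y))"
proof (cases "lcp x y = []")
  case True
  then have "\<not> is_cca f x y z" for z
    using longest_common_prefix_max_prefix[of z x y] by (auto simp: is_cca_def)
  with True show ?thesis
    by (simp add: cca_def)
next
  case False
  have "lcp x y \<in> nodes f"
    using longest_common_prefix_prefix1[of x y] assms(1) False nodes_prefix_closed
    by (metis prefix_def)
  then have "is_cca f x y (lcp x y)"
    by (simp add: is_cca_def longest_common_prefix_prefix1 longest_common_prefix_prefix2
        longest_common_prefix_max_prefix)
  with False show ?thesis
    by (simp add: cca_Some_iff)
qed

text \<open>
  Sending \<open>[]\<close> to \<open>[]\<close> adds a common root above both forests, which turns the partial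
  operation \<open>cca\<close> into the total operation \<open>longest_common_prefix\<close>.
\<close>

definition piece_map :: "(nat list \<Rightarrow> nat list) \<Rightarrow> 'a forest \<Rightarrow> 'a forest \<Rightarrow> bool" where
  "piece_map \<phi> s t \<longleftrightarrow> \<phi> [] = [] \<and>
     (\<forall>x \<in> nodes s. \<phi> x \<in> nodes t \<and> label t (\<phi> x) = label s x) \<and>
     (\<forall>x \<in> nodes s. \<forall>y \<in> nodes s. (x, y) \<in> lexord less_than \<longrightarrow> (\<phi> x, \<phi> y) \<in> lexord less_than) \<and>
     (\<forall>x \<in> nodes s. \<forall>y \<in> nodes s. \<phi> (lcp x y) = lcp (\<phi> x) (\<phi> y))"

lemma lcp_Nil_or_node:
  assumes "x \<in> nodes s" shows "lcp x y = [] \<or> lcp x y \<in> nodes s"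
  using longest_common_prefix_prefix1[of x y] assms nodes_prefix_closed
  by (metis prefix_def)

lemma lexord_less_than_irrefl: "(x, x) \<notin> lexord (less_than :: (nat \<times> nat) set)"
  by (simp add: lexord_irreflexive)

lemma cca_piece_iff_piece_map: "s \<unlhd>\<^sub>F t \<longleftrightarrow> (\<exists>\<phi>. piece_map \<phi> s t)"
proof
  assume "s \<unlhd>\<^sub>F t"
  then obtain \<phi> where \<phi>: "inj_on \<phi> (nodes s)" "\<phi> ` nodes s \<subseteq> nodes t"
    "\<forall>x \<in> nodes s. label t (\<phi> x) = label s x"
    "\<forall>x \<in> nodes s. \<forall>y \<in> nodes s.
        (x, y) \<in> lexord less_than \<longrightarrow> (\<phi> x, \<phi> y) \<in> lexord less_than"
    "\<forall>x \<in> nodes s. \<forall>y \<in> nodes s. cca t (\<phi> x) (\<phi> y) = map_option \<phi> (cca s x y)"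
    unfolding cca_piece_def by (elim exE conjE) (rule that)
  let ?\<phi> = "\<phi>([] := [])"
  have ne: "x \<noteq> []" if "x \<in> nodes s" for x
    using that by auto
  have "?\<phi> (lcp x y) = lcp (\<phi> x) (\<phi> y)" if xy: "x \<in> nodes s" "y \<in> nodes s" for x y
  proof -
    have "\<phi> x \<in> nodes t" "\<phi> y \<in> nodes t"
      using xy \<phi>(2) by auto
    then have "(if lcp (\<phi> x) (\<phi> y) = [] then None else Some (lcp (\<phi> x) (\<phi> y)))
        = map_option \<phi> (if lcp x y = [] then None else Some (lcp x y))"
      using \<phi>(5) xy cca_eq_lcp[of x s y] cca_eq_lcp[of "\<phi> x" t "\<phi> y"] by simp
    then show ?thesis
      by (auto split: if_splits)
  qed
  then have "piece_map ?\<phi> s t"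
    using \<phi>(2-4) ne unfolding piece_map_def by auto
  then show "\<exists>\<phi>. piece_map \<phi> s t" by blast
next
  assume "\<exists>\<phi>. piece_map \<phi> s t"
  then obtain \<phi> where \<phi>: "piece_map \<phi> s t" ..
  have lex: "(\<phi> x, \<phi> y) \<in> lexord less_than"
    if "x \<in> nodes s" "y \<in> nodes s" "(x, y) \<in> lexord less_than" for x y
    using \<phi> that unfolding piece_map_def by blast
  have node: "\<phi> x \<in> nodes t" if "x \<in> nodes s" for x
    using \<phi> that unfolding piece_map_def by blast
  have "inj_on \<phi> (nodes s)"
  proof (rule inj_onI, rule ccontr)
    fix x y assume xy: "x \<in> nodes s" "y \<in> nodes s" "\<phi> x = \<phi> y" "x \<noteq> y"
    \<comment> \<open>Injectivity comes from order preservation: distinct addresses are comparable,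
      and the order on the images is irreflexive.\<close>
    have "(x, y) \<in> lexord less_than \<or> (y, x) \<in> lexord less_than"
      using \<open>x \<noteq> y\<close> lexord_linear[of less_than x y] by (auto simp: less_linear)
    then show False
      using lex xy lexord_less_than_irrefl by metis
  qed
  moreover have "cca t (\<phi> x) (\<phi> y) = map_option \<phi> (cca s x y)"
    if xy: "x \<in> nodes s" "y \<in> nodes s" for x y
  proof -
    have "\<phi> (lcp x y) = lcp (\<phi> x) (\<phi> y)" "\<phi> [] = []"
      using \<phi> xy unfolding piece_map_def by blast+
    moreover have "lcp x y \<noteq> [] \<Longrightarrow> \<phi> (lcp x y) \<noteq> []"
      using node[of "lcp x y"] lcp_Nil_or_node[OF xy(1), of y] by auto
    ultimately show ?thesis
      using cca_eq_lcp[OF xy] cca_eq_lcp[OF node[OF xy(1)] node[OF xy(2)]] by auto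
  qed
  ultimately show "s \<unlhd>\<^sub>F t"
    using \<phi> unfolding cca_piece_def piece_map_def by blast
qed

text \<open>Roots of \<open>s\<close> have no common ancestor, so their images lie in different
  trees of \<open>t\<close>, and the order makes the indices of these trees increase. The closest
  common ancestor of a root and its descendant is the root, so the image of the descendant extends
  the image of the root. The resulting recursion is the link to \<open>temb\<close>.\<close>

lemma piece_map_iff_children:
  "(\<exists>\<phi>. piece_map \<phi> s t) \<longleftrightarrow>
     (\<exists>\<psi>. (\<forall>i < length s. \<psi> i \<in> nodes t \<and> label t (\<psi> i) = root (s ! i) \<and>
            (\<exists>\<chi>. piece_map \<chi> (children (s ! i)) (subforest_at t (\<psi> i)))) \<and>
          (\<forall>i j. i < j \<longrightarrow> j < length s \<longrightarrow> hd (\<psi> i) < hd (\<psi> j)))"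
proof
  assume "\<exists>\<phi>. piece_map \<phi> s t"
  then obtain \<phi> where \<phi>: "piece_map \<phi> s t" ..
  have lex: "(\<phi> x, \<phi> y) \<in> lexord less_than"
    if "x \<in> nodes s" "y \<in> nodes s" "(x, y) \<in> lexord less_than" for x y
    using \<phi> that unfolding piece_map_def by blast
  have node: "\<phi> x \<in> nodes t" "label t (\<phi> x) = label s x" if "x \<in> nodes s" for x
    using \<phi> that unfolding piece_map_def by blast+
  have lcp: "\<phi> (lcp x y) = lcp (\<phi> x) (\<phi> y)" if "x \<in> nodes s" "y \<in> nodes s" for x y
    using \<phi> that unfolding piece_map_def by blast
  define \<psi> where "\<psi> i = \<phi> [i]" for i
  define \<chi> where "\<chi> i x = drop (length (\<psi> i)) (\<phi> (i # x))" for i x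
  have top: "[i] \<in> nodes s" if "i < length s" for i
    using that by (simp add: Cons_in_nodes)
  have split: "\<phi> (i # x) = \<psi> i @ \<chi> i x" if "i < length s" "i # x \<in> nodes s" for i x
  proof -
    have "lcp (\<psi> i) (\<phi> (i # x)) = \<psi> i"
      using lcp[OF top[OF that(1)] that(2)] by (simp add: \<psi>_def)
    then have "prefix (\<psi> i) (\<phi> (i # x))"
      by (metis longest_common_prefix_prefix2)
    then show ?thesis
      unfolding \<chi>_def by (metis append_eq_conv_conj prefix_def)
  qed
  have "piece_map (\<chi> i) (children (s ! i)) (subforest_at t (\<psi> i))" if i: "i < length s" for i
    unfolding piece_map_def
  proof (intro conjI ballI impI)
    show "\<chi> i [] = []"
      by (simp add: \<chi>_def \<psi>_def)
  next
    fix x assume x: "x \<in> nodes (children (s ! i))"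
    then have ix: "i # x \<in> nodes s" and "x \<noteq> []"
      using i by (auto simp: Cons_in_nodes)
    then have "(\<psi> i, \<phi> (i # x)) \<in> lexord less_than"
      unfolding \<psi>_def using top[OF i] by (intro lex) (auto simp: neq_Nil_conv)
    then have ne: "\<chi> i x \<noteq> []"
      using split[OF i ix] lexord_less_than_irrefl by auto
    have "\<psi> i @ \<chi> i x \<in> nodes t" "label t (\<psi> i @ \<chi> i x) = label s (i # x)"
      using node[OF ix] split[OF i ix] by auto
    moreover have "\<psi> i \<in> nodes t"
      unfolding \<psi>_def using node top[OF i] by blast
    ultimately show "\<chi> i x \<in> nodes (subforest_at t (\<psi> i))"
      "label (subforest_at t (\<psi> i)) (\<chi> i x) = label (children (s ! i)) x"
      using ne \<open>x \<noteq> []\<close> by (auto simp: append_in_nodes label_append)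
  next
    fix x y assume xy: "x \<in> nodes (children (s ! i))" "y \<in> nodes (children (s ! i))"
    then have ix: "i # x \<in> nodes s" "i # y \<in> nodes s"
      using i by (auto simp: Cons_in_nodes)
    show "(\<chi> i x, \<chi> i y) \<in> lexord less_than" if "(x, y) \<in> lexord less_than"
    proof -
      have "(\<psi> i @ \<chi> i x, \<psi> i @ \<chi> i y) \<in> lexord less_than"
        using lex[OF ix] that split[OF i ix(1)] split[OF i ix(2)] by simp
      then show ?thesis
        by (rule lexord_append_leftD) simp
    qed
    have "lcp x y = [] \<or> lcp x y \<in> nodes (children (s ! i))"
      using lcp_Nil_or_node xy(1) .
    then have "i # lcp x y \<in> nodes s"
      using i by (auto simp: Cons_in_nodes)
    then have "\<psi> i @ \<chi> i (lcp x y) = lcp (\<psi> i @ \<chi> i x) (\<psi> i @ \<chi> i y)"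
      using lcp[OF ix] split[OF i] ix by simp
    then show "\<chi> i (lcp x y) = lcp (\<chi> i x) (\<chi> i y)"
      by simp
  qed
  moreover have "hd (\<psi> i) < hd (\<psi> j)" if "i < j" "j < length s" for i j
  proof -
    have ij: "[i] \<in> nodes s" "[j] \<in> nodes s"
      using that top by auto
    have "lcp (\<psi> i) (\<psi> j) = []"
      using lcp[OF ij] that \<phi> unfolding \<psi>_def piece_map_def by simp
    moreover have "(\<psi> i, \<psi> j) \<in> lexord less_than"
      unfolding \<psi>_def using that by (intro lex ij) simp
    moreover have "\<psi> i \<noteq> []" "\<psi> j \<noteq> []"
      unfolding \<psi>_def using node(1)[OF ij(1)] node(1)[OF ij(2)] by auto
    ultimately show ?thesis
      by (cases "\<psi> i"; cases "\<psi> j") (auto split: if_splits)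
  qed
  ultimately show "\<exists>\<psi>. (\<forall>i < length s. \<psi> i \<in> nodes t \<and> label t (\<psi> i) = root (s ! i) \<and>
            (\<exists>\<chi>. piece_map \<chi> (children (s ! i)) (subforest_at t (\<psi> i)))) \<and>
          (\<forall>i j. i < j \<longrightarrow> j < length s \<longrightarrow> hd (\<psi> i) < hd (\<psi> j))"
    using node top by (intro exI[of _ \<psi>]) (auto simp: \<psi>_def)
next
  assume "\<exists>\<psi>. (\<forall>i < length s. \<psi> i \<in> nodes t \<and> label t (\<psi> i) = root (s ! i) \<and>
            (\<exists>\<chi>. piece_map \<chi> (children (s ! i)) (subforest_at t (\<psi> i)))) \<and>
          (\<forall>i j. i < j \<longrightarrow> j < length s \<longrightarrow> hd (\<psi> i) < hd (\<psi> j))"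
  then obtain \<psi> where *: "(\<forall>i < length s. \<psi> i \<in> nodes t \<and> label t (\<psi> i) = root (s ! i) \<and>
            (\<exists>\<chi>. piece_map \<chi> (children (s ! i)) (subforest_at t (\<psi> i)))) \<and>
          (\<forall>i j. i < j \<longrightarrow> j < length s \<longrightarrow> hd (\<psi> i) < hd (\<psi> j))" ..
  from * have \<psi>: "\<forall>i < length s. \<psi> i \<in> nodes t \<and> label t (\<psi> i) = root (s ! i) \<and>
            (\<exists>\<chi>. piece_map \<chi> (children (s ! i)) (subforest_at t (\<psi> i)))" ..
  from * have hd: "hd (\<psi> i) < hd (\<psi> j)" if "i < j" "j < length s" for i j
    using that by simp
  from \<psi> have "\<forall>i. \<exists>\<chi>. i < length s \<longrightarrow> piece_map \<chi> (children (s ! i)) (subforest_at t (\<psi> i))"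
    by blast
  from choice[OF this] obtain \<chi> where
    "\<forall>i. i < length s \<longrightarrow> piece_map (\<chi> i) (children (s ! i)) (subforest_at t (\<psi> i))" ..
  then have \<chi>: "piece_map (\<chi> i) (children (s ! i)) (subforest_at t (\<psi> i))" if "i < length s" for i
    using that by blast
  have \<chi>_Nil: "\<chi> i [] = []" if "i < length s" for i
    using \<chi>[OF that] unfolding piece_map_def by blast
  have \<chi>_node: "\<chi> i x \<in> nodes (subforest_at t (\<psi> i))"
    "label (subforest_at t (\<psi> i)) (\<chi> i x) = label (children (s ! i)) x"
    if "i < length s" "x \<in> nodes (children (s ! i))" for i x
    using \<chi>[OF that(1)] that(2) unfolding piece_map_def by blast+
  have \<psi>_node: "\<psi> i \<in> nodes t" "label t (\<psi> i) = root (s ! i)" if "i < length s" for i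
    using \<psi> that by blast+
  have \<psi>_ne: "\<psi> i \<noteq> []" if "i < length s" for i
    using \<psi>_node(1)[OF that] by auto
  define \<phi> where "\<phi> w = (case w of [] \<Rightarrow> [] | i # x \<Rightarrow> \<psi> i @ \<chi> i x)" for w
  have [simp]: "\<phi> [] = []" "\<phi> (i # x) = \<psi> i @ \<chi> i x" for i x
    by (simp_all add: \<phi>_def)
  have hd_neq: "lcp (\<psi> i @ x) (\<psi> j @ y) = []" if "i \<noteq> j" "i < length s" "j < length s" for i j x y
    using hd[of i j] hd[of j i] that \<psi>_ne[of i] \<psi>_ne[of j]
    by (cases "\<psi> i"; cases "\<psi> j") (auto simp: neq_iff)
  have "piece_map \<phi> s t"
    unfolding piece_map_def
  proof (intro conjI ballI impI)
    fix w assume "w \<in> nodes s"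
    then obtain i x where w: "w = i # x" "i < length s" "x = [] \<or> x \<in> nodes (children (s ! i))"
      by (cases w) (auto simp: Cons_in_nodes)
    show "\<phi> w \<in> nodes t"
      using w \<psi>_node(1) \<chi>_Nil \<chi>_node(1) by (auto simp: append_in_nodes)
    show "label t (\<phi> w) = label s w"
    proof (cases "x = []")
      case True
      then show ?thesis
        using w \<psi>_node(2) \<chi>_Nil by simp
    next
      case False
      then have "x \<in> nodes (children (s ! i))"
        using w by blast
      moreover from this have "\<chi> i x \<noteq> []"
        using \<chi>_node(1)[OF w(2)] by fastforce
      ultimately show ?thesis
        using w \<chi>_node(2) False by (simp add: label_append)
    qed
  next
    fix u w assume "u \<in> nodes s" "w \<in> nodes s"
    then obtain i x j y where u: "u = i # x" "i < length s" "x = [] \<or> x \<in> nodes (children (s ! i))"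
      and w: "w = j # y" "j < length s" "y = [] \<or> y \<in> nodes (children (s ! j))"
      by (cases u; cases w) (auto simp: Cons_in_nodes)
    show "\<phi> (lcp u w) = lcp (\<phi> u) (\<phi> w)"
    proof (cases "i = j")
      case True
      have "\<chi> i (lcp x y) = lcp (\<chi> i x) (\<chi> i y)"
      proof (cases "x = [] \<or> y = []")
        case True
        then show ?thesis
          using \<chi>_Nil[OF u(2)] by auto
      next
        case False
        then show ?thesis
          using u w \<open>i = j\<close> \<chi>[OF u(2)] unfolding piece_map_def by blast
      qed
      then show ?thesis
        using True u w by simp
    next
      case False
      then show ?thesis
        using hd_neq[OF False u(2) w(2)] u w by simp
    qed
    assume "(u, w) \<in> lexord less_than"
    then consider "i < j" | "i = j" "(x, y) \<in> lexord less_than"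
      using u w by auto
    then show "(\<phi> u, \<phi> w) \<in> lexord less_than"
    proof cases
      case 1
      then show ?thesis
        using hd[OF 1 w(2)] \<psi>_ne[OF u(2)] \<psi>_ne[OF w(2)] u w
        by (cases "\<psi> i"; cases "\<psi> j") auto
    next
      case 2
      then have "y \<noteq> []"
        by auto
      then have y: "y \<in> nodes (children (s ! j))"
        using w by blast
      have "(\<chi> i x, \<chi> i y) \<in> lexord less_than"
      proof (cases "x = []")
        case True
        have "\<chi> i y \<noteq> []"
          using \<chi>_node(1)[OF w(2) y] 2(1) by fastforce
        then show ?thesis
          using \<chi>_Nil[OF u(2)] True by (auto simp: neq_Nil_conv)
      next
        case False
        then show ?thesis
          using u y 2 \<chi>[OF u(2)] unfolding piece_map_def by blast
      qed
      then show ?thesis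
        using 2 u w by (simp add: lexord_append_leftI)
    qed
  qed simp
  then show "\<exists>\<phi>. piece_map \<phi> s t" by blast
qed

lemma list_emb_iff_nth:
  "list_emb P xs ys \<longleftrightarrow>
     (\<exists>k. (\<forall>i < length xs. k i < length ys \<and> P (xs ! i) (ys ! k i)) \<and>
          (\<forall>i j. i < j \<longrightarrow> j < length xs \<longrightarrow> k i < k j))"
    (is "_ \<longleftrightarrow> (\<exists>k. ?K k xs ys)")
proof
  show "list_emb P xs ys \<Longrightarrow> \<exists>k. ?K k xs ys"
  proof (induction rule: list_emb.induct)
    case (list_emb_Nil ys)
    then show ?case by simp
  next
    case (list_emb_Cons xs ys y)
    then obtain k where "?K k xs ys" by blast
    then show ?case
      by (intro exI[of _ "\<lambda>i. Suc (k i)"]) auto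
  next
    case (list_emb_Cons2 x y xs ys)
    then obtain k where "?K k xs ys" by blast
    then show ?case
      using \<open>P x y\<close>
      by (intro exI[of _ "\<lambda>i. case i of 0 \<Rightarrow> 0 | Suc i \<Rightarrow> Suc (k i)"])
        (auto split: nat.splits simp: less_Suc_eq_0_disj)
  qed
  show "\<exists>k. ?K k xs ys \<Longrightarrow> list_emb P xs ys"
  proof (induction ys arbitrary: xs)
    case Nil
    then show ?case by (cases xs) auto
  next
    case (Cons y ys)
    from Cons.prems obtain k where k: "?K k xs (y # ys)" ..
    then have k_emb: "k i < length (y # ys) \<and> P (xs ! i) ((y # ys) ! k i)" if "i < length xs" for i
      using that by blast
    have k_mono: "k i < k j" if "i < j" "j < length xs" for i j
      using k that by blast
    show ?case
    proof (cases xs)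
      case xs: (Cons x xs')
      show ?thesis
      proof (cases "k 0 = 0")
        case True
        have pos: "0 < k (Suc i)" if "i < length xs'" for i
          using k_mono[of 0 "Suc i"] that xs True by simp
        have "?K (\<lambda>i. k (Suc i) - 1) xs' ys"
        proof (intro conjI allI impI)
          fix i assume i: "i < length xs'"
          show "k (Suc i) - 1 < length ys" "P (xs' ! i) (ys ! (k (Suc i) - 1))"
            using k_emb[of "Suc i"] pos[OF i] i xs by (auto simp: nth_Cons')
        next
          fix i j assume ij: "i < j" "j < length xs'"
          then have "k (Suc i) < k (Suc j)"
            using k_mono xs by simp
          then show "k (Suc i) - 1 < k (Suc j) - 1"
            using pos[of i] ij by linarith
        qed
        then have "list_emb P xs' ys"
          by (intro Cons.IH exI[of _ "\<lambda>i. k (Suc i) - 1"])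
        moreover have "P x y"
          using k_emb[of 0] xs True by simp
        ultimately show ?thesis
          using xs by (simp add: list_emb_Cons2)
      next
        case False
        have pos: "0 < k i" if "i < length xs" for i
          using k_mono[of 0 i] that False by (cases i) auto
        have "?K (\<lambda>i. k i - 1) xs ys"
        proof (intro conjI allI impI)
          fix i assume i: "i < length xs"
          show "k i - 1 < length ys" "P (xs ! i) (ys ! (k i - 1))"
            using k_emb[OF i] pos[OF i] by (auto simp: nth_Cons')
        next
          fix i j assume ij: "i < j" "j < length xs"
          then have "k i < k j"
            using k_mono by simp
          then show "k i - 1 < k j - 1"
            using pos[of i] ij by linarith
        qed
        then show ?thesis
          by (intro list_emb_Cons Cons.IH exI[of _ "\<lambda>i. k i - 1"])
      qed
    qed simp
  qed
qed

lemma temb_iff_node: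
  assumes "k < length t"
  shows "temb x (t ! k) \<longleftrightarrow>
     (\<exists>w. k # w \<in> nodes t \<and> label t (k # w) = root x \<and> emb (children x) (subforest_at t (k # w)))"
  using assms
proof (induction "t ! k" arbitrary: t k)
  case (Node a g)
  have tk: "root (t ! k) = a" "children (t ! k) = g"
    using Node.hyps(2) by (metis tree.sel)+
  have IH: "temb x (g ! j) \<longleftrightarrow>
     (\<exists>w. j # w \<in> nodes g \<and> label g (j # w) = root x \<and> emb (children x) (subforest_at g (j # w)))"
    if "j < length g" for j
    using Node.hyps(1)[OF nth_mem[OF that] that] .
  have "temb x (Node a g) \<longleftrightarrow> (root x = a \<and> emb (children x) g) \<or> (\<exists>j < length g. temb x (g ! j))"
    by (subst temb.simps) (cases x; auto simp: in_set_conv_nth)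
  also have "\<dots> \<longleftrightarrow> (\<exists>w. (w = [] \<or> w \<in> nodes g) \<and> label t (k # w) = root x \<and>
      emb (children x) (subforest_at g w))"
    (is "?A \<or> ?B \<longleftrightarrow> ?C")
  proof
    assume "?A \<or> ?B"
    then show ?C
    proof
      assume ?A
      then show ?C
        using tk by (intro exI[of _ "[]"]) simp
    next
      assume ?B
      then obtain j w where "j # w \<in> nodes g" "label g (j # w) = root x"
        "emb (children x) (subforest_at g (j # w))"
        using IH by blast
      then show ?C
        using tk by (intro exI[of _ "j # w"]) simp
    qed
  next
    assume ?C
    then obtain w where w: "w = [] \<or> w \<in> nodes g" "label t (k # w) = root x"
      "emb (children x) (subforest_at g w)"
      by blast
    show "?A \<or> ?B"
    proof (cases w)
      case Nil
      then show ?thesis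
        using w tk by simp
    next
      case (Cons j v)
      then have "j < length g" "label g (j # v) = root x"
        using w tk by (simp_all add: Cons_in_nodes)
      then show ?thesis
        using w IH Cons by blast
    qed
  qed
  finally show ?case
    using Node.hyps(2) Node.prems tk by (simp add: Cons_in_nodes)
qed

text \<open>Both relations unfold to the same choice: nodes in distinct trees of \<open>t\<close>
  for the roots of \<open>s\<close>, in order, with the children embedded below them. Induction on
  the size of \<open>s\<close> closes the recursion.\<close>

lemma cca_piece_iff_emb: "s \<unlhd>\<^sub>F t \<longleftrightarrow> emb s t"
  unfolding cca_piece_iff_piece_map
proof (induction "size_list size s" arbitrary: s t rule: less_induct)
  case less
  have IH: "(\<exists>\<chi>. piece_map \<chi> (children (s ! i)) u) \<longleftrightarrow> emb (children (s ! i)) u"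
    if "i < length s" for i u
  proof (rule less)
    have "size (s ! i) \<le> size_list size s"
      using that by (intro size_list_estimation'[of "s ! i"]) auto
    moreover have "size_list size (children (s ! i)) < size (s ! i)"
      by (cases "s ! i") auto
    ultimately show "size_list size (children (s ! i)) < size_list size s"
      by linarith
  qed
  have "(\<exists>\<phi>. piece_map \<phi> s t) \<longleftrightarrow>
     (\<exists>\<psi>. (\<forall>i < length s. \<psi> i \<in> nodes t \<and> label t (\<psi> i) = root (s ! i) \<and>
            emb (children (s ! i)) (subforest_at t (\<psi> i))) \<and>
          (\<forall>i j. i < j \<longrightarrow> j < length s \<longrightarrow> hd (\<psi> i) < hd (\<psi> j)))"
    by (subst piece_map_iff_children) (simp add: IH cong: conj_cong)
  also have "\<dots> \<longleftrightarrow> (\<exists>k. (\<forall>i < length s. k i < length t \<and> temb (s ! i) (t ! k i)) \<and>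
          (\<forall>i j. i < j \<longrightarrow> j < length s \<longrightarrow> k i < k j))"
    (is "(\<exists>\<psi>. ?A \<psi>) \<longleftrightarrow> (\<exists>k. ?B k)")
  proof
    assume "\<exists>\<psi>. ?A \<psi>"
    then obtain \<psi> where \<psi>: "?A \<psi>" ..
    have "hd (\<psi> i) < length t \<and> temb (s ! i) (t ! hd (\<psi> i))" if "i < length s" for i
    proof -
      obtain k w where kw: "\<psi> i = k # w"
        using \<psi> \<open>i < length s\<close> by (cases "\<psi> i") auto
      then have "k < length t"
        using \<psi> \<open>i < length s\<close> by (metis Cons_in_nodes)
      then show ?thesis
        using \<psi> \<open>i < length s\<close> kw temb_iff_node[of k t "s ! i"] by (metis list.sel(1))
    qed
    then have "?B (\<lambda>i. hd (\<psi> i))"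
      using \<psi> by blast
    then show "\<exists>k. ?B k" by (intro exI[of _ "\<lambda>i. hd (\<psi> i)"])
  next
    assume "\<exists>k. ?B k"
    then obtain k where k: "?B k" ..
    have "\<forall>i. \<exists>w. i < length s \<longrightarrow> k i # w \<in> nodes t \<and> label t (k i # w) = root (s ! i) \<and>
        emb (children (s ! i)) (subforest_at t (k i # w))"
    proof
      fix i
      show "\<exists>w. i < length s \<longrightarrow> k i # w \<in> nodes t \<and> label t (k i # w) = root (s ! i) \<and>
          emb (children (s ! i)) (subforest_at t (k i # w))"
      proof (cases "i < length s")
        case True
        then have "k i < length t" "temb (s ! i) (t ! k i)"
          using k by blast+
        then show ?thesis
          using temb_iff_node[of "k i" t "s ! i"] by blast
      qed simp
    qed
    from choice[OF this] obtain w where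
      "\<forall>i. i < length s \<longrightarrow> k i # w i \<in> nodes t \<and> label t (k i # w i) = root (s ! i) \<and>
        emb (children (s ! i)) (subforest_at t (k i # w i))" ..
    then have "?A (\<lambda>i. k i # w i)"
      using k by (simp del: label.simps subforest_at.simps)
    then show "\<exists>\<psi>. ?A \<psi>" by (intro exI[of _ "\<lambda>i. k i # w i"])
  qed
  also have "\<dots> \<longleftrightarrow> emb s t"
    by (rule list_emb_iff_nth[symmetric])
  finally show ?case .
qed

section \<open>Necessity of the identities\<close>

lemma list_emb_append_rightD:
  "list_emb P xs (ys @ zs) \<Longrightarrow> \<exists>us vs. xs = us @ vs \<and> list_emb P us ys \<and> list_emb P vs zs"
proof (induction ys arbitrary: xs)
  case Nil
  then show ?case by (intro exI[of _ "[]"] exI[of _ xs]) simp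
next
  case (Cons y ys)
  from Cons.prems have "list_emb P xs (y # (ys @ zs))" by simp
  then show ?case
  proof cases
    case list_emb_Nil
    then show ?thesis by (intro exI[of _ "[]"]) simp
  next
    case list_emb_Cons
    then show ?thesis
      using Cons.IH by (meson list_emb.list_emb_Cons)
  next
    case (list_emb_Cons2 x xs')
    then obtain us vs where "xs' = us @ vs" "list_emb P us ys" "list_emb P vs zs"
      using Cons.IH by blast
    then show ?thesis
      using list_emb_Cons2 by (intro exI[of _ "x # us"] exI[of _ vs]) auto
  qed
qed

lemma list_emb_append3_rightD:
  assumes "list_emb P xs (as @ bs @ cs)"
  shows "\<exists>x1 x2 x3. xs = x1 @ x2 @ x3 \<and> list_emb P x1 as \<and> list_emb P x2 bs \<and> list_emb P x3 cs"
proof -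
  obtain x1 y where "xs = x1 @ y" "list_emb P x1 as" "list_emb P y (bs @ cs)"
    using list_emb_append_rightD[OF assms] by blast
  then show ?thesis
    using list_emb_append_rightD[of P y bs cs] by blast
qed

lemma list_emb_singletonD: "list_emb P xs [y] \<Longrightarrow> xs = [] \<or> (\<exists>x. xs = [x] \<and> P x y)"
  by (cases xs) (auto dest!: list_emb_ConsD simp: Cons_eq_append_conv)

lemma list_emb_single_iff: "list_emb P [x] ys \<longleftrightarrow> (\<exists>y \<in> set ys. P x y)"
proof
  show "\<exists>y \<in> set ys. P x y \<Longrightarrow> list_emb P [x] ys"
    by (auto dest!: split_list intro!: list_emb_append2 list_emb_Cons2)
qed (auto elim: list_emb_set)

lemma emb_Nil_or_single:
  assumes "length s \<le> 1"
  shows "s = [] \<or> (\<exists>t. s = [t])"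
  using assms by (cases s) auto

lemma emb_into_Node: "length s \<le> 1 \<Longrightarrow> emb s g \<Longrightarrow> emb s [Node a g]"
proof -
  assume "length s \<le> 1" "emb s g"
  then consider "s = []" | t where "s = [t]" "emb [t] g"
    using emb_Nil_or_single by blast
  then show ?thesis
  proof cases
    case 2
    then show ?thesis
      by (auto simp: list_emb_single_iff intro: temb_sub)
  qed simp
qed

lemma emb_middle: "emb s (l @ s @ r)"
  using list_emb_append2[OF list_emb_prefix[OF emb_refl]] .

lemma emb_fill_self: "length s \<le> 1 \<Longrightarrow> emb s (fill p s)"
proof (induction p)
  case (Hole l r)
  then show ?case
    by (simp add: emb_middle)
next
  case (Layer l a p r)
  then have "emb s ([Node a (fill p s)] @ r)"
    by (intro list_emb_prefix emb_into_Node)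
  then show ?case
    by (simp add: list_emb_append2)
qed

lemma emb_fill_mono: "emb s s' \<Longrightarrow> emb (fill p s) (fill p s')"
  by (induction p) (auto intro!: list_emb_append_mono temb_node)

section \<open>Node counts and splitting a piece at the hole\<close>

lemma card_nodes_Cons: "card (nodes (t # f)) = Suc (card (nodes (children t)) + card (nodes f))"
proof -
  define sh where "sh = (\<lambda>x. case x of [] \<Rightarrow> [] | i # y \<Rightarrow> Suc i # y)"
  have sh_iff: "sh x = Suc j # y \<longleftrightarrow> x = j # y" for x j y
    by (cases x) (auto simp: sh_def)
  have "nodes (t # f) = (#) 0 ` insert [] (nodes (children t)) \<union> sh ` nodes f"
  proof (rule Set.set_eqI)
    fix x
    show "x \<in> nodes (t # f) \<longleftrightarrow> x \<in> (#) 0 ` insert [] (nodes (children t)) \<union> sh ` nodes f"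
    proof (cases x)
      case (Cons i y)
      show ?thesis
      proof (cases i)
        case 0
        have "0 # y \<notin> sh ` nodes f"
          by (auto simp: sh_def split: list.splits)
        then show ?thesis
          using Cons 0 by (auto simp: Cons_in_nodes)
      next
        case (Suc j)
        have "Suc j # y \<in> sh ` nodes f \<longleftrightarrow> j # y \<in> nodes f"
          unfolding image_iff using sh_iff by metis
        then show ?thesis
          using Cons Suc by (auto simp: Cons_in_nodes)
      qed
    next
      case Nil
      have "[] \<notin> sh ` nodes f"
        by (auto simp: sh_def split: list.splits)
      then show ?thesis
        using Nil by auto
    qed
  qed
  moreover have "(#) 0 ` insert [] (nodes (children t)) \<inter> sh ` nodes f = {}"
    by (auto simp: sh_def split: list.splits)
  moreover have "inj_on sh (nodes f)"
    by (auto simp: inj_on_def sh_def split: list.splits)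
  moreover have "inj_on ((#) 0) (insert [] (nodes (children t)))"
    by (auto simp: inj_on_def)
  ultimately show ?thesis
    by (simp add: card_Un_disjoint card_image)
qed

lemma card_nodes_Nil [simp]: "card (nodes []) = 0"
  using nodes_eq[of "[]"] by simp

lemma card_nodes_append: "card (nodes (f @ g)) = card (nodes f) + card (nodes g)"
  by (induction f) (simp_all add: card_nodes_Cons)

lemma card_nodes_eq_0: "card (nodes f) = 0 \<longleftrightarrow> f = []"
  by (cases f) (simp_all add: card_nodes_Cons)

text \<open>\<open>y\<close> is the part of \<open>x\<close> that is mapped into the hole.\<close>

lemma emb_fillD:
  assumes "emb x (fill p s)"
  shows "\<exists>y. emb y s \<and> (y = x \<or> card (nodes y) < card (nodes x)) \<and>
     (\<forall>s'. emb y s' \<longrightarrow> emb x (fill p s'))"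
  using assms
proof (induction p arbitrary: x)
  case (Hole l r)
  then obtain x1 y x3 where x: "x = x1 @ y @ x3" "emb x1 l" "emb y s" "emb x3 r"
    using list_emb_append3_rightD[of temb x l s r] by auto
  have "y = x \<or> card (nodes y) < card (nodes x)"
    unfolding x(1) by (cases x1; cases x3) (simp_all add: card_nodes_append card_nodes_Cons)
  moreover have "emb x (fill (Hole l r) s')" if "emb y s'" for s'
    using x that by (simp add: list_emb_append_mono)
  ultimately show ?case
    using x(3) by blast
next
  case (Layer l a p r)
  then have "emb x (l @ [Node a (fill p s)] @ r)"
    by simp
  then obtain x1 x2 x3 where x: "x = x1 @ x2 @ x3" "emb x1 l" "emb x2 [Node a (fill p s)]" "emb x3 r"
    using list_emb_append3_rightD[of temb x l "[Node a (fill p s)]" r] by blast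
  have *: "emb x (fill (Layer l a p r) s')" if "emb x2 [Node a (fill p s')]" for s'
    unfolding fill.simps x(1) by (intro list_emb_append_mono x(2,4) that)
  from list_emb_singletonD[OF x(3)] show ?case
  proof (elim disjE exE conjE)
    assume "x2 = []"
    then have "emb x (fill (Layer l a p r) s')" for s'
      by (intro *) simp
    moreover have "[] = x \<or> card (nodes []) < card (nodes x)"
      using card_nodes_eq_0[of x] by auto
    ultimately show ?thesis
      using list_emb_Nil by blast
  next
    fix t assume t: "x2 = [t]" "temb t (Node a (fill p s))"
    from t(2) show ?thesis
    proof cases
      case (temb_node f)
      then obtain y where y: "emb y s" "y = f \<or> card (nodes y) < card (nodes f)"
        "\<forall>s'. emb y s' \<longrightarrow> emb f (fill p s')"
        using Layer.IH by blast
      have "card (nodes f) < card (nodes x)"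
        using x(1) t temb_node by (simp add: card_nodes_append card_nodes_Cons)
      moreover have "emb x (fill (Layer l a p r) s')" if "emb y s'" for s'
        using * y(3) that t(1) temb_node by (simp add: temb.temb_node)
      ultimately show ?thesis
        using y by (intro exI[of _ y]) auto
    next
      case (temb_sub u)
      then have "emb [t] (fill p s)"
        by (auto simp: list_emb_single_iff)
      then obtain y where y: "emb y s" "y = [t] \<or> card (nodes y) < card (nodes [t])"
        "\<forall>s'. emb y s' \<longrightarrow> emb [t] (fill p s')"
        using Layer.IH by blast
      have "y = x \<or> card (nodes y) < card (nodes x)"
        using y(2) x(1) t(1) by (cases x1; cases x3) (auto simp: card_nodes_append card_nodes_Cons)
      moreover have "emb x (fill (Layer l a p r) s')" if "emb y s'" for s'
        using * y(3) that t(1) emb_into_Node[of "[t]"] by simp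
      ultimately show ?thesis
        using y(1) by blast
    qed
  qed
qed

lemma emb_fill_pow_mono: "emb s s' \<Longrightarrow> emb ((fill p ^^ n) s) ((fill p ^^ n) s')"
  by (induction n) (simp_all add: emb_fill_mono)

lemma emb_fill_pow_pump:
  "\<lbrakk>card (nodes x) \<le> n; emb x ((fill q ^^ Suc n) t)\<rbrakk> \<Longrightarrow> emb x ((fill q ^^ n) t)"
proof (induction n arbitrary: x)
  case 0
  then show ?case by (simp add: card_nodes_eq_0)
next
  case (Suc n)
  then obtain y where y: "emb y ((fill q ^^ Suc n) t)" "y = x \<or> card (nodes y) < card (nodes x)"
    "\<forall>s'. emb y s' \<longrightarrow> emb x (fill q s')"
    using emb_fillD[of x q "(fill q ^^ Suc n) t"] by auto
  show ?case
  proof (cases "y = x")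
    case False
    then have "emb y ((fill q ^^ n) t)"
      using y Suc by auto
    then show ?thesis
      using y(3) by simp
  qed (use y in simp)
qed

section \<open>Substitution into pieces of contexts\<close>

primrec graft :: "'a forest \<Rightarrow> 'a option tree \<Rightarrow> 'a forest" where
  "graft s (Node b f) =
     (case b of None \<Rightarrow> s | Some a \<Rightarrow> [Node a (concat (map (graft s) f))])"

text \<open>A hole with children would lose them in \<open>graft\<close>; with holes as leaves,
  \<open>temb_sub\<close> never descends through a hole.\<close>

primrec leaf_holes :: "'a option tree \<Rightarrow> bool" where
  "leaf_holes (Node b f) \<longleftrightarrow> (b = None \<longrightarrow> f = []) \<and> list_all leaf_holes f"

lemma graft_map_Some [simp]: "graft s (map_tree Some t) = [t]"
proof (induction t)
  case (Node a f)
  then have "map (graft s \<circ> map_tree Some) f = map (\<lambda>t. [t]) f"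
    by simp
  then have "concat (map (graft s \<circ> map_tree Some) f) = concat (map (\<lambda>t. [t]) f)"
    by (rule arg_cong)
  then show ?case
    by simp
qed

lemma leaf_holes_map_Some [simp]: "leaf_holes (map_tree Some t)"
  by (induction t) (simp add: list_all_iff)

text \<open>Pieces of contexts are defined on forests that carry the label \<open>None\<close> at
  the hole, so filling has to be expressed on such forests.\<close>

lemma graft_ctx_forest: "concat (map (graft s) (ctx_forest p)) = fill p s"
  by (induction p) (simp_all add: comp_def)

lemma leaf_holes_ctx_forest: "list_all leaf_holes (ctx_forest p)"
  by (induction p) (auto simp: list_all_iff)

lemma emb_grafts:
  assumes "list_emb (\<lambda>x y. leaf_holes y \<longrightarrow> emb (graft s x) (graft s y)) f g" "list_all leaf_holes g"
  shows "emb (concat (map (graft s) f)) (concat (map (graft s) g))"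
  using assms by (induction rule: list_emb.induct) (auto intro: list_emb_append_mono)

text \<open>The bound on \<open>s\<close> serves the case \<open>temb_sub\<close>: the grafted
  forest gets a parent, and if the root of \<open>x\<close> is the hole, this forest is
  \<open>s\<close> itself.\<close>

lemma emb_graft:
  assumes "temb x y" "leaf_holes y" "length s \<le> 1"
  shows "emb (graft s x) (graft s y)"
  using assms
proof (induction rule: temb.induct)
  case (temb_node f g b)
  have "list_emb (\<lambda>x y. leaf_holes y \<longrightarrow> emb (graft s x) (graft s y)) f g"
    using list_emb_mono[of "\<lambda>x y. temb x y \<and> (leaf_holes y \<longrightarrow> length s \<le> 1 \<longrightarrow> emb (graft s x) (graft s y))"
        "\<lambda>x y. leaf_holes y \<longrightarrow> emb (graft s x) (graft s y)" f g] temb_node assms(3) by blast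
  then have "emb (concat (map (graft s) f)) (concat (map (graft s) g))"
    using temb_node by (intro emb_grafts) auto
  then show ?case
    by (auto split: option.splits intro: temb.temb_node)
next
  case (temb_sub x y g b)
  then obtain a where b: "b = Some a"
    by (cases b) auto
  have "leaf_holes y"
    using temb_sub by (auto simp: list_all_iff)
  then have "emb (graft s x) (graft s y)"
    using temb_sub by blast
  moreover have "emb (graft s y) (concat (map (graft s) g))"
    using temb_sub(2) by (auto simp: in_set_conv_decomp emb_middle)
  moreover have "length (graft s x) \<le> 1"
    using assms(3) by (cases x) (auto split: option.splits)
  ultimately have "emb (graft s x) [Node a (concat (map (graft s) g))]"
    by (meson emb_into_Node emb_trans)
  then show ?case
    by (simp add: b)
qed

lemma ctx_piece_fill:
  assumes "p \<unlhd>\<^sub>C q" "length s \<le> 1"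
  shows "emb (fill p s) (fill q s)"
proof -
  have "emb (ctx_forest p) (ctx_forest q)"
    using assms(1) unfolding ctx_piece_def cca_piece_iff_emb .
  moreover have "list_emb temb f g \<longrightarrow> list_all leaf_holes g \<longrightarrow>
      list_emb (\<lambda>x y. leaf_holes y \<longrightarrow> emb (graft s x) (graft s y)) f g" for f g
    using list_emb_mono[of temb "\<lambda>x y. leaf_holes y \<longrightarrow> emb (graft s x) (graft s y)" f g]
      emb_graft assms(2) by blast
  ultimately show ?thesis
    using emb_grafts[of s "ctx_forest p" "ctx_forest q"] leaf_holes_ctx_forest
    unfolding graft_ctx_forest by blast
qed

lemma is_tree_ctxD: "is_tree_ctx p \<Longrightarrow> \<exists>a q. p = Layer [] a q []"
proof -
  assume p: "is_tree_ctx p"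
  then obtain x where x: "x \<in> nodes (ctx_forest p)" "\<forall>y \<in> nodes (ctx_forest p). prefix x y"
    unfolding is_tree_ctx_def by blast
  have "length (ctx_forest p) \<le> 1"
  proof (rule ccontr)
    assume "\<not> ?thesis"
    then have "0 < length (ctx_forest p)" "1 < length (ctx_forest p)"
      by linarith+
    then have "[0] \<in> nodes (ctx_forest p)" "[1] \<in> nodes (ctx_forest p)"
      by (simp_all add: Cons_in_nodes)
    then have "prefix x [0]" "prefix x [1]"
      using x(2) by blast+
    then have "x = []"
      by (cases x) auto
    then show False
      using x(1) by simp
  qed
  then show ?thesis
    using p by (cases p) (auto simp: is_tree_ctx_def)
qed

section \<open>Absorption in testable languages\<close>

definition testable_at :: "nat \<Rightarrow> 'a forest set \<Rightarrow> bool" where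
  "testable_at n L \<longleftrightarrow>
     (\<forall>t t'. cca_pieces_upto n t = cca_pieces_upto n t' \<longrightarrow> (t \<in> L \<longleftrightarrow> t' \<in> L))"

text \<open>Having the same pieces of size at most \<open>n\<close> is a congruence, because the
  part of a small piece that goes into the hole of a context is itself small. Lying between
  \<open>s\<close> and \<open>s''\<close>, the forest \<open>s'\<close> has the small pieces of
  \<open>s\<close>.\<close>

lemma syn_eq_of_sandwich:
  assumes "testable_at n L" "emb s s'" "emb s' s''"
    and "\<And>x. card (nodes x) \<le> n \<Longrightarrow> emb x s'' \<Longrightarrow> emb x s"
  shows "syn L s' = syn L s"
proof -
  have same: "emb x s' \<longleftrightarrow> emb x s" if "card (nodes x) \<le> n" for x
    using assms that emb_trans by blast
  have imp: "emb x (fill p t')" if x: "emb x (fill p t)" "card (nodes x) \<le> n"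
    and imp: "\<And>y. card (nodes y) \<le> n \<Longrightarrow> emb y t \<Longrightarrow> emb y t'" for x p t t'
  proof -
    obtain y where "emb y t" "y = x \<or> card (nodes y) < card (nodes x)"
      "\<forall>s'. emb y s' \<longrightarrow> emb x (fill p s')"
      using emb_fillD[OF x(1)] by blast
    then show ?thesis
      using x(2) imp by auto
  qed
  have "emb x (fill p s') \<longleftrightarrow> emb x (fill p s)" if "card (nodes x) \<le> n" for x p
    using imp[of x p s' s] imp[of x p s s'] that same by blast
  then have "cca_pieces_upto n (fill p s') = cca_pieces_upto n (fill p s)" for p
    unfolding cca_pieces_upto_def cca_piece_iff_emb by blast
  then have "fill p s' \<in> L \<longleftrightarrow> fill p s \<in> L" for p
    using assms(1) unfolding testable_at_def by blast
  then show ?thesis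
    by (simp add: syn_eq_iff syn_rel_def)
qed

lemma syn_fill: "syn L (fill p s) = syn_act L (syn_ctx L p) (syn L s)"
  by simp

lemma syn_ctx_pow: "syn_ctx L p [^]\<^bsub>syn_V L\<^esub> n = syn_ctx L ((ctx_comp p ^^ n) empty_ctx)"
proof -
  interpret forest_algebra "syn_H L" "syn_V L" "syn_act L"
    by (rule forest_algebra_syn)
  have p: "syn_ctx L p \<in> carrier (syn_V L)"
    by (simp add: carrier_syn_V)
  show ?thesis
  proof (induction n)
    case (Suc n)
    then show ?case
      using V.nat_pow_Suc2[OF p, of n] by simp
  qed (simp add: one_syn_V)
qed

lemma fill_ctx_pow: "fill ((ctx_comp p ^^ n) empty_ctx) s = (fill p ^^ n) s"
  by (induction n) simp_all

lemma syn_act_pow: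
  "syn_act L (syn_ctx L p [^]\<^bsub>syn_V L\<^esub> n) (syn L s) = syn L ((fill p ^^ n) s)"
  by (simp add: syn_ctx_pow fill_ctx_pow)

lemma syn_pow: "syn L t [^]\<^bsub>syn_H L\<^esub> n = syn L ((fill (Hole t []) ^^ n) [])"
proof -
  interpret forest_algebra "syn_H L" "syn_V L" "syn_act L"
    by (rule forest_algebra_syn)
  have t: "syn L t \<in> carrier (syn_H L)"
    by (simp add: carrier_syn_H)
  show ?thesis
  proof (induction n)
    case (Suc n)
    then show ?case
      using H.nat_pow_Suc2[OF t, of n] by simp
  qed (simp add: one_syn_H)
qed

text \<open>This replaces the exponent \<omega> by a multiple that is at least the bound
  \<open>n\<close> on the size of pieces, as pumping requires.\<close>

lemma idempotent_pow_mult: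
  assumes "monoid M" "x \<in> carrier M" "is_idempotent M (x [^]\<^bsub>M\<^esub> \<omega>)" "n > 0"
  shows "x [^]\<^bsub>M\<^esub> (\<omega> * n :: nat) = x [^]\<^bsub>M\<^esub> (\<omega> :: nat)"
proof -
  interpret monoid M by fact
  show ?thesis
    using \<open>n > 0\<close>
  proof (induction n rule: nat_induct_non_zero)
    case (Suc n)
    have "x [^]\<^bsub>M\<^esub> (\<omega> * Suc n) = x [^]\<^bsub>M\<^esub> \<omega> \<otimes>\<^bsub>M\<^esub> x [^]\<^bsub>M\<^esub> (\<omega> * n)"
      using assms(2) by (simp add: nat_pow_mult)
    then show ?case
      using Suc assms(3) by (simp add: is_idempotent_def)
  qed simp
qed

text \<open>The sandwich is q^N t, p q^N t, q^(N+1) t, and pumping removes the extra copy. That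
  \<open>q\<close> always produces at most one tree allows \<open>p\<close> to be wrapped around q^N
  t.\<close>

lemma testable_absorb_left:
  assumes "testable_at n L" "n \<le> N" "length t \<le> 1" "\<And>z. length (fill q z) \<le> 1"
    and "\<And>z. length z \<le> 1 \<Longrightarrow> emb (fill p z) (fill q z)"
  shows "syn L (fill p ((fill q ^^ N) t)) = syn L ((fill q ^^ N) t)"
proof -
  have len: "length ((fill q ^^ N) t) \<le> 1"
    using assms(3,4) by (cases N) auto
  show ?thesis
  proof (rule syn_eq_of_sandwich[OF assms(1)])
    show "emb ((fill q ^^ N) t) (fill p ((fill q ^^ N) t))"
      using len by (rule emb_fill_self)
    show "emb (fill p ((fill q ^^ N) t)) ((fill q ^^ Suc N) t)"
      using assms(5)[OF len] by simp
    show "emb x ((fill q ^^ N) t)" if "card (nodes x) \<le> n" "emb x ((fill q ^^ Suc N) t)" for x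
      using emb_fill_pow_pump[of x N q t] that assms(2) by simp
  qed
qed

lemma testable_absorb_right:
  assumes "testable_at n L" "n \<le> N" "length t \<le> 1" "p \<unlhd>\<^sub>C q"
  shows "syn L ((fill q ^^ N) (fill p t)) = syn L ((fill q ^^ N) t)"
proof (rule syn_eq_of_sandwich[OF assms(1)])
  show "emb ((fill q ^^ N) t) ((fill q ^^ N) (fill p t))"
    using assms(3) by (intro emb_fill_pow_mono emb_fill_self)
  show "emb ((fill q ^^ N) (fill p t)) ((fill q ^^ Suc N) t)"
    using ctx_piece_fill[OF assms(4,3)] by (simp add: emb_fill_pow_mono funpow_swap1)
  show "emb x ((fill q ^^ N) t)" if "card (nodes x) \<le> n" "emb x ((fill q ^^ Suc N) t)" for x
    using emb_fill_pow_pump[of x N q t] that assms(2) by simp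
qed

text \<open>Absorption of \<open>v\<close> from the right uses the comparable contexts
  \<open>p\<close> and \<open>q\<close> behind \<open>V_piece\<close>. From the left, wrapping
  requires tree contexts: \<open>p'\<close> and \<open>q'\<close> have the right types but need not
  be comparable, so the two pairs are combined. First u v is seen to fix u^\<omega> h, then v
  alone.\<close>

lemma testable_imp_V_identity:
  fixes \<omega> :: nat
  assumes test: "testable_at n L" and "n > 0" "\<omega> > 0"
    and idem: "\<And>v. v \<in> carrier (syn_V L) \<Longrightarrow> is_idempotent (syn_V L) (v [^]\<^bsub>syn_V L\<^esub> \<omega>)"
    and h: "tree_type L h \<or> h = \<one>\<^bsub>syn_H L\<^esub>"
    and u: "tree_ctx_type L u" and v: "tree_ctx_type L v" and vu: "V_piece L v u"
  shows "syn_act L (u [^]\<^bsub>syn_V L\<^esub> \<omega> \<otimes>\<^bsub>syn_V L\<^esub> v) h = syn_act L (u [^]\<^bsub>syn_V L\<^esub> \<omega>) h"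
    "syn_act L (v \<otimes>\<^bsub>syn_V L\<^esub> u [^]\<^bsub>syn_V L\<^esub> \<omega>) h = syn_act L (u [^]\<^bsub>syn_V L\<^esub> \<omega>) h"
proof -
  obtain t where t: "length t \<le> 1" "syn L t = h"
    using h unfolding tree_type_def is_tree_def one_syn_H by force
  obtain p q where pq: "p \<unlhd>\<^sub>C q" "syn_ctx L p = v" "syn_ctx L q = u"
    using vu unfolding V_piece_def by blast
  obtain p' q' where pq': "is_tree_ctx p'" "syn_ctx L p' = v" "is_tree_ctx q'" "syn_ctx L q' = u"
    using u v unfolding tree_ctx_type_def by blast
  have len: "length (fill p' z) \<le> 1" "length (fill q' z) \<le> 1" for z
    using is_tree_ctxD[OF pq'(1)] is_tree_ctxD[OF pq'(3)] by auto
  define N where "N = \<omega> * n"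
  have N: "n \<le> N" "N > 0"
    using assms(2,3) by (simp_all add: N_def)
  interpret forest_algebra "syn_H L" "syn_V L" "syn_act L"
    by (rule forest_algebra_syn)
  have uc: "u \<in> carrier (syn_V L)"
    using pq(3) by (auto simp: carrier_syn_V)
  have pow: "u [^]\<^bsub>syn_V L\<^esub> (\<omega> * k) = u [^]\<^bsub>syn_V L\<^esub> \<omega>" if "k > 0" for k :: nat
    using idempotent_pow_mult[OF V.monoid_axioms uc idem[OF uc] that] .
  have u\<omega>: "u [^]\<^bsub>syn_V L\<^esub> \<omega> = syn_ctx L ((ctx_comp q ^^ N) empty_ctx)"
    using pow[OF \<open>n > 0\<close>] by (simp add: N_def pq(3)[symmetric] syn_ctx_pow)
  show "syn_act L (u [^]\<^bsub>syn_V L\<^esub> \<omega> \<otimes>\<^bsub>syn_V L\<^esub> v) h = syn_act L (u [^]\<^bsub>syn_V L\<^esub> \<omega>) h"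
    unfolding u\<omega> unfolding t(2)[symmetric] pq(2)[symmetric]
    using testable_absorb_right[OF test N(1) t(1) pq(1)] by (simp add: fill_ctx_pow)
  define U where "U = syn_act L u"
  define W where "W = syn_act L v"
  have U: "syn L (fill q z) = U (syn L z)" "syn L (fill q' z) = U (syn L z)" for z
    using syn_fill[of L q z] syn_fill[of L q' z] by (simp_all add: U_def pq pq')
  have W: "syn L (fill p z) = W (syn L z)" "syn L (fill p' z) = W (syn L z)" for z
    using syn_fill[of L p z] syn_fill[of L p' z] by (simp_all add: W_def pq pq')
  define s where "s = (fill q' ^^ N) t"
  have len_s: "length s \<le> 1"
    using len(2) t(1) unfolding s_def by (cases N) auto
  have h1: "syn L s = syn_act L (u [^]\<^bsub>syn_V L\<^esub> \<omega>) h"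
    using syn_act_pow[of L q' N t] pow[OF \<open>n > 0\<close>] by (simp add: s_def N_def pq' t(2))
  have h1': "syn L ((fill q' ^^ (N * 2)) t) = syn L s"
    using syn_act_pow[of L q' "N * 2" t] pow[of "n * 2"] \<open>n > 0\<close> h1
    by (simp add: N_def pq' t(2) mult.assoc)
  \<comment> \<open>\<open>p\<close> and \<open>q\<close> need not be tree contexts, but \<open>q' p\<close> and \<open>q' q\<close> are.\<close>
  have "syn L (fill (ctx_comp q' p) ((fill (ctx_comp q' q) ^^ N) t)) =
      syn L ((fill (ctx_comp q' q) ^^ N) t)"
    using len(2) ctx_piece_fill[OF pq(1)]
    by (intro testable_absorb_left[OF test N(1) t(1)]) (simp_all add: emb_fill_mono)
  moreover have "syn L ((fill (ctx_comp q' q) ^^ k) t) = syn L ((fill q' ^^ (k * 2)) t)" for k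
    by (induction k) (simp_all add: U)
  ultimately have UW: "U (W (syn L s)) = syn L s"
    using h1' by (simp add: U W)
  \<comment> \<open>Now \<open>q' p'\<close> fixes the class of \<open>s\<close>, and
    \<open>p' z\<close> is a piece of \<open>q' p' z\<close>, so that powers of \<open>q' p'\<close>
    absorb \<open>p'\<close>.\<close>
  have "syn L (fill p' ((fill (ctx_comp q' p') ^^ N) s)) = syn L ((fill (ctx_comp q' p') ^^ N) s)"
    using len by (intro testable_absorb_left[OF test N(1) len_s]) (simp_all add: emb_fill_self)
  moreover have "syn L ((fill (ctx_comp q' p') ^^ k) s) = syn L s" for k
    by (induction k) (simp_all add: U W UW)
  ultimately have "W (syn L s) = syn L s"
    by (simp add: W)
  then show "syn_act L (v \<otimes>\<^bsub>syn_V L\<^esub> u [^]\<^bsub>syn_V L\<^esub> \<omega>) h = syn_act L (u [^]\<^bsub>syn_V L\<^esub> \<omega>) h"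
    using act_mult[of v "u [^]\<^bsub>syn_V L\<^esub> \<omega>" h] V.nat_pow_closed[OF uc] h1
    unfolding W_def pq(2)[symmetric] t(2)[symmetric] by (auto simp: carrier_syn_V carrier_syn_H)
qed

lemma testable_imp_H_identity:
  fixes \<omega> :: nat
  assumes test: "testable_at n L" and "n > 0" "\<omega> > 0"
    and idem: "\<And>h. h \<in> carrier (syn_H L) \<Longrightarrow> is_idempotent (syn_H L) (h [^]\<^bsub>syn_H L\<^esub> \<omega>)"
    and gh: "H_piece L g h"
  shows "h [^]\<^bsub>syn_H L\<^esub> \<omega> \<otimes>\<^bsub>syn_H L\<^esub> g = h [^]\<^bsub>syn_H L\<^esub> \<omega>"
    "g \<otimes>\<^bsub>syn_H L\<^esub> h [^]\<^bsub>syn_H L\<^esub> \<omega> = h [^]\<^bsub>syn_H L\<^esub> \<omega>"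
proof -
  obtain s t where st: "emb s t" "syn L s = g" "syn L t = h"
    using gh unfolding H_piece_def cca_piece_iff_emb by blast
  define N where "N = \<omega> * n"
  have N: "n \<le> N"
    using assms(2,3) by (simp add: N_def)
  interpret forest_algebra "syn_H L" "syn_V L" "syn_act L"
    by (rule forest_algebra_syn)
  have hc: "h \<in> carrier (syn_H L)"
    using st(3) by (auto simp: carrier_syn_H)
  let ?q = "Hole t []"
  let ?x = "(fill ?q ^^ N) []"
  have h\<omega>: "h [^]\<^bsub>syn_H L\<^esub> \<omega> = syn L ?x"
    using idempotent_pow_mult[OF H.monoid_axioms hc idem[OF hc] \<open>n > 0\<close>]
    by (simp add: N_def st(3)[symmetric] syn_pow)
  have append: "(fill ?q ^^ k) [] @ t = t @ (fill ?q ^^ k) []" for k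
    by (induction k) simp_all
  have pump: "emb x ?x" if "card (nodes x) \<le> n" "emb x ((fill ?q ^^ Suc N) [])" for x
    using emb_fill_pow_pump[of x N ?q "[]"] that N by simp
  have "syn L (?x @ s) = syn L ?x"
  proof (rule syn_eq_of_sandwich[OF test _ _ pump])
    show "emb ?x (?x @ s)"
      by (simp add: list_emb_prefix)
    have "emb (?x @ s) (?x @ t)"
      using st(1) by (intro list_emb_append_mono) simp_all
    then show "emb (?x @ s) ((fill ?q ^^ Suc N) [])"
      by (simp add: append)
  qed
  then show "h [^]\<^bsub>syn_H L\<^esub> \<omega> \<otimes>\<^bsub>syn_H L\<^esub> g = h [^]\<^bsub>syn_H L\<^esub> \<omega>"
    by (simp add: h\<omega> st(2)[symmetric])
  have "syn L (s @ ?x) = syn L ?x"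
  proof (rule syn_eq_of_sandwich[OF test _ _ pump])
    show "emb ?x (s @ ?x)"
      by (simp add: list_emb_append2)
    show "emb (s @ ?x) ((fill ?q ^^ Suc N) [])"
      using st(1) by (simp add: list_emb_append_mono)
  qed
  then show "g \<otimes>\<^bsub>syn_H L\<^esub> h [^]\<^bsub>syn_H L\<^esub> \<omega> = h [^]\<^bsub>syn_H L\<^esub> \<omega>"
    by (simp add: h\<omega> st(2)[symmetric])
qed

section \<open>Ideals, absorption and frames\<close>

definition order_ideal :: "('a \<Rightarrow> 'a \<Rightarrow> bool) \<Rightarrow> 'a set \<Rightarrow> bool" where
  "order_ideal P I \<longleftrightarrow> I \<noteq> {} \<and> downset P I \<and> (\<forall>x \<in> I. \<forall>y \<in> I. \<exists>z \<in> I. P x z \<and> P y z)"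

definition eventually_constant :: "('a \<Rightarrow> 'a \<Rightarrow> bool) \<Rightarrow> 'a set \<Rightarrow> ('a \<Rightarrow> 'b) \<Rightarrow> bool" where
  "eventually_constant P I \<beta> \<longleftrightarrow> (\<exists>w \<in> I. \<exists>c. \<forall>x \<in> I. P w x \<longrightarrow> \<beta> x = c)"

lemma eventually_constantI:
  "\<lbrakk>w \<in> I; \<And>x. x \<in> I \<Longrightarrow> P w x \<Longrightarrow> \<beta> x = c\<rbrakk> \<Longrightarrow> eventually_constant P I \<beta>"
  unfolding eventually_constant_def by (intro bexI[of _ w] exI[of _ c]) simp_all

lemma order_ideal_down: "order_ideal P I \<Longrightarrow> y \<in> I \<Longrightarrow> P x y \<Longrightarrow> x \<in> I"
  unfolding order_ideal_def downset_def by blast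

lemma order_ideal_directed: "order_ideal P I \<Longrightarrow> x \<in> I \<Longrightarrow> y \<in> I \<Longrightarrow> \<exists>z \<in> I. P x z \<and> P y z"
  unfolding order_ideal_def by blast

lemma order_ideal_bound:
  assumes I: "order_ideal P I" and P: "transp P" and "finite B" "B \<subseteq> I"
  shows "\<exists>z \<in> I. \<forall>b \<in> B. P b z"
  using assms(3,4)
proof (induction B rule: finite_induct)
  case empty
  then show ?case
    using I unfolding order_ideal_def by auto
next
  case (insert b B)
  then obtain z where z: "z \<in> I" "\<forall>b \<in> B. P b z"
    by auto
  obtain y where "y \<in> I" "P z y" "P b y"
    using order_ideal_directed[OF I, of z b] z(1) insert.prems by auto
  then show ?case
    using z(2) transpD[OF P] by (intro bexI[of _ y]) auto
qed

text \<open>The downward closure of an image. The threshold \<open>w\<close> is there for maps such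
  as \<open>last\<close> and \<open>children\<close>, which are monotone only on sufficiently large
  elements.\<close>

lemma order_ideal_image:
  assumes I: "order_ideal P I" "w \<in> I" and P: "transp P" "\<And>x. P x x"
    and Q: "transp Q" "\<And>x. Q x x"
    and mono: "\<And>x y. \<lbrakk>x \<in> I; y \<in> I; P w x; P x y\<rbrakk> \<Longrightarrow> Q (g x) (g y)"
  shows "order_ideal Q {z. \<exists>x \<in> I. P w x \<and> Q z (g x)}"
  unfolding order_ideal_def
proof (intro conjI ballI)
  show "{z. \<exists>x \<in> I. P w x \<and> Q z (g x)} \<noteq> {}"
    using I(2) P(2) Q(2) by auto
  show "downset Q {z. \<exists>x \<in> I. P w x \<and> Q z (g x)}"
    unfolding downset_def using transpD[OF Q(1)] by auto
next
  fix z1 z2 assume "z1 \<in> {z. \<exists>x \<in> I. P w x \<and> Q z (g x)}" "z2 \<in> {z. \<exists>x \<in> I. P w x \<and> Q z (g x)}"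
  then obtain x1 x2 where x: "x1 \<in> I" "P w x1" "Q z1 (g x1)" "x2 \<in> I" "P w x2" "Q z2 (g x2)"
    by auto
  obtain y where y: "y \<in> I" "P x1 y" "P x2 y"
    using order_ideal_directed[OF I(1) x(1,4)] by auto
  have "Q z1 (g y)" "Q z2 (g y)"
    using mono[OF x(1) y(1) x(2) y(2)] mono[OF x(4) y(1) x(5) y(3)] x(3,6) transpD[OF Q(1)] by auto
  moreover have "P w y"
    using transpD[OF P(1) x(2) y(2)] .
  ultimately show "\<exists>z \<in> {z. \<exists>x \<in> I. P w x \<and> Q z (g x)}. Q z1 z \<and> Q z2 z"
    using y(1) Q(2) by (intro bexI[of _ "g y"]) auto
qed

lemma eventually_constant_image:
  assumes P: "transp P" and Q: "transp Q" "\<And>x. Q x x"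
    and mono: "\<And>x y. \<lbrakk>x \<in> I; y \<in> I; P w x; P x y\<rbrakk> \<Longrightarrow> Q (g x) (g y)"
    and ec: "eventually_constant Q {z. \<exists>x \<in> I. P w x \<and> Q z (g x)} \<beta>"
  shows "eventually_constant P I (\<lambda>x. \<beta> (g x))"
proof -
  obtain w' c where w': "w' \<in> {z. \<exists>x \<in> I. P w x \<and> Q z (g x)}"
    and c: "\<forall>z \<in> {z. \<exists>x \<in> I. P w x \<and> Q z (g x)}. Q w' z \<longrightarrow> \<beta> z = c"
    using ec unfolding eventually_constant_def by blast
  then obtain x0 where x0: "x0 \<in> I" "P w x0" "Q w' (g x0)"
    by auto
  have "\<beta> (g x) = c" if x: "x \<in> I" "P x0 x" for x
  proof -
    have "P w x"
      using transpD[OF P x0(2) x(2)] .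
    moreover have "Q w' (g x)"
      using transpD[OF Q(1) x0(3)] mono[OF x0(1) x(1) x0(2) x(2)] by blast
    ultimately show ?thesis
      using c x(1) Q(2)[of "g x"] by auto
  qed
  then show ?thesis
    by (rule eventually_constantI[OF x0(1)])
qed

lemma eventually_constant_combine:
  assumes I: "order_ideal P I" and P: "transp P" and w0: "w0 \<in> I"
    and "eventually_constant P I \<beta>" "eventually_constant P I \<gamma>"
    and \<delta>: "\<And>x. \<lbrakk>x \<in> I; P w0 x\<rbrakk> \<Longrightarrow> \<delta> x = F (\<beta> x) (\<gamma> x)"
  shows "eventually_constant P I \<delta>"
proof -
  obtain w1 c1 where 1: "w1 \<in> I" "\<forall>x \<in> I. P w1 x \<longrightarrow> \<beta> x = c1"
    using assms(4) unfolding eventually_constant_def by auto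
  obtain w2 c2 where 2: "w2 \<in> I" "\<forall>x \<in> I. P w2 x \<longrightarrow> \<gamma> x = c2"
    using assms(5) unfolding eventually_constant_def by auto
  obtain w where w: "w \<in> I" "P w0 w" "P w1 w" "P w2 w"
    using order_ideal_bound[OF I P, of "{w0, w1, w2}"] w0 1(1) 2(1) by auto
  have "\<delta> x = F c1 c2" if x: "x \<in> I" "P w x" for x
    using \<delta>[OF x(1) transpD[OF P w(2) x(2)]] 1(2) 2(2) x(1) transpD[OF P w(3) x(2)]
      transpD[OF P w(4) x(2)] by simp
  then show ?thesis
    by (rule eventually_constantI[OF w(1)])
qed

section \<open>Words that absorb\<close>

abbreviation wpow :: "nat \<Rightarrow> 'a list \<Rightarrow> 'a list" where
  "wpow n w \<equiv> concat (replicate n w)"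

lemma list_emb_wpow_split:
  "list_emb Q (wpow n u) y \<Longrightarrow>
     \<exists>ys r. y = concat ys @ r \<and> length ys = n \<and> (\<forall>z \<in> set ys. list_emb Q u z)"
proof (induction n arbitrary: y)
  case 0
  then show ?case by (intro exI[of _ "[]"] exI[of _ y]) simp
next
  case (Suc n)
  then obtain a b where ab: "y = a @ b" "list_emb Q u a" "list_emb Q (wpow n u) b"
    using list_emb_appendD[of Q u "wpow n u" y] by auto
  obtain ys r where "b = concat ys @ r" "length ys = n" "\<forall>z \<in> set ys. list_emb Q u z"
    using Suc.IH[OF ab(3)] by auto
  then show ?case
    using ab by (intro exI[of _ "a # ys"] exI[of _ r]) simp
qed

lemma concat_in_lists: "set zs \<subseteq> lists C \<Longrightarrow> concat zs \<in> lists C"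
  by (induction zs) auto

lemma wpow_in_lists: "u \<in> lists C \<Longrightarrow> wpow n u \<in> lists C"
  by (induction n) auto

text \<open>\<open>E\<close> will be the class of a word and \<open>k\<close> will be \<omega>.
  Powers of \<open>u\<close> absorb every word over \<open>C\<close>, powers of other words absorb
  what embeds into these words. Two prefixes of \<open>y\<close> that end behind successive copies
  of \<open>u\<close> have the same value, so the factor \<open>z\<close> between them can be
  iterated. Since \<open>u\<close> embeds into \<open>z\<close>, the power of \<open>z\<close>
  absorbs \<open>u\<close> on its right, while the power of \<open>u\<close> absorbs
  \<open>z\<close> on its left; hence both powers have the same value. The power of \<open>u\<close>
  then swallows the rest of \<open>y\<close>.\<close>

lemma eventually_absorbed:
  fixes E :: "'x list \<Rightarrow> 'b"
  assumes fin: "finite (E ` lists C)"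
    and cong: "\<And>a b x y. E a = E b \<Longrightarrow> E (x @ a @ y) = E (x @ b @ y)"
    and u: "u \<in> lists C" "u \<noteq> []"
    and absorb: "\<And>v w. \<lbrakk>v \<in> lists C; w \<in> lists C; v \<noteq> []; w \<noteq> []; list_emb Q v w \<or> w = u\<rbrakk> \<Longrightarrow>
       E (wpow k w @ v) = E (wpow k w) \<and> E (v @ wpow k w) = E (wpow k w)"
  shows "\<exists>N. \<forall>y \<in> lists C. list_emb Q (wpow N u) y \<longrightarrow> E y = E (wpow k u)"
proof (intro exI ballI impI)
  fix y assume y: "y \<in> lists C" "list_emb Q (wpow (card (E ` lists C)) u) y"
  have absorb_u: "E (wpow k u @ v) = E (wpow k u)" "E (v @ wpow k u) = E (wpow k u)"
    if "v \<in> lists C" for v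
    using absorb[OF that u(1) _ u(2)] by (cases "v = []"; simp)+
  let ?N = "card (E ` lists C)"
  obtain ys r where ys: "y = concat ys @ r" "length ys = ?N" "\<forall>z \<in> set ys. list_emb Q u z"
    using list_emb_wpow_split[OF y(2)] by auto
  have ys_C: "set ys \<subseteq> lists C" and r_C: "r \<in> lists C"
    using y(1) unfolding ys(1) by auto
  define pre where "pre i = concat (take i ys)" for i
  have pre_C: "pre i \<in> lists C" for i
    unfolding pre_def using ys_C set_take_subset[of i ys] by (intro concat_in_lists) blast
  \<comment> \<open>The \<open>?N + 1\<close> prefixes, counting the empty one, take at most
    \<open>?N\<close> values.\<close>
  have "\<not> inj_on (\<lambda>i. E (pre i)) {..?N}"
  proof (rule pigeonhole)
    have "(\<lambda>i. E (pre i)) ` {..?N} \<subseteq> E ` lists C"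
      using pre_C by auto
    then have "card ((\<lambda>i. E (pre i)) ` {..?N}) \<le> ?N"
      using fin by (rule card_mono[rotated])
    then show "card ((\<lambda>i. E (pre i)) ` {..?N}) < card {..?N}"
      by simp
  qed
  then obtain i' j' where "i' \<noteq> j'" "i' \<le> ?N" "j' \<le> ?N" "E (pre i') = E (pre j')"
    unfolding inj_on_def by auto
  then obtain i j where ij: "i < j" "j \<le> ?N" "E (pre i) = E (pre j)"
    by (metis linorder_neqE_nat)
  define z where "z = concat (take (j - i) (drop i ys))"
  have "take j ys = take i ys @ take (j - i) (drop i ys)"
    using ij(1) by (metis le_add_diff_inverse less_imp_le take_add)
  then have pre_j: "pre j = pre i @ z"
    by (simp add: pre_def z_def)
  have "drop i ys = ys ! i # drop (Suc i) ys"
    using ij ys(2) by (simp add: Cons_nth_drop_Suc)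
  then have "take (j - i) (drop i ys) = ys ! i # take (j - i - 1) (drop (Suc i) ys)"
    using ij(1) by (cases "j - i") auto
  then have z_eq: "z = ys ! i @ concat (take (j - i - 1) (drop (Suc i) ys))"
    by (simp add: z_def)
  have "list_emb Q u (ys ! i)"
    using ys(2,3) ij by simp
  then have uz: "list_emb Q u z"
    unfolding z_eq by (rule list_emb_prefix)
  then have "z \<noteq> []"
    using u(2) by auto
  have z_C: "z \<in> lists C"
    unfolding z_def using ys_C set_take_subset[of "j - i" "drop i ys"] set_drop_subset[of i ys]
    by (intro concat_in_lists) blast
  have pump: "E (pre i) = E (pre i @ wpow m z)" for m
  proof (induction m)
    case (Suc m)
    have "E (pre i @ wpow (Suc m) z) = E ([] @ pre j @ wpow m z)"
      by (simp add: pre_j)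
    also have "\<dots> = E ([] @ pre i @ wpow m z)"
      using cong[OF ij(3)[symmetric]] .
    finally show ?case
      using Suc by simp
  qed simp
  have "E (wpow k z @ wpow m u) = E (wpow k z)" for m
  proof (induction m)
    case (Suc m)
    have "E (wpow k z @ u) = E (wpow k z)"
      using absorb[OF u(1) z_C u(2) \<open>z \<noteq> []\<close>] uz by blast
    then have "E ([] @ (wpow k z @ u) @ wpow m u) = E ([] @ wpow k z @ wpow m u)"
      by (rule cong)
    then show ?case
      using Suc by simp
  qed simp
  moreover have "E (wpow m z @ wpow k u) = E (wpow k u)" for m
    using absorb_u(2) wpow_in_lists[OF z_C] by blast
  \<comment> \<open>Both sides are the value of \<open>wpow k z @ wpow k u\<close>.\<close>
  ultimately have zu: "E (wpow k z) = E (wpow k u)"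
    by metis
  define rest where "rest = concat (drop i ys) @ r"
  have "concat ys = pre i @ concat (drop i ys)"
    unfolding pre_def by (metis append_take_drop_id concat_append)
  then have y_eq: "y = pre i @ rest"
    by (simp add: ys(1) rest_def)
  then have rest_C: "rest \<in> lists C"
    using y(1) by simp
  have "E y = E ([] @ (pre i @ wpow k z) @ rest)"
    using cong[OF pump[of k], of "[]" rest] by (simp add: y_eq)
  also have "\<dots> = E (pre i @ wpow k z @ rest)"
    by simp
  also have "\<dots> = E (pre i @ wpow k u @ rest)"
    using cong[OF zu] .
  also have "\<dots> = E (pre i @ (wpow k u @ rest) @ [])"
    by simp
  also have "\<dots> = E (pre i @ wpow k u @ [])"
    using cong[OF absorb_u(1)[OF rest_C]] .
  also have "\<dots> = E (wpow k u)"
    using absorb_u(2)[OF pre_C] by simp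
  finally show "E y = E (wpow k u)" .
qed

text \<open>Concatenating one representative of each value makes every value occur on a factor.
  Since factors embed, each word over \<open>C\<close> has the class of a piece of \<open>u\<close>,
  so that the identities let \<open>u\<close> absorb it. The extra letter \<open>c\<close> keeps
  \<open>u\<close> nonempty.\<close>

lemma ex_universal_word:
  assumes "finite (\<tau> ` lists C)" "C \<noteq> {}"
  shows "\<exists>u \<in> lists C. u \<noteq> [] \<and> (\<forall>w \<in> lists C. \<exists>x w' y. u = x @ w' @ y \<and> \<tau> w' = \<tau> w)"
proof -
  obtain B where B: "B \<subseteq> lists C" "finite B" "\<tau> ` lists C = \<tau> ` B"
    using finite_subset_image[OF assms(1) subset_refl] by auto
  obtain bs where bs: "set bs = B"
    using finite_list[OF B(2)] by auto
  obtain c where c: "c \<in> C"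
    using assms(2) by auto
  have "\<exists>x w' y. c # concat bs = x @ w' @ y \<and> \<tau> w' = \<tau> w" if w: "w \<in> lists C" for w
  proof -
    have "\<tau> w \<in> \<tau> ` B"
      using B(3) w by (metis imageI)
    then obtain w' where w': "w' \<in> set bs" "\<tau> w' = \<tau> w"
      using bs by auto
    obtain ps qs where "bs = ps @ w' # qs"
      using split_list[OF w'(1)] by auto
    then have "c # concat bs = (c # concat ps) @ w' @ concat qs"
      by simp
    then show ?thesis
      using w'(2) by blast
  qed
  moreover have "c # concat bs \<in> lists C"
    using c concat_in_lists[of bs C] bs B(1) by simp
  ultimately show ?thesis
    by (intro bexI[of _ "c # concat bs"]) simp_all
qed

section \<open>Frames along the path to a hole\<close>

type_synonym 'a frame = "'a forest \<times> 'a \<times> 'a forest"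

text \<open>A frame \<open>(l, a, r)\<close> is one node on the path from the root of a tree context
  to its hole, with the forests to the left and to the right of the path. Nested tree contexts
  thereby become words, to which \<open>eventually_absorbed\<close> applies.\<close>

fun frames_ctx :: "'a frame list \<Rightarrow> 'a ctx" where
  "frames_ctx [] = empty_ctx"
| "frames_ctx ((l, a, r) # fs) = Layer [] a (pad l (frames_ctx fs) r) []"

fun plug :: "'a frame list \<Rightarrow> 'a forest \<Rightarrow> 'a forest" where
  "plug [] s = s"
| "plug ((l, a, r) # fs) s = [Node a (l @ plug fs s @ r)]"

fun frame_le :: "'a frame \<Rightarrow> 'a frame \<Rightarrow> bool" where
  "frame_le (l, a, r) (l', a', r') \<longleftrightarrow> a = a' \<and> emb l l' \<and> emb r r'"

lemma frame_le_refl [simp]: "frame_le c c"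
  by (cases c) simp

lemma fill_frames_ctx [simp]: "fill (frames_ctx fs) s = plug fs s"
  by (induction fs s rule: plug.induct) simp_all

lemma frames_ctx_append: "frames_ctx (fs @ gs) = ctx_comp (frames_ctx fs) (frames_ctx gs)"
  by (induction fs rule: frames_ctx.induct) simp_all

lemma plug_append: "plug (fs @ gs) s = plug fs (plug gs s)"
  by (induction fs s rule: plug.induct) simp_all

lemma length_plug: "length s \<le> 1 \<Longrightarrow> length (plug fs s) \<le> 1"
  by (cases "(fs, s)" rule: plug.cases) simp_all

lemma plug_single: "\<exists>t. plug fs [s] = [t]"
  by (cases "(fs, [s])" rule: plug.cases) simp_all

lemma is_tree_ctx_frames_ctx:
  assumes "fs \<noteq> []" shows "is_tree_ctx (frames_ctx fs)"
proof -
  obtain l a r gs where "fs = (l, a, r) # gs"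
    using assms by (cases fs) auto
  moreover have "[0] \<in> nodes [x]" "\<forall>y \<in> nodes [x]. prefix [0] y" for x :: "'a option tree"
    by (auto simp: nodes_eq[of "[x]"] Cons_in_nodes)
  ultimately show ?thesis
    by (auto simp: is_tree_ctx_def)
qed

lemma plug_mono:
  assumes "list_emb frame_le fs gs" "emb s s'" "length s \<le> 1"
  shows "emb (plug fs s) (plug gs s')"
  using assms(1)
proof (induction rule: list_emb.induct)
  case (list_emb_Nil gs)
  show ?case
  proof (induction gs)
    case (Cons c gs)
    obtain l a r where "c = (l, a, r)"
      by (cases c)
    moreover have "emb s (l @ plug gs s' @ r)"
      using Cons emb_middle emb_trans by auto
    ultimately show ?case
      using emb_into_Node[OF assms(3)] by simp
  qed (simp add: assms(2))
next
  case (list_emb_Cons fs gs c)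
  obtain l a r where "c = (l, a, r)"
    by (cases c)
  moreover have "emb (plug fs s) (l @ plug gs s' @ r)"
    using list_emb_Cons emb_middle emb_trans by blast
  ultimately show ?case
    using emb_into_Node[OF length_plug[OF assms(3)]] by simp
next
  case (list_emb_Cons2 c d fs gs)
  then show ?case
    by (cases c; cases d) (auto intro!: temb_node list_emb_append_mono)
qed

lemma temb_map_tree: "temb s t \<Longrightarrow> temb (map_tree h s) (map_tree h t)"
proof (induction rule: temb.induct)
  case (temb_node f g a)
  from temb_node(1) have "list_emb temb (map (map_tree h) f) (map (map_tree h) g)"
    by (induction rule: list_emb.induct) auto
  then show ?case
    by (simp add: temb.temb_node)
next
  case (temb_sub s t g a)
  then show ?case
    by (auto intro: temb.temb_sub)
qed

lemma emb_map_tree: "emb f g \<Longrightarrow> emb (map (map_tree h) f) (map (map_tree h) g)"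
  by (induction rule: list_emb.induct) (auto intro: temb_map_tree)

fun some_frame :: "'a frame \<Rightarrow> 'a option frame" where
  "some_frame (l, a, r) = (map (map_tree Some) l, Some a, map (map_tree Some) r)"

lemma ctx_forest_pad:
  "ctx_forest (pad l p r) = map (map_tree Some) l @ ctx_forest p @ map (map_tree Some) r"
  by (cases p) simp_all

text \<open>With the hole as a labelled leaf, the context is again a word of frames around a tree,
  now over the alphabet with \<open>None\<close>; so \<open>plug_mono\<close> also yields pieces of
  contexts.\<close>

lemma ctx_forest_frames_ctx: "ctx_forest (frames_ctx fs) = plug (map some_frame fs) [Node None []]"
  by (induction fs rule: frames_ctx.induct) (simp_all add: ctx_forest_pad)

lemma frames_ctx_piece:
  assumes "list_emb frame_le fs gs"
  shows "frames_ctx fs \<unlhd>\<^sub>C frames_ctx gs"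
proof -
  have "frame_le (some_frame c) (some_frame d)" if "frame_le c d" for c d :: "'a frame"
    using that by (cases c; cases d) (simp add: emb_map_tree)
  with assms have "list_emb frame_le (map some_frame fs) (map some_frame gs)"
    by (induction rule: list_emb.induct) auto
  then show ?thesis
    unfolding ctx_piece_def cca_piece_iff_emb ctx_forest_frames_ctx by (intro plug_mono) simp_all
qed

text \<open>\<open>gs\<close> is the path in \<open>t\<close> above the node to which the root of
  \<open>s\<close> is sent.\<close>

lemma temb_Node_decompose:
  "temb s t \<Longrightarrow> s = Node a f \<Longrightarrow> \<exists>gs g. [t] = plug gs [Node a g] \<and> emb f g"
proof (induction rule: temb.induct)
  case (temb_node f' g b)
  then have "emb f g"
    using list_emb_mono[of "\<lambda>x y. temb x y \<and> (x = Node a f \<longrightarrow> (\<exists>gs g. [y] = plug gs [Node a g] \<and> emb f g))"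
        temb f' g] by simp
  then show ?case
    using temb_node.prems by (intro exI[of _ "[]"] exI[of _ g]) simp
next
  case (temb_sub s t h b)
  then obtain gs g where gs: "[t] = plug gs [Node a g]" "emb f g"
    by auto
  obtain l r where "h = l @ t # r"
    using split_list[OF temb_sub(2)] by auto
  then have "[Node b h] = plug ((l, b, r) # gs) [Node a g]"
    by (simp flip: gs(1))
  then show ?case
    using gs(2) by blast
qed

text \<open>A converse of \<open>plug_mono\<close>: the nodes of the frames in \<open>fs\<close> are
  sent to nodes on one path of \<open>t\<close>, as each image has the next one in its subtree. This
  path down to \<open>s'\<close> is \<open>gs\<close>; its frames without a preimage are
  skipped.\<close>

lemma temb_plug_decompose:
  assumes "emb (plug fs [s]) [t]"
  shows "\<exists>gs s'. [t] = plug gs [s'] \<and> list_emb frame_le fs gs \<and> temb s s'"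
  using assms
proof (induction fs arbitrary: t)
  case Nil
  then show ?case
    by (intro exI[of _ "[]"] exI[of _ t]) (auto dest: list_emb_singletonD)
next
  case (Cons c fs)
  obtain l a r where c: "c = (l, a, r)"
    by (cases c)
  obtain u where u: "plug fs [s] = [u]"
    using plug_single by blast
  have "temb (Node a (l @ u # r)) t"
    using Cons.prems c u by (auto dest: list_emb_singletonD)
  from temb_Node_decompose[OF this refl]
  obtain gs g where g: "[t] = plug gs [Node a g]" "emb (l @ u # r) g"
    by auto
  obtain g1 g2 where g12: "g = g1 @ g2" "emb l g1" "emb (u # r) g2"
    using list_emb_appendD[OF g(2)] by auto
  obtain g3 v g4 where g34: "g2 = g3 @ v # g4" "temb u v" "emb r g4"
    using list_emb_ConsD[OF g12(3)] by auto
  have "emb (plug fs [s]) [v]"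
    using u g34(2) by simp
  from Cons.IH[OF this]
  obtain hs s' where hs: "[v] = plug hs [s']" "list_emb frame_le fs hs" "temb s s'"
    by auto
  have "[t] = plug (gs @ (g1 @ g3, a, g4) # hs) [s']"
    using g(1) g12(1) g34(1) by (simp add: plug_append flip: hs(1))
  moreover have "list_emb frame_le (c # fs) (gs @ (g1 @ g3, a, g4) # hs)"
    using c g12(2) g34(3) hs(2) by (intro list_emb_append2 list_emb_Cons2) (simp_all add: list_emb_prefix)
  ultimately show ?case
    using hs(3) by blast
qed

lemma almost_full_on_prod:
  assumes P: "almost_full_on P UNIV" "transp P" and Q: "almost_full_on Q UNIV"
  shows "almost_full_on (\<lambda>x y. P (fst x) (fst y) \<and> Q (snd x) (snd y)) UNIV"
  unfolding almost_full_on_def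
proof (intro allI impI)
  fix f :: "nat \<Rightarrow> 'a \<times> 'b"
  have *: "fst (f i) \<in> UNIV" for i
    by simp
  obtain g :: "nat \<Rightarrow> nat" where g: "strict_mono g" "\<forall>i j. i < j \<longrightarrow> P (fst (f (g i))) (fst (f (g j)))"
    using almost_full_on_monotone_subseq[OF P, of "\<lambda>i. fst (f i)", OF *] by blast
  obtain i j :: nat where "i < j" "Q (snd (f (g i))) (snd (f (g j)))"
    using almost_full_onD[OF Q, of "\<lambda>i. snd (f (g i))"] by auto
  moreover from this have "g i < g j"
    using g(1) by (simp add: strict_monoD)
  ultimately show "\<exists>i j. i < j \<and> P (fst (f i)) (fst (f j)) \<and> Q (snd (f i)) (snd (f j))"
    using g(2) by blast
qed

lemma almost_full_on_frame_le: "almost_full_on frame_le (UNIV :: 'a::finite frame set)"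
proof -
  have "almost_full_on ((=) :: 'a \<Rightarrow> 'a \<Rightarrow> bool) UNIV" "transp ((=) :: 'a \<Rightarrow> 'a \<Rightarrow> bool)"
    by (auto intro: almost_full_on_finite transpI)
  from almost_full_on_prod[OF almost_full_on_emb transp_emb
      almost_full_on_prod[OF this almost_full_on_emb]]
  have "almost_full_on (\<lambda>x y :: 'a frame. emb (fst x) (fst y) \<and>
      fst (snd x) = fst (snd y) \<and> emb (snd (snd x)) (snd (snd y))) UNIV" .
  moreover have "(\<lambda>x y :: 'a frame. emb (fst x) (fst y) \<and>
      fst (snd x) = fst (snd y) \<and> emb (snd (snd x)) (snd (snd y))) = frame_le"
    by (intro ext) auto
  ultimately show ?thesis
    by simp
qed

section \<open>Splitting ideals of forests\<close>

lemma downset_trees: "downset emb I \<Longrightarrow> downset temb {t. [t] \<in> I}"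
  unfolding downset_def by auto

lemma mem_lists_trees:
  assumes "downset emb I" "f \<in> I" shows "f \<in> lists {t. [t] \<in> I}"
proof (rule in_listsI, rule ballI)
  fix t assume "t \<in> set f"
  then have "emb [t] f"
    unfolding list_emb_single_iff by (intro bexI[of _ t]) simp_all
  then show "t \<in> {t. [t] \<in> I}"
    using downsetD[OF assms] by simp
qed

lemma list_emb_Cons_nth:
  "list_emb P (x # xs) ys \<longleftrightarrow> (\<exists>k < length ys. P x (ys ! k) \<and> list_emb P xs (drop (Suc k) ys))"
proof
  assume "list_emb P (x # xs) ys"
  then obtain us v vs where "ys = us @ v # vs" "P x v" "list_emb P xs vs"
    using list_emb_ConsD[of P x xs ys] by auto
  then show "\<exists>k < length ys. P x (ys ! k) \<and> list_emb P xs (drop (Suc k) ys)"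
    by (intro exI[of _ "length us"]) simp
next
  assume "\<exists>k < length ys. P x (ys ! k) \<and> list_emb P xs (drop (Suc k) ys)"
  then obtain k where k: "k < length ys" "P x (ys ! k)" "list_emb P xs (drop (Suc k) ys)"
    by auto
  have "list_emb P (x # xs) (take k ys @ ys ! k # drop (Suc k) ys)"
    using k(2,3) by (intro list_emb_append2 list_emb_Cons2)
  then show "list_emb P (x # xs) ys"
    using id_take_nth_drop[OF k(1)] by simp
qed

lemma emb_take: "emb (take k f) f"
  by (metis append_take_drop_id emb_refl list_emb_prefix)

lemma list_emb_drop_mono:
  assumes "list_emb P xs (drop m ys)" "k \<le> m"
  shows "list_emb P xs (drop k ys)"
proof -
  have "drop k ys = take (m - k) (drop k ys) @ drop m ys"
    using append_take_drop_id[of "m - k" "drop k ys"] assms(2) by simp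
  then show ?thesis
    using list_emb_append2[OF assms(1)] by metis
qed

text \<open>Both identities, transferred to representatives: nonempty words of frames give tree
  contexts, and \<open>length t \<le> 1\<close> covers the tree types and 0.\<close>

locale absorbing =
  fixes L :: "'a::finite forest set" and \<omega> :: nat
  assumes regular: "regular L"
    and V_absorb: "\<And>us vs t. \<lbrakk>length t \<le> 1; us \<noteq> []; vs \<noteq> [];
        V_piece L (syn_ctx L (frames_ctx vs)) (syn_ctx L (frames_ctx us))\<rbrakk> \<Longrightarrow>
        syn L (plug (wpow \<omega> us @ vs) t) = syn L (plug (wpow \<omega> us) t) \<and>
        syn L (plug (vs @ wpow \<omega> us) t) = syn L (plug (wpow \<omega> us) t)"
    and H_absorb: "\<And>s t. H_piece L (syn L s) (syn L t) \<Longrightarrow>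
        syn L (wpow \<omega> t @ s) = syn L (wpow \<omega> t) \<and> syn L (s @ wpow \<omega> t) = syn L (wpow \<omega> t)"
begin

lemma finite_range_syn: "finite (range (syn L))"
  using regular by (simp add: regular_def carrier_syn_H)

lemma finite_range_syn_ctx: "finite (range (syn_ctx L))"
  using regular by (simp add: regular_def carrier_syn_V)

lemma syn_append_cong: "syn L a = syn L b \<Longrightarrow> syn L (x @ a @ y) = syn L (x @ b @ y)"
  by (simp flip: mult_syn_H)

lemma syn_plug_cong: "syn L s = syn L t \<Longrightarrow> syn L (plug fs s) = syn L (plug fs t)"
  using syn_act_syn[of L "frames_ctx fs" s] syn_act_syn[of L "frames_ctx fs" t] by simp

text \<open>Such an ideal consists of all words over its trees, so the powers of a universal word
  \<open>u\<close> belong to it. Each word over \<open>C\<close> shares its class with a factor of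
  \<open>u\<close>, hence its class is a piece of the class of \<open>u\<close>, and
  \<open>H_absorb\<close> applies.\<close>

lemma concat_closed_eventually_constant:
  assumes I: "order_ideal emb I" and closed: "\<And>x y. x \<in> I \<Longrightarrow> y \<in> I \<Longrightarrow> x @ y \<in> I"
    and "{t. [t] \<in> I} \<noteq> {}"
  shows "eventually_constant emb I (syn L)"
proof -
  define C where "C = {t. [t] \<in> I}"
  have down: "downset emb I"
    using I unfolding order_ideal_def by blast
  have Nil: "[] \<in> I"
    using I order_ideal_down[OF I _ list_emb_Nil] unfolding order_ideal_def by blast
  have "f \<in> I" if "f \<in> lists C" for f
    using that
  proof induction
    case (Cons t f)
    then show ?case
      using closed[of "[t]" f] by (simp add: C_def)
  qed (rule Nil)
  then have C: "lists C = I"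
    using mem_lists_trees[OF down] unfolding C_def by blast
  have fin: "finite (syn L ` lists C)"
    using finite_range_syn by (rule finite_subset[rotated]) auto
  have "C \<noteq> {}"
    using assms(3) by (simp add: C_def)
  from ex_universal_word[OF fin this] obtain u where u: "u \<in> lists C" "u \<noteq> []"
    and univ: "\<forall>w \<in> lists C. \<exists>x w' y. u = x @ w' @ y \<and> syn L w' = syn L w"
    by auto
  have absorb: "syn L (wpow \<omega> w @ v) = syn L (wpow \<omega> w) \<and> syn L (v @ wpow \<omega> w) = syn L (wpow \<omega> w)"
    if v: "v \<in> lists C" and vw: "emb v w \<or> w = u" for v w
  proof (rule H_absorb)
    from vw show "H_piece L (syn L v) (syn L w)"
    proof
      assume "emb v w"
      then show ?thesis
        unfolding H_piece_def cca_piece_iff_emb by blast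
    next
      assume "w = u"
      obtain x v' y where "u = x @ v' @ y" "syn L v' = syn L v"
        using univ v by blast
      then show ?thesis
        using \<open>w = u\<close> emb_middle unfolding H_piece_def cca_piece_iff_emb by blast
    qed
  qed
  have "\<exists>N. \<forall>y \<in> lists C. list_emb temb (wpow N u) y \<longrightarrow> syn L y = syn L (wpow \<omega> u)"
    by (rule eventually_absorbed[OF fin syn_append_cong u]) (use absorb in auto)
  then obtain N where N: "\<forall>y \<in> I. emb (wpow N u) y \<longrightarrow> syn L y = syn L (wpow \<omega> u)"
    unfolding C by auto
  have "wpow N u \<in> I"
    using wpow_in_lists[OF u(1)] C by blast
  then show ?thesis
    by (rule eventually_constantI) (use N in blast)
qed

text \<open>For directedness, embed \<open>b # y1\<close> and \<open>b # y2\<close> into one forest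
  of \<open>I\<close> and cut it behind the earlier of the two images of \<open>b\<close>: what
  follows contains both \<open>y1\<close> and \<open>y2\<close>, and with \<open>b\<close> in front
  it is still in \<open>I\<close>.\<close>

lemma residual_order_ideal:
  assumes I: "order_ideal emb I" and b: "[b] \<in> I"
  shows "order_ideal emb {y. b # y \<in> I}"
  unfolding order_ideal_def
proof (intro conjI ballI)
  show "{y. b # y \<in> I} \<noteq> {}"
    using b by auto
  show "downset emb {y. b # y \<in> I}"
    unfolding downset_def using order_ideal_down[OF I] by (metis list_emb_Cons2 mem_Collect_eq temb_refl)
next
  fix y1 y2 assume "y1 \<in> {y. b # y \<in> I}" "y2 \<in> {y. b # y \<in> I}"
  then obtain f where f: "f \<in> I" "emb (b # y1) f" "emb (b # y2) f"
    using order_ideal_directed[OF I, of "b # y1" "b # y2"] by auto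
  obtain k1 where k1: "k1 < length f" "temb b (f ! k1)" "emb y1 (drop (Suc k1) f)"
    using f(2) unfolding list_emb_Cons_nth by auto
  obtain k2 where k2: "k2 < length f" "temb b (f ! k2)" "emb y2 (drop (Suc k2) f)"
    using f(3) unfolding list_emb_Cons_nth by auto
  define k where "k = min k1 k2"
  have "k < length f" "temb b (f ! k)"
    using k1 k2 unfolding k_def min_def by simp_all
  then have "emb (b # drop (Suc k) f) f"
    unfolding list_emb_Cons_nth by (intro exI[of _ k]) simp
  then have "b # drop (Suc k) f \<in> I"
    using order_ideal_down[OF I f(1)] by blast
  moreover have "emb y1 (drop (Suc k) f)" "emb y2 (drop (Suc k) f)"
    using list_emb_drop_mono[OF k1(3)] list_emb_drop_mono[OF k2(3)] unfolding k_def by simp_all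
  ultimately show "\<exists>z \<in> {y. b # y \<in> I}. emb y1 z \<and> emb y2 z"
    by (intro bexI[of _ "drop (Suc k) f"]) simp_all
qed

text \<open>
  Cutting a forest at its longest suffix in \<open>F\<close> gives a prefix that is monotone in the forest.
\<close>

lemma residual_split_eventually_constant:
  assumes I: "order_ideal emb I" and b: "[b] \<in> I"
    and F_neq: "{y. b # y \<in> I} \<noteq> I" "{y. b # y \<in> I} \<noteq> {[]}"
    and IH: "\<And>J. order_ideal emb J \<Longrightarrow> J \<subset> I \<Longrightarrow> eventually_constant emb J (syn L)"
  shows "eventually_constant emb I (syn L)"
proof -
  define F where "F = {y. b # y \<in> I}"
  have F: "order_ideal emb F"
    unfolding F_def using residual_order_ideal[OF I b] .
  have F_iff: "y \<in> F \<longleftrightarrow> b # y \<in> I" for y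
    by (simp add: F_def)
  have NilF: "[] \<in> F"
    using b by (simp add: F_def)
  have "emb y (b # y)" for y
    by (simp add: list_emb_Cons)
  then have "F \<subseteq> I"
    using order_ideal_down[OF I] F_iff by blast
  then have F_I: "F \<subset> I"
    using F_neq(1) by (auto simp: F_def)
  have suffix: "drop (Suc j) f \<in> F" if "f \<in> I" "j < length f" "temb b (f ! j)" for f j
  proof -
    have "emb (b # drop (Suc j) f) f"
      unfolding list_emb_Cons_nth using that by (intro exI[of _ j]) simp
    then show ?thesis
      using order_ideal_down[OF I that(1)] by (simp add: F_iff)
  qed
  define k where "k f = (LEAST j. drop j f \<in> F)" for f
  have k: "drop (k f) f \<in> F" for f
    unfolding k_def by (rule LeastI[of _ "length f"]) (simp add: NilF)
  have k_le: "k f \<le> j" if "drop j f \<in> F" for f j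
    unfolding k_def using that by (rule Least_le)
  have mono: "emb (take (k f) f) (take (k f') f')" if "emb f f'" for f f'
  proof -
    have "emb f (take (k f') f' @ drop (k f') f')"
      using that by simp
    then obtain f1 f2 where f12: "f = f1 @ f2" "emb f1 (take (k f') f')" "emb f2 (drop (k f') f')"
      using list_emb_append_rightD[of temb f] by blast
    \<comment> \<open>The part of \<open>f\<close> that embeds behind the cut of \<open>f'\<close>
      is in \<open>F\<close>, so \<open>f\<close> is cut no later than where this part
      begins.\<close>
    have "f2 \<in> F"
      using order_ideal_down[OF F k f12(3)] .
    then have "k f \<le> length f1"
      using k_le[of "length f1" f] f12(1) by simp
    then have "take (k f) f = take (k f) f1"
      using f12(1) by simp
    then show ?thesis
      using emb_trans[OF emb_take f12(2)] by simp
  qed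
  define Z where "Z = {z. \<exists>f \<in> I. emb [] f \<and> emb z (take (k f) f)}"
  have NilI: "[] \<in> I"
    using order_ideal_down[OF I b] by simp
  have Z: "order_ideal emb Z"
    unfolding Z_def by (rule order_ideal_image[OF I NilI transp_emb _ transp_emb]) (use mono in auto)
  have "Z \<subseteq> I"
    unfolding Z_def using order_ideal_down[OF I] emb_trans[OF _ emb_take] by blast
  \<comment> \<open>A forest of \<open>I\<close> is cut at the latest right behind an image of
    \<open>b\<close>, so no forest in \<open>Z\<close> has \<open>b\<close> followed by another
    tree; \<open>I\<close> does contain such a forest because \<open>F\<close> contains a
    tree.\<close>
  moreover have "Z \<noteq> I"
  proof
    assume "Z = I"
    obtain y where "y \<in> F" "y \<noteq> []"
      using F_neq(2) NilF unfolding F_def by blast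
    then obtain t where "[t] \<in> F"
      using order_ideal_down[OF F, of y "[hd y]"] by (cases y) auto
    then have "[b, t] \<in> Z"
      using \<open>Z = I\<close> by (simp add: F_iff)
    then obtain f where f: "f \<in> I" "emb [b, t] (take (k f) f)"
      unfolding Z_def by auto
    then obtain j where j: "j < length (take (k f) f)" "temb b (take (k f) f ! j)"
      "emb [t] (drop (Suc j) (take (k f) f))"
      unfolding list_emb_Cons_nth[of temb b] by auto
    have "k f \<le> Suc j"
      using k_le[OF suffix[OF f(1), of j]] j(1,2) by simp
    then have "drop (Suc j) (take (k f) f) = []"
      by simp
    then show False
      using j(3) by simp
  qed
  ultimately have "eventually_constant emb Z (syn L)"
    using IH[OF Z] by blast
  then have z: "eventually_constant emb I (\<lambda>f. syn L (take (k f) f))"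
    unfolding Z_def
    by (intro eventually_constant_image[of emb emb I "[]" "\<lambda>f. take (k f) f", OF transp_emb transp_emb])
      (use mono in auto)
  obtain w c where w: "w \<in> F" "\<forall>y \<in> F. emb w y \<longrightarrow> syn L y = c"
    using IH[OF F F_I] unfolding eventually_constant_def by auto
  have y: "eventually_constant emb I (\<lambda>f. syn L (drop (k f) f))"
  proof (rule eventually_constantI)
    show "b # w \<in> I"
      using w(1) by (simp add: F_iff)
    fix f assume f: "f \<in> I" "emb (b # w) f"
    then obtain j where j: "j < length f" "temb b (f ! j)" "emb w (drop (Suc j) f)"
      unfolding list_emb_Cons_nth by auto
    have "k f \<le> Suc j"
      using k_le[OF suffix[OF f(1) j(1,2)]] .
    then have "emb w (drop (k f) f)"
      using list_emb_drop_mono[OF j(3)] by blast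
    then show "syn L (drop (k f) f) = c"
      using w(2) k by blast
  qed
  show ?thesis
  proof (rule eventually_constant_combine[OF I transp_emb NilI z y])
    fix f
    show "syn L f = (\<lambda>g h. g \<otimes>\<^bsub>syn_H L\<^esub> h) (syn L (take (k f) f)) (syn L (drop (k f) f))"
      by simp
  qed
qed

text \<open>Nothing can follow \<open>t0\<close>, so a forest of \<open>I\<close> containing
  \<open>t0\<close> contains it only in its last tree, and embeddings between such forests send last
  tree to last tree. Splitting off the last tree is therefore monotone. The prefixes omit
  \<open>[t0]\<close>, and the last trees omit \<open>[c, t0]\<close>, so both factors generate
  smaller ideals.\<close>

lemma last_split_eventually_constant:
  assumes I: "order_ideal emb I" and c: "[c] \<in> I" "{y. c # y \<in> I} = I"
    and t0: "[t0] \<in> I" "{y. t0 # y \<in> I} = {[]}"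
    and IH: "\<And>J. order_ideal emb J \<Longrightarrow> J \<subset> I \<Longrightarrow> eventually_constant emb J (syn L)"
  shows "eventually_constant emb I (syn L)"
proof -
  have t0_last: "Suc j = length f" if "f \<in> I" "j < length f" "temb t0 (f ! j)" for f j
  proof -
    have "emb (t0 # drop (Suc j) f) f"
      unfolding list_emb_Cons_nth using that by (intro exI[of _ j]) simp
    then have "drop (Suc j) f \<in> {y. t0 # y \<in> I}"
      using order_ideal_down[OF I that(1)] by simp
    then show ?thesis
      using that(2) unfolding t0(2) by simp
  qed
  have mono: "emb (butlast f) (butlast f') \<and> emb [last f] [last f']"
    if ff: "f \<in> I" "f' \<in> I" "emb [t0] f" "emb f f'" for f f'
  proof -
    obtain j where j: "j < length f" "temb t0 (f ! j)"
      using ff(3) by (auto simp: list_emb_single_iff in_set_conv_nth)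
    have "f \<noteq> []"
      using j(1) by auto
    moreover have "j = length f - 1"
      using t0_last[OF ff(1) j] by simp
    ultimately have t0f: "temb t0 (last f)"
      using j(2) by (simp add: last_conv_nth)
    have "emb (butlast f @ [last f]) f'"
      using ff(4) \<open>f \<noteq> []\<close> by simp
    from list_emb_appendD[OF this] obtain us vs where uv: "f' = us @ vs" "emb (butlast f) us" "emb [last f] vs"
      by auto
    obtain as v bs where v: "vs = as @ v # bs" "temb (last f) v"
      using list_emb_ConsD[OF uv(3)] by auto
    have "Suc (length (us @ as)) = length f'"
      using t0_last[OF ff(2), of "length (us @ as)"] uv(1) v temb_trans[OF t0f] by simp
    then have f': "f' = (us @ as) @ [v]"
      using uv(1) v(1) by simp
    then show ?thesis
      using uv(2) v(2) by (simp add: butlast_append list_emb_prefix)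
  qed
  define Z where "Z = {z. \<exists>f \<in> I. emb [t0] f \<and> emb z (butlast f)}"
  define Y where "Y = {z. \<exists>f \<in> I. emb [t0] f \<and> emb z [last f]}"
  have ZY: "order_ideal emb Z" "order_ideal emb Y"
    unfolding Z_def Y_def
    by (rule order_ideal_image[OF I t0(1) transp_emb _ transp_emb]; use mono in auto)+
  have "emb (butlast f) f" for f :: "'a forest"
    by (simp add: butlast_conv_take emb_take)
  then have "Z \<subseteq> I"
    unfolding Z_def using order_ideal_down[OF I] emb_trans by blast
  moreover have "[t0] \<notin> Z"
  proof
    assume "[t0] \<in> Z"
    then obtain f where f: "f \<in> I" "emb [t0] (butlast f)"
      unfolding Z_def by auto
    then obtain j where j: "j < length (butlast f)" "temb t0 (butlast f ! j)"
      by (auto simp: list_emb_single_iff in_set_conv_nth)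
    then have "Suc j < length f" "temb t0 (f ! j)"
      by (simp_all add: nth_butlast)
    then show False
      using t0_last[OF f(1), of j] by simp
  qed
  ultimately have Z: "eventually_constant emb Z (syn L)"
    using IH[OF ZY(1)] t0(1) by blast
  have "Y \<subseteq> I"
  proof
    fix z assume "z \<in> Y"
    then obtain f where f: "f \<in> I" "emb [t0] f" "emb z [last f]"
      unfolding Y_def by auto
    then have "emb [last f] f"
      by (cases f rule: rev_cases) (auto simp: list_emb_single_iff)
    then show "z \<in> I"
      using order_ideal_down[OF I f(1)] emb_trans[OF f(3)] by blast
  qed
  moreover have "[c, t0] \<in> I"
    using c(2) t0(1) by blast
  moreover have "[c, t0] \<notin> Y"
    unfolding Y_def by (auto dest: list_emb_length)
  ultimately have Y: "eventually_constant emb Y (syn L)"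
    using IH[OF ZY(2)] by blast
  have z: "eventually_constant emb I (\<lambda>f. syn L (butlast f))"
    by (rule eventually_constant_image[OF transp_emb transp_emb _ _ Z[unfolded Z_def]]) (use mono in auto)
  have y: "eventually_constant emb I (\<lambda>f. syn L [last f])"
    by (rule eventually_constant_image[OF transp_emb transp_emb _ _ Y[unfolded Y_def]]) (use mono in auto)
  show ?thesis
  proof (rule eventually_constant_combine[OF I transp_emb t0(1) z y])
    fix f assume "emb [t0] f"
    then have "f \<noteq> []"
      by auto
    then show "syn L f = (\<lambda>g h. g \<otimes>\<^bsub>syn_H L\<^esub> h) (syn L (butlast f)) (syn L [last f])"
      by simp
  qed
qed

section \<open>Ideals of trees\<close>

text \<open>A large tree of \<open>T\<close> can only embed root to root, since its root can have no parent in \<open>T\<close>.\<close>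

lemma root_fixed_eventually_constant:
  assumes T: "order_ideal temb T" and no: "\<And>a. \<exists>t \<in> T. Node a [t] \<notin> T"
    and IH: "\<And>J. \<lbrakk>order_ideal emb J; {t. [t] \<in> J} \<subset> T\<rbrakk> \<Longrightarrow> eventually_constant emb J (syn L)"
  shows "eventually_constant temb T (\<lambda>t. syn L [t])"
proof -
  have "\<forall>a. \<exists>t. t \<in> T \<and> Node a [t] \<notin> T"
    using no by blast
  from choice[OF this] obtain \<tau> where \<tau>: "\<forall>a. \<tau> a \<in> T \<and> Node a [\<tau> a] \<notin> T" ..
  \<comment> \<open>Finiteness of the alphabet gives one tree above all witnesses; no tree of
    \<open>T\<close> has it embedded strictly below its root.\<close>
  obtain w where w: "w \<in> T" "\<forall>t \<in> range \<tau>. temb t w"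
    using order_ideal_bound[OF T transp_temb, of "range \<tau>"] \<tau> by auto
  have no_child: False if "Node a f \<in> T" "t \<in> set f" "temb w t" for a f t
  proof -
    have "temb (\<tau> a) t"
      using w(2) temb_trans[OF _ that(3)] by simp
    then have "emb [\<tau> a] f"
      using that(2) by (auto simp: list_emb_single_iff)
    then have "temb (Node a [\<tau> a]) (Node a f)"
      by (rule temb_node)
    then show False
      using order_ideal_down[OF T that(1)] \<tau> by blast
  qed
  have root_emb: "root s = root t \<and> emb (children s) (children t)"
    if st: "t \<in> T" "temb w s" "temb s t" for s t
    using st(3)
  proof cases
    case (temb_sub u g a)
    then show ?thesis
      using no_child[of a g u] st temb_trans[OF st(2)] by blast
  qed simp
  define J where "J = {z. \<exists>t \<in> T. temb w t \<and> emb z (children t)}"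
  have J: "order_ideal emb J"
    unfolding J_def
    by (rule order_ideal_image[OF T w(1) transp_temb _ transp_emb]) (use root_emb in auto)
  have child: "\<exists>a f u. Node a f \<in> T \<and> u \<in> set f \<and> temb t u" if t: "[t] \<in> J" for t
  proof -
    obtain s where "s \<in> T" "emb [t] (children s)"
      using t unfolding J_def by auto
    then show ?thesis
      by (cases s) (auto simp: list_emb_single_iff)
  qed
  have "t \<in> T" if t: "[t] \<in> J" for t
  proof -
    obtain a f u where "Node a f \<in> T" "u \<in> set f" "temb t u"
      using child[OF t] by auto
    then show ?thesis
      using order_ideal_down[OF T, of "Node a f" t] by (simp add: temb_sub)
  qed
  moreover have "[w] \<notin> J"
    using child[of w] no_child by blast
  ultimately have "{t. [t] \<in> J} \<subset> T"
    using w(1) by auto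
  then have "eventually_constant emb J (syn L)"
    using IH[OF J] by blast
  then have ec: "eventually_constant temb T (\<lambda>t. syn L (children t))"
    unfolding J_def
    by (rule eventually_constant_image[OF transp_temb transp_emb, rotated 2]) (use root_emb in auto)
  show ?thesis
  proof (rule eventually_constant_combine[OF T transp_temb w(1) ec ec])
    fix t assume t: "t \<in> T" "temb w t"
    have "[t] = fill (Layer [] (root w) empty_ctx []) (children t)"
      using root_emb[OF t(1) _ t(2)] by (cases t) auto
    then show "syn L [t] = (\<lambda>g _. syn_act L (syn_ctx L (Layer [] (root w) empty_ctx [])) g)
        (syn L (children t)) (syn L (children t))"
      using syn_fill by metis
  qed
qed

text \<open>The frames outside \<open>C\<close> have a finite basis, and each basis frame fails on
  some tree of \<open>T\<close>. A tree \<open>w\<close> above these finitely many trees detects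
  every frame outside \<open>C\<close>: put around anything above \<open>w\<close>, such a frame
  leaves \<open>T\<close>.\<close>

lemma ex_full_frames:
  fixes T :: "'a tree set"
  assumes T: "order_ideal temb T"
  defines "C \<equiv> {c. \<forall>t \<in> T. \<forall>u. [u] = plug [c] [t] \<longrightarrow> u \<in> T}"
  shows "\<exists>w \<in> T. \<forall>c s u. temb w s \<longrightarrow> [u] = plug [c] [s] \<longrightarrow> u \<in> T \<longrightarrow> c \<in> C"
proof -
  obtain B where B: "finite B" "B \<subseteq> - C" "\<forall>c \<in> - C. \<exists>b \<in> B. frame_le b c"
    using almost_full_on_finite_basis[OF almost_full_on_frame_le, of "- C"] by auto
  have "\<forall>b. \<exists>t. b \<in> B \<longrightarrow> t \<in> T \<and> (\<exists>u. [u] = plug [b] [t] \<and> u \<notin> T)"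
    using B(2) unfolding C_def by blast
  from choice[OF this] obtain \<tau> where
    \<tau>: "\<forall>b. b \<in> B \<longrightarrow> \<tau> b \<in> T \<and> (\<exists>u. [u] = plug [b] [\<tau> b] \<and> u \<notin> T)" ..
  have "finite (\<tau> ` B)" "\<tau> ` B \<subseteq> T"
    using \<tau> B(1) by blast+
  then obtain w where w: "w \<in> T" "\<forall>t \<in> \<tau> ` B. temb t w"
    using order_ideal_bound[OF T transp_temb] by blast
  have "c \<in> C" if c: "temb w s" "[u] = plug [c] [s]" "u \<in> T" for c s u
  proof (rule ccontr)
    assume "c \<notin> C"
    then obtain b where b: "b \<in> B" "frame_le b c"
      using B(3) by blast
    then obtain v where v: "[v] = plug [b] [\<tau> b]" "v \<notin> T"
      using \<tau> by blast
    have "temb (\<tau> b) s"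
      using w(2) b(1) temb_trans[OF _ c(1)] by simp
    then have "emb (plug [b] [\<tau> b]) (plug [c] [s])"
      using b(2) by (intro plug_mono) simp_all
    then have "temb v u"
      unfolding v(1)[symmetric] c(2)[symmetric] by (auto dest: list_emb_singletonD)
    then show False
      using order_ideal_down[OF T c(3)] v(2) by blast
  qed
  then show ?thesis
    using w(1) by blast
qed

text \<open>The analogue of \<open>concat_closed_eventually_constant\<close> with nesting in place
  of concatenation.\<close>

lemma frames_eventually_absorbed:
  assumes "C \<noteq> {}"
  shows "\<exists>u \<in> lists C. \<exists>N. (\<forall>ys \<in> lists C. \<forall>s. list_emb frame_le (wpow N u) ys \<longrightarrow> length s \<le> 1 \<longrightarrow>
        syn L (plug ys s) = syn L (plug (wpow \<omega> u) s)) \<and>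
     (\<forall>ys \<in> lists C. \<forall>s. length s \<le> 1 \<longrightarrow> syn L (plug (wpow \<omega> u @ ys) s) = syn L (plug (wpow \<omega> u) s))"
proof -
  have "finite ((\<lambda>fs. syn_ctx L (frames_ctx fs)) ` lists C)"
    using finite_range_syn_ctx by (rule finite_subset[rotated]) auto
  from ex_universal_word[OF this assms] obtain u where u: "u \<in> lists C" "u \<noteq> []"
    and univ: "\<forall>w \<in> lists C. \<exists>x w' y. u = x @ w' @ y \<and>
      syn_ctx L (frames_ctx w') = syn_ctx L (frames_ctx w)"
    by auto
  \<comment> \<open>\<open>V_absorb\<close> speaks only about at most one tree, so the class of a
    word of frames is recorded as a function on such forests, with a fixed default elsewhere. It is
    determined by \<open>syn_ctx\<close>, hence takes finitely many values, and it is a congruence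
    because plugging keeps the bound.\<close>
  define E where "E fs = (\<lambda>s. if length s \<le> 1 then syn L (plug fs s) else undefined)" for fs
  define G where "G v = (\<lambda>s. if length s \<le> 1 then syn_act L v (syn L s) else undefined)" for v
  have "E fs = G (syn_ctx L (frames_ctx fs))" for fs
    by (simp add: E_def G_def fun_eq_iff)
  then have "E ` lists C \<subseteq> G ` range (syn_ctx L)"
    by auto
  then have fin: "finite (E ` lists C)"
    using finite_range_syn_ctx by (meson finite_imageI finite_subset)
  have cong: "E (x @ a @ y) = E (x @ b @ y)" if "E a = E b" for a b x y
  proof (rule ext)
    fix s :: "'a forest"
    have "syn L (plug a (plug y s)) = syn L (plug b (plug y s))" if "length s \<le> 1"
      using fun_cong[OF \<open>E a = E b\<close>, of "plug y s"] length_plug[OF that, of y] by (simp add: E_def)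
    then show "E (x @ a @ y) s = E (x @ b @ y) s"
      using syn_plug_cong[of "plug a (plug y s)" "plug b (plug y s)" x]
      by (simp add: E_def plug_append)
  qed
  have absorb: "E (wpow \<omega> w @ v) = E (wpow \<omega> w) \<and> E (v @ wpow \<omega> w) = E (wpow \<omega> w)"
    if v: "v \<in> lists C" "v \<noteq> []" "w \<noteq> []" and vw: "list_emb frame_le v w \<or> w = u" for v w
  proof -
    from vw have "V_piece L (syn_ctx L (frames_ctx v)) (syn_ctx L (frames_ctx w))"
    proof
      assume "list_emb frame_le v w"
      then show ?thesis
        using frames_ctx_piece unfolding V_piece_def by blast
    next
      assume "w = u"
      obtain x v' y where xy: "u = x @ v' @ y" "syn_ctx L (frames_ctx v') = syn_ctx L (frames_ctx v)"
        using univ v(1) by blast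
      have "list_emb frame_le v' w"
        unfolding \<open>w = u\<close> xy(1) by (intro list_emb_append2 list_emb_prefix list_emb_refl) simp
      then show ?thesis
        using frames_ctx_piece xy(2) unfolding V_piece_def by blast
    qed
    then show ?thesis
      using V_absorb[OF _ v(3,2)] by (simp add: E_def fun_eq_iff)
  qed
  have "\<exists>N. \<forall>y \<in> lists C. list_emb frame_le (wpow N u) y \<longrightarrow> E y = E (wpow \<omega> u)"
    by (rule eventually_absorbed[OF fin cong u]) (use absorb in auto)
  then obtain N where N: "\<forall>y \<in> lists C. list_emb frame_le (wpow N u) y \<longrightarrow> E y = E (wpow \<omega> u)" ..
  have E_eq: "syn L (plug y s) = syn L (plug z s)" if "E y = E z" "length s \<le> 1" for y z s
  proof -
    have "E y s = E z s"
      by (simp only: that(1))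
    then show ?thesis
      using that(2) by (simp add: E_def)
  qed
  have abs_u: "E (wpow \<omega> u @ ys) = E (wpow \<omega> u)" if "ys \<in> lists C" for ys
    using absorb[OF that _ u(2)] by (cases "ys = []") simp_all
  show ?thesis
    using u(1) N abs_u E_eq by (intro bexI[of _ u] exI[of _ N]) blast+
qed

text \<open>
  Frames in \<open>C\<close> can be put on top of every tree of \<open>T\<close>. Every tree of \<open>T\<close> is a composition of
  frames in \<open>C\<close> around a core that is empty or irreducible, and irreducible cores that do not
  occur beside the hole of a frame in \<open>C\<close> can only embed into the core.
\<close>

lemma iterated_eventually_constant:
  assumes T: "order_ideal temb T" and a0: "\<And>t. t \<in> T \<Longrightarrow> Node a0 [t] \<in> T"
    and IH: "\<And>R. \<lbrakk>order_ideal temb R; R \<subset> T\<rbrakk> \<Longrightarrow> eventually_constant temb R (\<lambda>t. syn L [t])"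
  shows "eventually_constant temb T (\<lambda>t. syn L [t])"
proof -
  define C where "C = {c. \<forall>t \<in> T. \<forall>u. [u] = plug [c] [t] \<longrightarrow> u \<in> T}"
  have C_down: "c \<in> C" if "d \<in> C" "frame_le c d" for c d
    unfolding C_def
  proof (intro CollectI ballI allI impI)
    fix t u assume t: "t \<in> T" "[u] = plug [c] [t]"
    obtain v where v: "plug [d] [t] = [v]"
      using plug_single by blast
    then have "v \<in> T"
      using that(1) t(1) unfolding C_def by auto
    have "emb [u] [v]"
      unfolding t(2) v[symmetric] using that(2) by (intro plug_mono) simp_all
    then show "u \<in> T"
      using order_ideal_down[OF T \<open>v \<in> T\<close>] by (auto dest: list_emb_singletonD)
  qed
  have a0_C: "([], a0, []) \<in> C"
    using a0 by (auto simp: C_def)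
  have plug_T: "u \<in> T" if "t \<in> T" "cs \<in> lists C" "[u] = plug cs [t]" for cs t u
    using that(2,3)
  proof (induction cs arbitrary: u rule: list.induct)
    case (Cons c cs)
    obtain v where v: "plug cs [t] = [v]"
      using plug_single by blast
    then have "v \<in> T"
      using Cons.IH[of v] Cons.prems(1) by simp
    moreover have "[u] = plug [c] [v]"
      using Cons.prems(2) plug_append[of "[c]" cs "[t]"] v by simp
    ultimately show ?case
      using Cons.prems(1) unfolding C_def by auto
  qed (use that(1) in simp)
  obtain w where w: "w \<in> T" "\<And>c s u. \<lbrakk>temb w s; [u] = plug [c] [s]; u \<in> T\<rbrakk> \<Longrightarrow> c \<in> C"
    using ex_full_frames[OF T] unfolding C_def by meson
  have temb_plug: "temb s u" if "[u] = plug cs [s]" for cs s u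
  proof -
    have "emb (plug [] [s]) (plug cs [s])"
      by (intro plug_mono) simp_all
    then show ?thesis
      unfolding that[symmetric] by (auto dest: list_emb_singletonD)
  qed
  have frames_C: "cs \<in> lists C" if "temb w s" "[u] = plug cs [s]" "u \<in> T" for cs s u
    using that(2,3)
  proof (induction cs arbitrary: u rule: list.induct)
    case (Cons c cs)
    obtain v where v: "[v] = plug cs [s]"
      using plug_single[of cs s] by metis
    have u: "[u] = plug [c] [v]"
      using Cons.prems(1) plug_append[of "[c]" cs "[s]"] v by simp
    have "temb w v"
      using temb_trans[OF that(1) temb_plug[OF v]] .
    then have "c \<in> C"
      using w(2)[OF _ u Cons.prems(2)] by blast
    moreover have "v \<in> T"
      using order_ideal_down[OF T Cons.prems(2) temb_plug[OF u]] .
    ultimately show ?case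
      using Cons.IH[OF v] by simp
  qed simp
  define irred where "irred s \<longleftrightarrow> (\<forall>c \<in> C. \<forall>x. length x \<le> 1 \<longrightarrow> [s] \<noteq> plug [c] x)" for s
  \<comment> \<open>Frames below a frame of \<open>C\<close> are in \<open>C\<close>, so these two
    shapes capture every tree beside the hole of a frame in \<open>C\<close>.\<close>
  define side where "side s \<longleftrightarrow> (\<exists>b. ([s], b, []) \<in> C \<or> ([], b, [s]) \<in> C)" for s
  have decompose: "\<exists>cs \<in> lists C. \<exists>x. [t] = plug cs x \<and> (x = [] \<or> (\<exists>s. x = [s] \<and> irred s))" for t
  proof (induction t rule: measure_induct_rule[of size])
    case (less t)
    show ?case
    proof (cases "irred t")
      case True
      then show ?thesis
        by (intro bexI[of _ "[]"] exI[of _ "[t]"]) simp_all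
    next
      case False
      then obtain c x where c: "c \<in> C" "length x \<le> 1" "[t] = plug [c] x"
        unfolding irred_def by auto
      from emb_Nil_or_single[OF c(2)] show ?thesis
      proof (elim disjE exE)
        assume "x = []"
        then show ?thesis
          using c by (intro bexI[of _ "[c]"] exI[of _ "[]"]) auto
      next
        fix v assume v: "x = [v]"
        obtain l b r where "c = (l, b, r)"
          by (cases c)
        then have "size v < size t"
          using c(3) v by simp
        from less[OF this] obtain cs y where cs: "cs \<in> lists C" "[v] = plug cs y"
          "y = [] \<or> (\<exists>s. y = [s] \<and> irred s)"
          by auto
        have "[t] = plug (c # cs) y"
          using c(3) v cs(2) plug_append[of "[c]" cs y] by simp
        then show ?thesis
          using c(1) cs by (intro bexI[of _ "c # cs"] exI[of _ y]) simp_all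
      qed
    qed
  qed
  have side_down: "side s" if s: "side t" "temb s t" for s t
  proof -
    obtain b where "([t], b, []) \<in> C \<or> ([], b, [t]) \<in> C"
      using s(1) unfolding side_def by auto
    then have "([s], b, []) \<in> C \<or> ([], b, [s]) \<in> C"
      using C_down[of "([t], b, [])" "([s], b, [])"] C_down[of "([], b, [t])" "([], b, [s])"] s(2) by auto
    then show ?thesis
      unfolding side_def by auto
  qed
  have core: "emb [s] x" if s: "irred s" "\<not> side s" and "cs \<in> lists C" "emb [s] (plug cs x)" and x: "length x \<le> 1" for s cs x
    using that(3,4)
  proof (induction cs rule: list.induct)
    case (Cons c cs)
    obtain l b r where c: "c = (l, b, r)"
      by (cases c)
    then have cC: "(l, b, r) \<in> C"
      using Cons.prems(1) by simp
    have "temb s (Node b (l @ plug cs x @ r))"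
      using Cons.prems(2) c by (auto dest: list_emb_singletonD)
    then show ?case
    proof cases
      \<comment> \<open>If the root of \<open>s\<close> is matched with the node of the frame, then
        \<open>s\<close> is itself a frame of \<open>C\<close> around at most one tree.\<close>
      case (temb_node f)
      then obtain f1 f2 f3 where f: "f = f1 @ f2 @ f3" "emb f1 l" "emb f2 (plug cs x)" "emb f3 r"
        using list_emb_append3_rightD[of temb f] by blast
      have "length f2 \<le> 1"
        using list_emb_length[OF f(3)] length_plug[OF x, of cs] by simp
      moreover have "(f1, b, f3) \<in> C"
        using C_down[OF cC] f(2,4) by simp
      moreover have "[s] = plug [(f1, b, f3)] f2"
        using temb_node f(1) by simp
      ultimately show ?thesis
        using s(1) unfolding irred_def by blast
    next
      case (temb_sub t)
      then consider "t \<in> set l" | "t \<in> set r" | "t \<in> set (plug cs x)"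
        by auto
      then show ?thesis
      proof cases
        case 1
        then have "frame_le ([s], b, []) (l, b, r)"
          using temb_sub(1) by (auto simp: list_emb_single_iff)
        then show ?thesis
          using C_down[OF cC] s(2) unfolding side_def by blast
      next
        case 2
        then have "frame_le ([], b, [s]) (l, b, r)"
          using temb_sub(1) by (auto simp: list_emb_single_iff)
        then show ?thesis
          using C_down[OF cC] s(2) unfolding side_def by blast
      next
        case 3
        then have "emb [s] (plug cs x)"
          using temb_sub(1) by (auto simp: list_emb_single_iff)
        then show ?thesis
          using Cons by simp
      qed
    qed
  qed simp
  have "C \<noteq> {}"
    using a0_C by auto
  from frames_eventually_absorbed[OF this] obtain u N where u: "u \<in> lists C"
    and N: "\<forall>ys \<in> lists C. \<forall>s. list_emb frame_le (wpow N u) ys \<longrightarrow> length s \<le> 1 \<longrightarrow>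
        syn L (plug ys s) = syn L (plug (wpow \<omega> u) s)"
    and u_absorb: "\<forall>ys \<in> lists C. \<forall>s. length s \<le> 1 \<longrightarrow>
        syn L (plug (wpow \<omega> u @ ys) s) = syn L (plug (wpow \<omega> u) s)"
    by (elim bexE exE conjE) (rule that)
  \<comment> \<open>The frames of \<open>t\<close> around the image of \<open>s'\<close> belong to
    \<open>C\<close> and have the effect of u^\<omega>, which also absorbs the frames from that
    image down to its core \<open>x\<close>. Irreducible trees below \<open>s'\<close> that are not
    \<open>side\<close> survive in the core.\<close>
  have reduce: "\<exists>x. syn L [t] = syn L (plug (wpow \<omega> u) x) \<and> (x = [] \<or> (\<exists>s. x = [s] \<and> irred s \<and> s \<in> T)) \<and>
      (\<forall>s. irred s \<longrightarrow> \<not> side s \<longrightarrow> temb s s' \<longrightarrow> emb [s] x)"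
    if s': "s' \<in> T" "temb w s'" and v: "[v] = plug (wpow N u) [s']" and t: "t \<in> T" "temb v t" for s' v t
  proof -
    have "emb (plug (wpow N u) [s']) [t]"
      unfolding v[symmetric] using t(2) by simp
    from temb_plug_decompose[OF this] obtain ys q where ys: "[t] = plug ys [q]"
      "list_emb frame_le (wpow N u) ys" "temb s' q"
      by auto
    have "ys \<in> lists C"
      using frames_C[OF temb_trans[OF s'(2) ys(3)] ys(1) t(1)] .
    then have 1: "syn L [t] = syn L (plug (wpow \<omega> u) [q])"
      using N ys(1,2) by simp
    obtain cs x where x: "cs \<in> lists C" "[q] = plug cs x" "x = [] \<or> (\<exists>s. x = [s] \<and> irred s)"
      using decompose[of q] by auto
    have len: "length x \<le> 1"
      using x(3) by auto
    have 2: "syn L (plug (wpow \<omega> u) [q]) = syn L (plug (wpow \<omega> u) x)"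
      using u_absorb x(1) len by (simp add: x(2) plug_append)
    have "s \<in> T" if "x = [s]" for s
    proof -
      have "temb s q"
        using temb_plug x(2) that by simp
      then show ?thesis
        using order_ideal_down[OF T t(1)] temb_plug[OF ys(1)] temb_trans by blast
    qed
    moreover have "emb [s] x" if s: "irred s" "\<not> side s" "temb s s'" for s
    proof (rule core[OF s(1,2) x(1) _ len])
      show "emb [s] (plug cs x)"
        unfolding x(2)[symmetric] using temb_trans[OF s(3) ys(3)] by simp
    qed
    ultimately show ?thesis
      using 1 2 x(3) by (intro exI[of _ x]) auto
  qed
  \<comment> \<open>Under u^\<omega> such a tree counts as nothing: u^\<omega> absorbs the bare
    frame \<open>b\<close> put around \<open>s\<close>, and the tree b(s) is also a frame with
    \<open>s\<close> beside the hole, filled with the empty forest.\<close>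
  have side_zero: "syn L (plug (wpow \<omega> u) [s]) = syn L (plug (wpow \<omega> u) [])" if s: "side s" for s
  proof -
    obtain b where b: "([s], b, []) \<in> C \<or> ([], b, [s]) \<in> C"
      using s unfolding side_def by auto
    then have "([], b, []) \<in> C"
      using C_down[of _ "([], b, [])"] by auto
    then have "syn L (plug (wpow \<omega> u) [s]) = syn L (plug (wpow \<omega> u @ [([], b, [])]) [s])"
      using u_absorb by simp
    also have "\<dots> = syn L (plug (wpow \<omega> u) [Node b [s]])"
      by (simp add: plug_append)
    also have "\<dots> = syn L (plug (wpow \<omega> u) [])"
      using b
    proof
      assume "([s], b, []) \<in> C"
      then have "syn L (plug (wpow \<omega> u @ [([s], b, [])]) []) = syn L (plug (wpow \<omega> u) [])"
        using u_absorb by simp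
      then show ?thesis
        by (simp add: plug_append)
    next
      assume "([], b, [s]) \<in> C"
      then have "syn L (plug (wpow \<omega> u @ [([], b, [s])]) []) = syn L (plug (wpow \<omega> u) [])"
        using u_absorb by simp
      then show ?thesis
        by (simp add: plug_append)
    qed
    finally show ?thesis .
  qed
  \<comment> \<open>The cores that matter. If there are none, every core has the effect of the empty
    one; otherwise they generate an ideal \<open>R\<close> smaller than \<open>T\<close>, to which
    the induction hypothesis applies.\<close>
  define M where "M = {s \<in> T. irred s \<and> \<not> side s}"
  show ?thesis
  proof (cases "M = {}")
    case True
    obtain v where v: "[v] = plug (wpow N u) [w]"
      using plug_single[of "wpow N u" w] by metis
    have "v \<in> T"
      using plug_T[OF w(1) wpow_in_lists[OF u] v] .
    then show ?thesis
    proof (rule eventually_constantI)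
      fix t assume "t \<in> T" "temb v t"
      from reduce[OF w(1) temb_refl v this] obtain x where
        x: "syn L [t] = syn L (plug (wpow \<omega> u) x)" "x = [] \<or> (\<exists>s. x = [s] \<and> irred s \<and> s \<in> T)"
        by auto
      from x(2) have "x = [] \<or> (\<exists>s. x = [s] \<and> side s)"
        using True unfolding M_def by auto
      then show "syn L [t] = syn L (plug (wpow \<omega> u) [])"
        using x(1) side_zero by auto
    qed
  next
    case False
    define R where "R = {r. \<exists>s \<in> M. temb r s}"
    have M_up: "\<exists>s. x = [s] \<and> s \<in> M \<and> temb m s"
      if "m \<in> M" "emb [m] x" "x = [] \<or> (\<exists>s. x = [s] \<and> irred s \<and> s \<in> T)" for m x
      using that side_down unfolding M_def by (auto dest: list_emb_singletonD)
    have "order_ideal temb R"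
      unfolding order_ideal_def
    proof (intro conjI ballI)
      show "R \<noteq> {}"
        using False temb_refl unfolding R_def by blast
      show "downset temb R"
        unfolding downset_def R_def using temb_trans by blast
    next
      fix r1 r2 assume "r1 \<in> R" "r2 \<in> R"
      then obtain m1 m2 where m: "m1 \<in> M" "m2 \<in> M" "temb r1 m1" "temb r2 m2"
        unfolding R_def by auto
      \<comment> \<open>The core of a common upper bound in \<open>T\<close> is above
        \<open>m1\<close> and \<open>m2\<close> and belongs to \<open>M\<close>.\<close>
      obtain t where t: "t \<in> T" "temb m1 t" "temb m2 t"
        using order_ideal_directed[OF T, of m1 m2] m unfolding M_def by auto
      obtain cs x where x: "cs \<in> lists C" "[t] = plug cs x" "x = [] \<or> (\<exists>s. x = [s] \<and> irred s)"
        using decompose[of t] by auto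
      have x': "x = [] \<or> (\<exists>s. x = [s] \<and> irred s \<and> s \<in> T)"
        using x(2,3) order_ideal_down[OF T t(1) temb_plug[of t cs]] by auto
      have emb: "emb [m] x" if "m \<in> M" "temb m t" for m
      proof (rule core[OF _ _ x(1)])
        show "emb [m] (plug cs x)"
          unfolding x(2)[symmetric] using that(2) by simp
      qed (use that x(3) in \<open>auto simp: M_def\<close>)
      obtain s where "x = [s]" "s \<in> M" "temb m1 s"
        using M_up[OF m(1) emb[OF m(1) t(2)] x'] by auto
      moreover from this have "temb m2 s"
        using emb[OF m(2) t(3)] by (auto dest: list_emb_singletonD)
      ultimately show "\<exists>z \<in> R. temb r1 z \<and> temb r2 z"
        using temb_trans[OF m(3)] temb_trans[OF m(4)] temb_refl unfolding R_def by blast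
    qed
    moreover have "R \<subseteq> T"
      unfolding R_def M_def using order_ideal_down[OF T] by auto
    \<comment> \<open>If \<open>R\<close> were \<open>T\<close>, then for some \<open>m\<close> in
      \<open>M\<close> above \<open>w\<close> the tree a0(m) would lie below some \<open>s\<close>
      in \<open>M\<close>; but then \<open>s\<close> starts with a frame of \<open>C\<close> and is
      reducible.\<close>
    moreover have "R \<noteq> T"
    proof
      assume "R = T"
      then obtain m where m: "m \<in> M" "temb w m"
        using w(1) unfolding R_def by auto
      then have "Node a0 [m] \<in> R"
        using a0 \<open>R = T\<close> unfolding M_def by auto
      then obtain s where s: "s \<in> M" "temb (Node a0 [m]) s"
        unfolding R_def by auto
      have "emb (plug [([], a0, [])] [m]) [s]"
        using s(2) by simp
      from temb_plug_decompose[OF this] obtain gs q where gs: "[s] = plug gs [q]"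
        "list_emb frame_le [([], a0, [])] gs" "temb m q"
        by auto
      obtain c cs where c: "gs = c # cs"
        using gs(2) by (cases gs) auto
      have "gs \<in> lists C"
        using frames_C[OF temb_trans[OF m(2) gs(3)] gs(1)] s(1) unfolding M_def by auto
      moreover have "[s] = plug [c] (plug cs [q])" "length (plug cs [q]) \<le> 1"
        using gs(1) c plug_append[of "[c]" cs "[q]"] length_plug[of "[q]" cs] by simp_all
      ultimately have "\<not> irred s"
        using c unfolding irred_def by auto
      then show False
        using s(1) unfolding M_def by simp
    qed
    ultimately have "eventually_constant temb R (\<lambda>t. syn L [t])"
      using IH by blast
    then obtain r k where r: "r \<in> R" "\<forall>x \<in> R. temb r x \<longrightarrow> syn L [x] = k"
      unfolding eventually_constant_def by auto
    then obtain m where m: "m \<in> M" "temb r m"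
      unfolding R_def by auto
    \<comment> \<open>Choosing \<open>s'\<close> above both \<open>w\<close> and \<open>m\<close>
      forces the core of every tree above \<open>v\<close> to lie above \<open>m\<close>, hence
      above \<open>r\<close>.\<close>
    obtain s' where s': "s' \<in> T" "temb w s'" "temb m s'"
      using order_ideal_directed[OF T, of w m] w(1) m(1) unfolding M_def by auto
    obtain v where v: "[v] = plug (wpow N u) [s']"
      using plug_single[of "wpow N u" s'] by metis
    have "v \<in> T"
      using plug_T[OF s'(1) wpow_in_lists[OF u] v] .
    then show ?thesis
    proof (rule eventually_constantI)
      fix t assume "t \<in> T" "temb v t"
      from reduce[OF s'(1,2) v this] obtain x where
        x: "syn L [t] = syn L (plug (wpow \<omega> u) x)" "x = [] \<or> (\<exists>s. x = [s] \<and> irred s \<and> s \<in> T)"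
        "\<forall>s. irred s \<longrightarrow> \<not> side s \<longrightarrow> temb s s' \<longrightarrow> emb [s] x"
        by auto
      have "emb [m] x"
        using x(3) m(1) s'(3) unfolding M_def by auto
      then obtain s where s: "x = [s]" "s \<in> M" "temb m s"
        using M_up[OF m(1) _ x(2)] by auto
      have "s \<in> R"
        using s(2) temb_refl unfolding R_def by blast
      then have k: "syn L [s] = k"
        using r(2) temb_trans[OF m(2) s(3)] by blast
      have "syn L [t] = syn L (fill (frames_ctx (wpow \<omega> u)) [s])"
        using x(1) s(1) by simp
      then show "syn L [t] = syn_act L (syn_ctx L (frames_ctx (wpow \<omega> u))) k"
        unfolding syn_fill k .
    qed
  qed
qed

section \<open>The characterization\<close>

lemma ideal_eventually_constant: "order_ideal emb I \<Longrightarrow> eventually_constant emb I (syn L)"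
proof -
  let ?r = "inv_image ({(A, B). A \<subset> B \<and> downset temb A \<and> downset temb B} <*lex*>
      {(A, B). A \<subset> B \<and> downset emb A \<and> downset emb B}) (\<lambda>I :: 'a forest set. ({t. [t] \<in> I}, I))"
  have "wf ?r"
    by (intro wf_inv_image wf_lex_prod wf_psubset_downsets almost_full_on_temb almost_full_on_emb)
  then show "order_ideal emb I \<Longrightarrow> eventually_constant emb I (syn L)"
  proof (induction I rule: wf_induct_rule)
    case (less I)
    note I = less.prems
    have down: "downset emb J" "downset temb {t. [t] \<in> J}" if "order_ideal emb J" for J :: "'a forest set"
      using that downset_trees unfolding order_ideal_def by auto
    have IH_trees: "eventually_constant emb J (syn L)"
      if "order_ideal emb J" "{t. [t] \<in> J} \<subset> {t. [t] \<in> I}" for J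
      using that down[OF that(1)] down[OF I] by (intro less.IH) auto
    have IH: "eventually_constant emb J (syn L)" if J: "order_ideal emb J" "J \<subset> I" for J
    proof (cases "{t. [t] \<in> J} = {t. [t] \<in> I}")
      case True
      then show ?thesis
        using J down[OF J(1)] down[OF I] by (intro less.IH) auto
    next
      case False
      then show ?thesis
        using J by (intro IH_trees) auto
    qed
    have Nil: "[] \<in> I"
      using I order_ideal_down[OF I _ list_emb_Nil] unfolding order_ideal_def by blast
    have hd_tl: "[t] \<in> I" "f \<in> I" if "t # f \<in> I" for t f
      using order_ideal_down[OF I that] by (auto simp: list_emb_Cons)
    define res where "res b = {y. b # y \<in> I}" for b
    \<comment> \<open>Each residual of a tree in \<open>I\<close> contains \<open>[]\<close> and is
      contained in \<open>I\<close>. Either one of them lies strictly between the extremes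
      \<open>{[]}\<close> and \<open>I\<close>, or both extremes occur, or only one does; if it is
      \<open>{[]}\<close>, the forests of \<open>I\<close> have at most one tree.\<close>
    consider (closed) "\<forall>b. [b] \<in> I \<longrightarrow> res b = I" "\<exists>b. [b] \<in> I"
      | (split) b where "[b] \<in> I" "res b \<noteq> I" "res b \<noteq> {[]}"
      | (last) c t0 where "[c] \<in> I" "res c = I" "[t0] \<in> I" "res t0 = {[]}"
      | (single) "\<forall>b. [b] \<in> I \<longrightarrow> res b = {[]}"
      by blast
    then show ?case
    proof cases
      case closed
      have "x @ y \<in> I" if "x \<in> I" "y \<in> I" for x y
        using that(1)
      proof (induction x)
        case (Cons t x)
        then show ?case
          using closed(1) hd_tl[of t x] unfolding res_def by auto
      qed (simp add: that(2))
      then show ?thesis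
        using concat_closed_eventually_constant[OF I] closed(2) by blast
    next
      case split
      then show ?thesis
        using residual_split_eventually_constant[OF I _ _ _ IH] unfolding res_def by blast
    next
      case last
      then show ?thesis
        using last_split_eventually_constant[OF I _ _ _ _ IH] unfolding res_def by blast
    next
      case single
      define T where "T = {t. [t] \<in> I}"
      have sing: "f = [] \<or> (\<exists>t \<in> T. f = [t])" if "f \<in> I" for f
      proof (cases f)
        case (Cons t g)
        then have "[t] \<in> I" "g \<in> res t"
          using that hd_tl unfolding res_def by auto
        then show ?thesis
          using single Cons unfolding T_def by auto
      qed simp
      show ?thesis
      proof (cases "T = {}")
        case True
        show ?thesis
          by (rule eventually_constantI[OF Nil, where c = "syn L []"]) (use sing True in auto)
      next
        case False
        have T: "order_ideal temb T"
          unfolding order_ideal_def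
        proof (intro conjI ballI)
          show "downset temb T"
            unfolding T_def using down[OF I] by blast
          fix s t assume "s \<in> T" "t \<in> T"
          then obtain f where f: "f \<in> I" "emb [s] f" "emb [t] f"
            using order_ideal_directed[OF I, of "[s]" "[t]"] unfolding T_def by auto
          then show "\<exists>u \<in> T. temb s u \<and> temb t u"
            using sing[OF f(1)] by (auto dest: list_emb_singletonD)
        qed (rule False)
        have "eventually_constant temb T (\<lambda>t. syn L [t])"
        proof (cases "\<exists>a. \<forall>t \<in> T. Node a [t] \<in> T")
          case True
          then obtain a where a: "\<And>t. t \<in> T \<Longrightarrow> Node a [t] \<in> T"
            by auto
          show ?thesis
          proof (rule iterated_eventually_constant[OF T a])
            fix R assume R: "order_ideal temb R" "R \<subset> T"
            \<comment> \<open>The induction hypothesis speaks about ideals of forests, so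
              \<open>R\<close> is encoded by the empty forest and the single trees from
              \<open>R\<close>.\<close>
            define J where "J = {f. length f \<le> 1 \<and> set f \<subseteq> R}"
            have J_iff: "f \<in> J \<longleftrightarrow> f = [] \<or> (\<exists>t \<in> R. f = [t])" for f
              unfolding J_def by (cases f) auto
            have trees_J: "{t. [t] \<in> J} = R"
              by (auto simp: J_iff)
            have "order_ideal emb J"
              unfolding order_ideal_def
            proof (intro conjI ballI)
              show "J \<noteq> {}"
                by (auto simp: J_iff)
              show "downset emb J"
                unfolding downset_def J_iff using order_ideal_down[OF R(1)]
                by (auto dest!: list_emb_singletonD)
            next
              fix f g assume fg: "f \<in> J" "g \<in> J"
              obtain r0 where r0: "r0 \<in> R"
                using R(1) unfolding order_ideal_def by auto
              have "\<exists>t \<in> R. emb f [t]" if "f \<in> J" for f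
                using that r0 unfolding J_iff by (metis emb_refl list_emb_Nil)
              then obtain s t where st: "s \<in> R" "t \<in> R" "emb f [s]" "emb g [t]"
                using fg by blast
              then obtain u where u: "u \<in> R" "temb s u" "temb t u"
                using order_ideal_directed[OF R(1), of s t] by auto
              then have "emb f [u]" "emb g [u]"
                using emb_trans[OF st(3), of "[u]"] emb_trans[OF st(4), of "[u]"] by simp_all
              then show "\<exists>z \<in> J. emb f z \<and> emb g z"
                using u(1) by (intro bexI[of _ "[u]"]) (auto simp: J_iff)
            qed
            then have "eventually_constant emb J (syn L)"
              using R(2) trees_J by (intro IH_trees) (auto simp: T_def)
            then obtain z k where z: "z \<in> J" "\<forall>f \<in> J. emb z f \<longrightarrow> syn L f = k"
              unfolding eventually_constant_def by auto
            obtain r0 where "r0 \<in> R"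
              using R(1) unfolding order_ideal_def by auto
            then obtain r where r: "r \<in> R" "emb z [r]"
              using z(1) unfolding J_iff by auto
            show "eventually_constant temb R (\<lambda>t. syn L [t])"
            proof (rule eventually_constantI[OF r(1)])
              fix t assume t: "t \<in> R" "temb r t"
              then have "emb [r] [t]"
                by simp
              then show "syn L [t] = k"
                using z(2) t(1) emb_trans[OF r(2)] by (auto simp: J_iff)
            qed
          qed
        next
          case False
          then show ?thesis
            using root_fixed_eventually_constant[OF T] IH_trees unfolding T_def by blast
        qed
        then obtain w k where w: "w \<in> T" "\<forall>t \<in> T. temb w t \<longrightarrow> syn L [t] = k"
          unfolding eventually_constant_def by auto
        show ?thesis
        proof (rule eventually_constantI)
          show "[w] \<in> I"
            using w(1) by (simp add: T_def)
          show "syn L f = k" if f: "f \<in> I" "emb [w] f" for f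
            using sing[OF f(1)] f(2) w(2) by (auto dest: list_emb_singletonD)
        qed
      qed
    qed
  qed
qed

lemma cca_piecewise_testable: "cca_piecewise_testable L"
proof (rule ccontr)
  assume not: "\<not> cca_piecewise_testable L"
  have "\<forall>n. \<exists>t. \<exists>t'. cca_pieces_upto (Suc n) t = cca_pieces_upto (Suc n) t' \<and> t \<in> L \<and> t' \<notin> L"
  proof
    fix n
    have "\<not> (\<forall>t t'. cca_pieces_upto (Suc n) t = cca_pieces_upto (Suc n) t' \<longrightarrow> (t \<in> L \<longleftrightarrow> t' \<in> L))"
      using not unfolding cca_piecewise_testable_def by blast
    then show "\<exists>t. \<exists>t'. cca_pieces_upto (Suc n) t = cca_pieces_upto (Suc n) t' \<and> t \<in> L \<and> t' \<notin> L"
      by metis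
  qed
  from choice[OF this] obtain f :: "nat \<Rightarrow> 'a forest"
    where "\<forall>n. \<exists>t'. cca_pieces_upto (Suc n) (f n) = cca_pieces_upto (Suc n) t' \<and> f n \<in> L \<and> t' \<notin> L" ..
  from choice[OF this] obtain g :: "nat \<Rightarrow> 'a forest"
    where fg: "\<forall>n. cca_pieces_upto (Suc n) (f n) = cca_pieces_upto (Suc n) (g n) \<and> f n \<in> L \<and> g n \<notin> L" ..
  have pieces: "emb x (f n) \<longleftrightarrow> emb x (g n)" if "card (nodes x) \<le> n" for x n
  proof -
    have "x \<in> cca_pieces_upto (Suc n) (f n) \<longleftrightarrow> x \<in> cca_pieces_upto (Suc n) (g n)"
      using fg by simp
    then show ?thesis
      using that unfolding cca_pieces_upto_def cca_piece_iff_emb by simp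
  qed
  obtain h1 :: "nat \<Rightarrow> nat" where h1: "strict_mono h1" "\<forall>i j. i < j \<longrightarrow> emb (f (h1 i)) (f (h1 j))"
    using almost_full_on_monotone_subseq[OF almost_full_on_emb transp_emb, of f] by blast
  obtain h2 :: "nat \<Rightarrow> nat"
    where h2: "strict_mono h2" "\<forall>i j. i < j \<longrightarrow> emb (g (h1 (h2 i))) (g (h1 (h2 j)))"
    using almost_full_on_monotone_subseq[OF almost_full_on_emb transp_emb, of "\<lambda>i. g (h1 i)"] by blast
  define h where "h i = h1 (h2 i)" for i
  have h: "strict_mono h"
    using h1(1) h2(1) by (simp add: h_def strict_mono_def)
  then have h_ge: "i \<le> h i" for i
    by (rule strict_mono_imp_increasing)
  have f_mono: "emb (f (h i)) (f (h j))" if "i \<le> j" for i j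
  proof (cases "i = j")
    case False
    then have "h2 i < h2 j"
      using that h2(1) by (simp add: strict_mono_def)
    then show ?thesis
      using h1(2) by (simp add: h_def)
  qed simp
  have g_mono: "emb (g (h i)) (g (h j))" if "i \<le> j" for i j
  proof (cases "i = j")
    case False
    then show ?thesis
      using that h2(2) by (simp add: h_def)
  qed simp
  define I where "I = {x. \<exists>i. emb x (f (h i))}"
  have "order_ideal emb I"
    unfolding order_ideal_def
  proof (intro conjI ballI)
    show "I \<noteq> {}"
      unfolding I_def using emb_refl by blast
    show "downset emb I"
      unfolding downset_def I_def using emb_trans by blast
    fix x y assume "x \<in> I" "y \<in> I"
    then obtain i j where "emb x (f (h i))" "emb y (f (h j))"
      unfolding I_def by auto
    then have "emb x (f (h (max i j)))" "emb y (f (h (max i j)))"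
      using emb_trans f_mono[of i "max i j"] f_mono[of j "max i j"] by auto
    moreover have "f (h (max i j)) \<in> I"
      unfolding I_def using emb_refl by blast
    ultimately show "\<exists>z \<in> I. emb x z \<and> emb y z"
      by blast
  qed
  from ideal_eventually_constant[OF this] obtain w c where w: "w \<in> I"
    "\<forall>x \<in> I. emb w x \<longrightarrow> syn L x = c"
    unfolding eventually_constant_def by auto
  then obtain i where i: "emb w (f (h i))"
    unfolding I_def by auto
  have "f (h i) \<in> I"
    unfolding I_def using emb_refl by blast
  then have f_c: "syn L (f (h i)) = c"
    using w(2) i by blast
  \<comment> \<open>The sequences interleave: \<open>f (h i)\<close> is small enough to be a piece
    of \<open>g (h j)\<close>, which in turn will be a piece of \<open>f (h k)\<close>. So
    \<open>g (h j)\<close> lies in \<open>I\<close> and above \<open>w\<close>.\<close>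
  define j where "j = max i (card (nodes (f (h i))))"
  have "card (nodes (f (h i))) \<le> h j"
    using h_ge[of j] by (simp add: j_def)
  then have "emb (f (h i)) (g (h j))"
    using pieces f_mono[of i j] by (simp add: j_def)
  then have wg: "emb w (g (h j))"
    using emb_trans[OF i] by blast
  define k where "k = max j (card (nodes (g (h j))))"
  have "card (nodes (g (h j))) \<le> h k"
    using h_ge[of k] by (simp add: k_def)
  then have "emb (g (h j)) (f (h k))"
    using pieces g_mono[of j k] by (simp add: k_def)
  then have "g (h j) \<in> I"
    unfolding I_def by blast
  then have "syn L (g (h j)) = syn L (f (h i))"
    using w(2) wg f_c by blast
  then have "fill empty_ctx (g (h j)) \<in> L \<longleftrightarrow> fill empty_ctx (f (h i)) \<in> L"
    unfolding syn_eq_iff syn_rel_def by blast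
  then show False
    using fg by simp
qed

end

lemma frames_ctx_wpow: "frames_ctx (wpow n us) = (ctx_comp (frames_ctx us) ^^ n) empty_ctx"
  by (induction n) (simp_all add: frames_ctx_append)

lemma fill_Hole_pow: "(fill (Hole t []) ^^ n) [] = wpow n t"
  by (induction n) simp_all

theorem theorem20:
  fixes L :: "'a::finite forest set" and \<omega> :: nat
  assumes "regular L"
    and "\<omega> > 0"
    and "\<And>v. v \<in> carrier (syn_V L) \<Longrightarrow> is_idempotent (syn_V L) (v [^]\<^bsub>syn_V L\<^esub> \<omega>)"
    and "\<And>h. h \<in> carrier (syn_H L) \<Longrightarrow> is_idempotent (syn_H L) (h [^]\<^bsub>syn_H L\<^esub> \<omega>)"
  shows "cca_piecewise_testable L \<longleftrightarrow>
     (\<forall>h \<in> carrier (syn_H L). \<forall>u \<in> carrier (syn_V L). \<forall>v \<in> carrier (syn_V L).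
        (tree_type L h \<or> h = \<one>\<^bsub>syn_H L\<^esub>) \<and> tree_ctx_type L u \<and> tree_ctx_type L v \<and>
        V_piece L v u \<longrightarrow>
          syn_act L (u [^]\<^bsub>syn_V L\<^esub> \<omega>) h = syn_act L (u [^]\<^bsub>syn_V L\<^esub> \<omega> \<otimes>\<^bsub>syn_V L\<^esub> v) h \<and>
          syn_act L (u [^]\<^bsub>syn_V L\<^esub> \<omega> \<otimes>\<^bsub>syn_V L\<^esub> v) h =
            syn_act L (v \<otimes>\<^bsub>syn_V L\<^esub> u [^]\<^bsub>syn_V L\<^esub> \<omega>) h) \<and>
     (\<forall>g \<in> carrier (syn_H L). \<forall>h \<in> carrier (syn_H L).
        H_piece L g h \<longrightarrow>
          h [^]\<^bsub>syn_H L\<^esub> \<omega> = h [^]\<^bsub>syn_H L\<^esub> \<omega> \<otimes>\<^bsub>syn_H L\<^esub> g \<and>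
          h [^]\<^bsub>syn_H L\<^esub> \<omega> \<otimes>\<^bsub>syn_H L\<^esub> g = g \<otimes>\<^bsub>syn_H L\<^esub> h [^]\<^bsub>syn_H L\<^esub> \<omega>)"
    (is "_ \<longleftrightarrow> ?V \<and> ?H")
proof
  assume "cca_piecewise_testable L"
  then obtain n where n: "testable_at n L" "n > 0"
    unfolding cca_piecewise_testable_def testable_at_def by auto
  have ?V
    using testable_imp_V_identity[OF n assms(2,3)] by (intro ballI impI) (elim conjE, simp only: simp_thms)
  moreover have ?H
    using testable_imp_H_identity[OF n assms(2,4)] by (intro ballI impI) (simp only: simp_thms)
  ultimately show "?V \<and> ?H" ..
next
  assume VH: "?V \<and> ?H"
  interpret absorbing L \<omega>
  proof
    show "regular L"
      by (rule assms)
  next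
    fix us vs :: "'a frame list" and t :: "'a forest"
    assume t: "length t \<le> 1" and uv: "us \<noteq> []" "vs \<noteq> []"
      and piece: "V_piece L (syn_ctx L (frames_ctx vs)) (syn_ctx L (frames_ctx us))"
    have "tree_type L (syn L t) \<or> syn L t = \<one>\<^bsub>syn_H L\<^esub>"
      using emb_Nil_or_single[OF t] unfolding tree_type_def is_tree_def one_syn_H by auto
    moreover have "tree_ctx_type L (syn_ctx L (frames_ctx us))" "tree_ctx_type L (syn_ctx L (frames_ctx vs))"
      using is_tree_ctx_frames_ctx uv unfolding tree_ctx_type_def by blast+
    moreover have "syn L t \<in> carrier (syn_H L)" "syn_ctx L (frames_ctx us) \<in> carrier (syn_V L)"
      "syn_ctx L (frames_ctx vs) \<in> carrier (syn_V L)"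
      by (simp_all add: carrier_syn_H carrier_syn_V)
    ultimately have "syn_act L (syn_ctx L (frames_ctx us) [^]\<^bsub>syn_V L\<^esub> \<omega>) (syn L t) =
        syn_act L (syn_ctx L (frames_ctx us) [^]\<^bsub>syn_V L\<^esub> \<omega> \<otimes>\<^bsub>syn_V L\<^esub> syn_ctx L (frames_ctx vs)) (syn L t)"
      "syn_act L (syn_ctx L (frames_ctx us) [^]\<^bsub>syn_V L\<^esub> \<omega> \<otimes>\<^bsub>syn_V L\<^esub> syn_ctx L (frames_ctx vs)) (syn L t) =
        syn_act L (syn_ctx L (frames_ctx vs) \<otimes>\<^bsub>syn_V L\<^esub> syn_ctx L (frames_ctx us) [^]\<^bsub>syn_V L\<^esub> \<omega>) (syn L t)"
      using VH piece by blast+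
    then show "syn L (plug (wpow \<omega> us @ vs) t) = syn L (plug (wpow \<omega> us) t) \<and>
        syn L (plug (vs @ wpow \<omega> us) t) = syn L (plug (wpow \<omega> us) t)"
      unfolding syn_ctx_pow frames_ctx_wpow[symmetric] by (simp add: plug_append)
  next
    fix s t :: "'a forest"
    assume piece: "H_piece L (syn L s) (syn L t)"
    have "syn L t [^]\<^bsub>syn_H L\<^esub> \<omega> = syn L t [^]\<^bsub>syn_H L\<^esub> \<omega> \<otimes>\<^bsub>syn_H L\<^esub> syn L s \<and>
      syn L t [^]\<^bsub>syn_H L\<^esub> \<omega> \<otimes>\<^bsub>syn_H L\<^esub> syn L s = syn L s \<otimes>\<^bsub>syn_H L\<^esub> syn L t [^]\<^bsub>syn_H L\<^esub> \<omega>"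
      by (rule conjunct2[OF VH, THEN bspec, THEN bspec, THEN mp])
        (use piece in \<open>simp_all add: carrier_syn_H\<close>)
    then show "syn L (wpow \<omega> t @ s) = syn L (wpow \<omega> t) \<and> syn L (s @ wpow \<omega> t) = syn L (wpow \<omega> t)"
      unfolding syn_pow fill_Hole_pow by simp
  qed
  show "cca_piecewise_testable L"
    by (rule cca_piecewise_testable)
qed

end
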